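(* Let $\epsilon\in\{0,-1\}$ and let $n\ge2$ be an even integer. Then the following assertions hold. (i) There exists a rotational strictly convex $n$-translator $\Sigma_0$ in $\mathbb Q_\epsilon^n\times\mathbb R$ (called the $n$-bowl soliton) which is a vertical graph over an open ball $B_R(o)\subset\Pi_0$ of radius $R>0$. Moreover, $\Sigma_0$ is contained in the closed half-space $\mathbb Q_\epsilon^n\times[0,+\infty)$ with unbounded height, and is asymptotic to $\partial B_R(o)\times\mathbb R$. (ii) There exists a one-parameter family $\mathscr K_n=\{\mathcal K_\lambda\,;\,0<\lambda<1\}$ of properly embedded rotational half-cones in $\mathbb Q_\epsilon^n\times\mathbb R$ with vertex at $o\in\mathbb Q_\epsilon^n\times\{0\}$ (called peaked $n$-bowl solitons), which are all $n$-translators. Any $\mathcal K_\lambda\in\mathscr K_n$ is a vertical graph defined on an open ball $B_R(o)\subset\mathbb Q_\epsilon^n\times\{0\}$ of radius $R=R(\epsilon,n,\lambda)$ with a conical singularity at $o$. In addition, $\mathcal K_\lambda$ has the following properties: - It is contained in a half-space and its height function is unbounded from above. - It is vertically asymptotic to the cylinder $\partial B_R(o)\times\mathbb R$, and its angle function $\Theta_\lambda$ satisfies $\lim_{s\to0}\Theta_\lambda^2(s)=1-\lambda^2$. (iii) There exists a one-parameter family $\mathscr G_n=\{\Sigma_\mu\,;\,\mu>0\}$ of properly embedded rotational $n$-translators in $\mathbb Q_\epsilon^n\times\mathbb R$ (called $n$-grim reapers) with nonempty boundary. Each $\Sigma_\mu\in\mathscr G_n$ is a vertical graph over an annulus $B_R(o)-B_\mu(o)$,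 $R=R(\epsilon,n,\mu)>\mu$, and has the following properties: - It is contained in a half-space, and its height function is unbounded from above. - It is vertically asymptotic to the cylinder $\partial B_R(o)\times\mathbb R$ and tangent to $\mathbb Q_\epsilon^n\times\{0\}$ along its boundary $\partial\Sigma_\mu=\partial B_\mu(o)$.
   Context: $\mathbb Q_0^n=\mathbb R^n$ and $\mathbb Q_{-1}^n=\mathbb H^n$; $\mathbb Q_\epsilon^n\times\mathbb R$ carries the product metric, $\partial_t$ is the unit vertical field (gradient of the projection onto $\mathbb R$), $\Pi_0=\mathbb Q_\epsilon^n\times\{0\}$ is identified with $\mathbb Q_\epsilon^n$. The height function of a hypersurface is the restriction of the projection onto $\mathbb R$. For an oriented hypersurface $\Sigma$ with unit normal $N$, the shape operator is $AX=-\overline\nabla_XN$ ($\overline\nabla$ the ambient Levi-Civita connection), with principal curvatures $k_1,\dots,k_n$; $H_n=k_1\cdots k_n$ is the Gaussian curvature and $\Theta=\langle N,\partial_t\rangle$ is the angle function. Hypersurfaces are of class at least $C^2$ except possibly on a set $\Lambda$ of null measure, where they are only of class $C^1$ (and $\Sigma$ is said to be $C^2$-singular on $\Lambda$). $\Sigma$ is an $n$-translator (translator to the Gaussian curvature flow) if $H_n=\Theta$ on $\Sigma$ (on $\Sigma-\Lambda$ if there is a $C^2$-singular set $\Lambda$). In the case of half-cones, the vertex is additionally a conical singular point, at which the graph is not differentiable. Rotational means invariant under rotations of $\mathbb Q_\epsilon^n$ about a fixed point $o$, extended to $\mathbb Q_\epsilon^n\times\mathbb R$ by fixing the $\mathbb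 R$ factor. $B_R(o)$ is the geodesic ball of radius $R$ centered at $o$. The angle function of a rotational graph is regarded as a function of $s$, the distance in $\mathbb Q_\epsilon^n$ to $o$. Strictly convex means that all principal curvatures are positive. *)

theory Defs
  imports "HOL-Analysis.Analysis"
begin

section \<open>The ambient space\<close>

text \<open>
  The space form of constant curvature \<open>\<epsilon> \<in> {0, -1}\<close> is given in Riemann's normal form: the
  metric \<open>|dx|\<^sup>2 / (1 + \<epsilon> |x|\<^sup>2 / 4)\<^sup>2\<close> on \<open>{x. 1 + \<epsilon> |x|\<^sup>2 / 4 > 0}\<close>. For \<open>\<epsilon> = 0\<close> this is
  Euclidean space, for \<open>\<epsilon> = -1\<close> it is the Poincare model of hyperbolic space on the ball of
  radius 2 (the unit ball model after the substitution \<open>x = 2 y\<close>). The chart is centred at the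
  distinguished point o, i.e. o is the origin. Points and tangent vectors of the product with the
  line are elements of \<open>real ^ 'n \<times> real\<close>; the dimension n is \<open>CARD('n)\<close>.
\<close>

type_synonym 'n amb = "(real ^ 'n) \<times> real"

definition space_form :: "real \<Rightarrow> (real ^ 'n::finite) set" where
  "space_form \<epsilon> = {x. 0 < 1 + \<epsilon> * (norm x)\<^sup>2 / 4}"

definition conf :: "real \<Rightarrow> real ^ 'n::finite \<Rightarrow> real" where
  "conf \<epsilon> x = 1 / (1 + \<epsilon> * (norm x)\<^sup>2 / 4)"

definition ambient :: "real \<Rightarrow> 'n::finite amb set" where
  "ambient \<epsilon> = space_form \<epsilon> \<times> UNIV"

definition metric :: "real \<Rightarrow> 'n::finite amb \<Rightarrow> 'n amb \<Rightarrow> 'n amb \<Rightarrow> real" where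
  "metric \<epsilon> p v w = (conf \<epsilon> (fst p))\<^sup>2 * (fst v \<bullet> fst w) + snd v * snd w"

text \<open>
  Riemannian distance of the space form. The curves are required to be \<open>C\<^sup>1\<close> on the whole compact
  interval, so that the length integral always converges.
\<close>

definition curve_length :: "real \<Rightarrow> (real \<Rightarrow> real ^ 'n::finite) \<Rightarrow> real" where
  "curve_length \<epsilon> \<gamma> =
     integral {0..1} (\<lambda>t. conf \<epsilon> (\<gamma> t) * norm (vector_derivative \<gamma> (at t)))"

definition geo_dist :: "real \<Rightarrow> real ^ 'n::finite \<Rightarrow> real ^ 'n \<Rightarrow> real" where
  "geo_dist \<epsilon> x y =
     Inf {curve_length \<epsilon> \<gamma> | \<gamma>. \<gamma> C1_differentiable_on {0..1} \<and>
            \<gamma> ` {0..1} \<subseteq> space_form \<epsilon> \<and> \<gamma> 0 = x \<and> \<gamma> 1 = y}"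

definition geo_ball :: "real \<Rightarrow> real \<Rightarrow> (real ^ 'n::finite) set" where
  "geo_ball \<epsilon> R = {x \<in> space_form \<epsilon>. geo_dist \<epsilon> 0 x < R}"

definition geo_sphere :: "real \<Rightarrow> real \<Rightarrow> (real ^ 'n::finite) set" where
  "geo_sphere \<epsilon> R = {x \<in> space_form \<epsilon>. geo_dist \<epsilon> 0 x = R}"

text \<open>
  The Christoffel term of the Levi-Civita connection. Its horizontal part is the formula
  \<open>d\<phi>(X) Y + d\<phi>(Y) X - \<langle>X, Y\<rangle> \<nabla>\<phi>\<close> for a conformal metric \<open>e\<^sup>2\<^sup>\<phi> |dx|\<^sup>2\<close> with \<open>\<phi> = ln conf\<close>.
  The two lemmas below (symmetry and compatibility with the metric) characterise it.
\<close>

definition christoffel :: "real \<Rightarrow> 'n::finite amb \<Rightarrow> 'n amb \<Rightarrow> 'n amb \<Rightarrow> 'n amb" where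
  "christoffel \<epsilon> p X Y =
     (- (\<epsilon> * conf \<epsilon> (fst p) / 2) *\<^sub>R
        ((fst p \<bullet> fst X) *\<^sub>R fst Y + (fst p \<bullet> fst Y) *\<^sub>R fst X - (fst X \<bullet> fst Y) *\<^sub>R fst p), 0)"

lemma christoffel_sym: "christoffel \<epsilon> p X Y = christoffel \<epsilon> p Y X"
  by (simp add: christoffel_def inner_commute add.commute)

lemma metric_christoffel:
  fixes Y Z :: "'n::finite amb \<Rightarrow> 'n amb"
  assumes p: "p \<in> ambient \<epsilon>"
    and Y: "(Y has_derivative Y') (at p)" and Z: "(Z has_derivative Z') (at p)"
  shows "((\<lambda>q. metric \<epsilon> q (Y q) (Z q)) has_derivative
           (\<lambda>X. metric \<epsilon> p (Y' X + christoffel \<epsilon> p X (Y p)) (Z p)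
              + metric \<epsilon> p (Y p) (Z' X + christoffel \<epsilon> p X (Z p)))) (at p)"
proof -
  define D where "D q = 1 + \<epsilon> * (fst q \<bullet> fst q) / 4" for q :: "'n amb"
  have D: "D p > 0" and conf: "conf \<epsilon> (fst q) = 1 / D q" for q
    using p by (auto simp: D_def ambient_def space_form_def conf_def power2_norm_eq_inner)
  have dD: "(D has_derivative (\<lambda>X. \<epsilon> * (fst p \<bullet> fst X) / 2)) (at p)"
    unfolding D_def by (auto intro!: derivative_eq_intros simp: inner_commute)
  have "((\<lambda>q. (1 / D q)\<^sup>2 * (fst (Y q) \<bullet> fst (Z q)) + snd (Y q) * snd (Z q)) has_derivative
      (\<lambda>X. - (\<epsilon> * (fst p \<bullet> fst X) / (D p) ^ 3) * (fst (Y p) \<bullet> fst (Z p))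
         + (1 / D p)\<^sup>2 * (fst (Y' X) \<bullet> fst (Z p) + fst (Y p) \<bullet> fst (Z' X))
         + (snd (Y' X) * snd (Z p) + snd (Y p) * snd (Z' X)))) (at p)"
    using D by (auto intro!: derivative_eq_intros dD Y Z
        simp: field_simps power2_eq_square power3_eq_cube)
  then show ?thesis
    unfolding metric_def christoffel_def conf
    apply (rule has_derivative_eq_rhs)
    using D by (auto simp: fun_eq_iff inner_add_left inner_add_right inner_diff_left
        inner_diff_right inner_commute field_simps power2_eq_square power3_eq_cube)
qed


section \<open>Hypersurfaces\<close>

definition C1_on :: "'a::real_normed_vector set \<Rightarrow> ('a \<Rightarrow> 'b::real_normed_vector) \<Rightarrow> bool" where
  "C1_on U f \<longleftrightarrow> (\<exists>f' :: 'a \<Rightarrow> 'a \<Rightarrow>\<^sub>L 'b.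
     (\<forall>x\<in>U. (f has_derivative blinfun_apply (f' x)) (at x)) \<and> continuous_on U f')"

definition C2_on :: "'a::real_normed_vector set \<Rightarrow> ('a \<Rightarrow> 'b::real_normed_vector) \<Rightarrow> bool" where
  "C2_on U f \<longleftrightarrow> (\<exists>f' :: 'a \<Rightarrow> 'a \<Rightarrow>\<^sub>L 'b.
     (\<forall>x\<in>U. (f has_derivative blinfun_apply (f' x)) (at x)) \<and> C1_on U f')"

text \<open>
  Embedded hypersurfaces, possibly with boundary, are described by local defining functions. The
  parameter C is the regularity class, \<open>C1_on\<close> or \<open>C2_on\<close>.
\<close>

definition interior_point ::
    "('n::finite amb set \<Rightarrow> ('n amb \<Rightarrow> real) \<Rightarrow> bool) \<Rightarrow> 'n amb set \<Rightarrow> 'n amb \<Rightarrow> bool" where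
  "interior_point C \<Sigma> p \<longleftrightarrow> p \<in> \<Sigma> \<and>
     (\<exists>U F. open U \<and> p \<in> U \<and> C U F \<and> \<Sigma> \<inter> U = {q \<in> U. F q = 0} \<and>
        surj (frechet_derivative F (at p)))"

definition boundary_point ::
    "('n::finite amb set \<Rightarrow> ('n amb \<Rightarrow> real) \<Rightarrow> bool) \<Rightarrow> 'n amb set \<Rightarrow> 'n amb \<Rightarrow> bool" where
  "boundary_point C \<Sigma> p \<longleftrightarrow> p \<in> \<Sigma> \<and>
     (\<exists>U F G. open U \<and> p \<in> U \<and> C U F \<and> C U G \<and>
        \<Sigma> \<inter> U = {q \<in> U. F q = 0 \<and> 0 \<le> G q} \<and> G p = 0 \<and>
        surj (\<lambda>v. (frechet_derivative F (at p) v, frechet_derivative G (at p) v)))"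

definition hyp_boundary :: "'n::finite amb set \<Rightarrow> 'n amb set" where
  "hyp_boundary \<Sigma> = {p. boundary_point C1_on \<Sigma> p}"

text \<open>
  Null sets of the n-dimensional Hausdorff measure. On compact subsets of the ambient space the
  Euclidean distance of the chart is bi-Lipschitz equivalent to the Riemannian distance, so that
  the Euclidean diameter gives the same null sets.
\<close>

definition hausdorff_null :: "nat \<Rightarrow> 'a::metric_space set \<Rightarrow> bool" where
  "hausdorff_null n S \<longleftrightarrow> (\<forall>e>0. \<exists>B :: nat \<Rightarrow> 'a set.
     S \<subseteq> (\<Union>i. B i) \<and> (\<forall>i. bounded (B i)) \<and>
     summable (\<lambda>i. diameter (B i) ^ n) \<and> (\<Sum>i. diameter (B i) ^ n) < e)"

definition hypersurface :: "real \<Rightarrow> 'n::finite amb set \<Rightarrow> 'n amb set \<Rightarrow> bool" where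
  "hypersurface \<epsilon> \<Sigma> \<Lambda> \<longleftrightarrow> \<Sigma> \<subseteq> ambient \<epsilon> \<and>
     (\<forall>p\<in>\<Sigma>. interior_point C1_on \<Sigma> p \<or> boundary_point C1_on \<Sigma> p) \<and>
     \<Lambda> \<subseteq> \<Sigma> \<and> hausdorff_null CARD('n) \<Lambda> \<and>
     (\<forall>p\<in>\<Sigma> - \<Lambda>. interior_point C2_on \<Sigma> p \<or> boundary_point C2_on \<Sigma> p)"

text \<open>One-sided curves are used so that the whole tangent space is obtained at boundary points.\<close>

definition tangent_space :: "'n::finite amb set \<Rightarrow> 'n amb \<Rightarrow> 'n amb set" where
  "tangent_space \<Sigma> p = span {v. \<exists>\<gamma> :: real \<Rightarrow> 'n amb.
     \<gamma> 0 = p \<and> (\<forall>\<^sub>F t in at_right 0. \<gamma> t \<in> \<Sigma>) \<and> (\<gamma> has_vector_derivative v) (at_right 0)}"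

definition unit_normal :: "real \<Rightarrow> 'n::finite amb set \<Rightarrow> ('n amb \<Rightarrow> 'n amb) \<Rightarrow> bool" where
  "unit_normal \<epsilon> \<Sigma> N \<longleftrightarrow> continuous_on \<Sigma> N \<and>
     (\<forall>p\<in>\<Sigma>. metric \<epsilon> p (N p) (N p) = 1 \<and> (\<forall>v\<in>tangent_space \<Sigma> p. metric \<epsilon> p (N p) v = 0))"

definition angle :: "real \<Rightarrow> ('n::finite amb \<Rightarrow> 'n amb) \<Rightarrow> 'n amb \<Rightarrow> real" where
  "angle \<epsilon> N p = metric \<epsilon> p (N p) (0, 1)"

text \<open>
  The derivative within \<open>\<Sigma>\<close> only involves the values of N on \<open>\<Sigma>\<close>, and it is uniquely determined on
  vectors tangent to \<open>\<Sigma>\<close>, the only ones to which the shape operator is applied.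
\<close>

definition shape_operator ::
    "real \<Rightarrow> 'n::finite amb set \<Rightarrow> ('n amb \<Rightarrow> 'n amb) \<Rightarrow> 'n amb \<Rightarrow> 'n amb \<Rightarrow> 'n amb" where
  "shape_operator \<epsilon> \<Sigma> N p X =
     - (frechet_derivative N (at p within \<Sigma>) X + christoffel \<epsilon> p X (N p))"

text \<open>
  The family k lists the eigenvalues of the shape operator with multiplicities; it is determined
  by \<open>\<Sigma>\<close>, N and p up to a permutation of the index type.
\<close>

definition principal_curvatures ::
    "real \<Rightarrow> 'n::finite amb set \<Rightarrow> ('n amb \<Rightarrow> 'n amb) \<Rightarrow> 'n amb \<Rightarrow> ('n \<Rightarrow> real) \<Rightarrow> bool" where
  "principal_curvatures \<epsilon> \<Sigma> N p k \<longleftrightarrow> N differentiable (at p within \<Sigma>) \<and>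
     (\<exists>e :: 'n \<Rightarrow> 'n amb.
        span (range e) = tangent_space \<Sigma> p \<and>
        (\<forall>i j. metric \<epsilon> p (e i) (e j) = (if i = j then 1 else 0)) \<and>
        (\<forall>i. shape_operator \<epsilon> \<Sigma> N p (e i) = k i *\<^sub>R e i))"

definition gauss_curvature ::
    "real \<Rightarrow> 'n::finite amb set \<Rightarrow> ('n amb \<Rightarrow> 'n amb) \<Rightarrow> 'n amb \<Rightarrow> real \<Rightarrow> bool" where
  "gauss_curvature \<epsilon> \<Sigma> N p H \<longleftrightarrow>
     (\<exists>k. principal_curvatures \<epsilon> \<Sigma> N p k \<and> H = (\<Prod>i\<in>UNIV. k i))"

definition strictly_convex ::
    "real \<Rightarrow> 'n::finite amb set \<Rightarrow> ('n amb \<Rightarrow> 'n amb) \<Rightarrow> bool" where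
  "strictly_convex \<epsilon> \<Sigma> N \<longleftrightarrow>
     (\<forall>p\<in>\<Sigma>. \<exists>k. principal_curvatures \<epsilon> \<Sigma> N p k \<and> (\<forall>i. 0 < k i))"

text \<open>Here \<open>\<Lambda>\<close> is the \<open>C\<^sup>2\<close>-singular set, which may be empty.\<close>

definition n_translator ::
    "real \<Rightarrow> 'n::finite amb set \<Rightarrow> ('n amb \<Rightarrow> 'n amb) \<Rightarrow> 'n amb set \<Rightarrow> bool" where
  "n_translator \<epsilon> \<Sigma> N \<Lambda> \<longleftrightarrow> hypersurface \<epsilon> \<Sigma> \<Lambda> \<and> unit_normal \<epsilon> \<Sigma> N \<and>
     (\<forall>p\<in>\<Sigma> - \<Lambda>. gauss_curvature \<epsilon> \<Sigma> N p (angle \<epsilon> N p))"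


section \<open>Rotational graphs\<close>

definition vertical_graph ::
    "'n::finite amb set \<Rightarrow> (real ^ 'n \<Rightarrow> real) \<Rightarrow> (real ^ 'n) set \<Rightarrow> bool" where
  "vertical_graph \<Sigma> u D \<longleftrightarrow> continuous_on D u \<and> \<Sigma> = (\<lambda>x. (x, u x)) ` D"

definition rotational :: "'n::finite amb set \<Rightarrow> bool" where
  "rotational \<Sigma> \<longleftrightarrow>
     (\<forall>A :: real ^ 'n ^ 'n. rotation_matrix A \<longrightarrow> (\<lambda>p. (A *v fst p, snd p)) ` \<Sigma> = \<Sigma>)"

text \<open>For an embedded \<open>\<Sigma>\<close>, properness of the inclusion means that \<open>\<Sigma>\<close> is closed.\<close>

definition proper_in_ambient :: "real \<Rightarrow> 'n::finite amb set \<Rightarrow> bool" where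
  "proper_in_ambient \<epsilon> \<Sigma> \<longleftrightarrow> closedin (top_of_set (ambient \<epsilon>)) \<Sigma>"

text \<open>
  The horizontal sections of \<open>\<Sigma>\<close> and Z at height t become arbitrarily close in the Hausdorff sense
  as t tends to infinity. (Z will be a vertical cylinder.)
\<close>

definition vertically_asymptotic :: "real \<Rightarrow> 'n::finite amb set \<Rightarrow> 'n amb set \<Rightarrow> bool" where
  "vertically_asymptotic \<epsilon> \<Sigma> Z \<longleftrightarrow> (\<forall>e>0. \<exists>h. \<forall>t\<ge>h.
     (\<forall>x. (x, t) \<in> \<Sigma> \<longrightarrow> (\<exists>y. (y, t) \<in> Z \<and> geo_dist \<epsilon> x y < e)) \<and>
     (\<forall>y. (y, t) \<in> Z \<longrightarrow> (\<exists>x. (x, t) \<in> \<Sigma> \<and> geo_dist \<epsilon> x y < e)))"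

text \<open>
  The graph of u has a conical singularity over a: it is not differentiable there, and its tangent
  cone is the graph of a continuous positively homogeneous function.
\<close>

definition conical_singularity :: "(real ^ 'n::finite \<Rightarrow> real) \<Rightarrow> real ^ 'n \<Rightarrow> bool" where
  "conical_singularity u a \<longleftrightarrow> \<not> u differentiable (at a) \<and>
     (\<exists>\<psi> :: real ^ 'n \<Rightarrow> real. continuous_on UNIV \<psi> \<and> (\<forall>r\<ge>0. \<forall>v. \<psi> (r *\<^sub>R v) = r * \<psi> v) \<and>
        ((\<lambda>v. (u (a + v) - u a - \<psi> v) / norm v) \<longlongrightarrow> 0) (at 0))"

end

theory Submission
  imports Defs
begin

text \<open>
  A rotational graph \<open>t = U (norm x)\<close> is governed by one function, the angle \<open>a\<close> between its upward
  normal and the vertical. With respect to that normal the angle function is \<open>cos a\<close>, the \<open>n - 1\<close>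
  principal curvatures along the parallels are \<open>sin a / T\<close>, where \<open>T\<close> is \<open>s\<close> or \<open>tanh s\<close> at
  geodesic distance \<open>s\<close> from the axis, and the principal curvature along the meridian is the
  derivative of \<open>sin a\<close> with respect to \<open>s\<close>. So \<open>H\<^sub>n = \<Theta>\<close> is the ordinary differential equation
  \<open>(sin a / T)\<^bsup>n - 1\<^esup> cos a a' = cos a\<close> in \<open>s\<close>, that is \<open>sin\<^bsup>n - 1\<^esup> a a' = T\<^bsup>n - 1\<^esup>\<close>, whose variables
  separate: \<open>F a - F a\<^sub>0 = G r - G r\<^sub>0\<close> with \<open>F\<close> and \<open>G\<close> the antiderivatives of the two sides.

  Since \<open>G\<close> is unbounded and \<open>F (\<pi> / 2)\<close> is finite, the angle reaches \<open>\<pi> / 2\<close> at a finite radius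
  \<open>r\<^sub>1\<close>. There \<open>F' = 1\<close>, so \<open>a\<close> is Lipschitz up to \<open>r\<^sub>1\<close>, and near \<open>r\<^sub>1\<close> one has
  \<open>U' \<ge> tan a \<ge> K / (r\<^sub>1 - r)\<close> for some \<open>K > 0\<close>: the height grows at least like a logarithm and is
  unbounded. As \<open>U\<close> is monotone, the graph is asymptotic to the cylinder over the sphere of radius
  \<open>r\<^sub>1\<close>. All curvatures are positive, being quotients and products of positive quantities. The graph
  is closed if its inner edge belongs to it. All of this is \<open>translator_profile_exists\<close>, together
  with \<open>gauss_curvature_annulus\<close>, \<open>convex_annulus\<close>, \<open>closed_surface\<close> and
  \<open>vertically_asymptotic_surface\<close>.

  The three families are three initial conditions. The bowl has \<open>a = 0\<close> on the axis: both \<open>F\<close> and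
  \<open>G\<close> are asymptotic to \<open>n\<close>-th powers, hence \<open>a r / r \<rightarrow> 1\<close> (\<open>angle_asymptotics\<close>), which makes the
  graph \<open>C\<^sup>2\<close> across the axis with all curvatures 1 there (\<open>bowl_soliton\<close>). The half-cones have
  \<open>sin a = \<lambda>\<close> on the axis, so the graph has slope \<open>tan a > 0\<close> at its vertex and \<open>\<Theta>\<^sup>2 = cos\<^sup>2 a\<close> tends
  to \<open>1 - \<lambda>\<^sup>2\<close> (\<open>peaked_bowl_soliton\<close>). The grim reapers have \<open>a = 0\<close> at a radius \<open>r\<^sub>0 > 0\<close>: there \<open>G - G r\<^sub>0\<close> is
  only of first order while \<open>F\<close> is of order \<open>n\<close>, so \<open>a\<close> behaves like an \<open>n\<close>-th root, the graph is
  tangent to the horizontal slice and \<open>C\<^sup>1\<close> but not \<open>C\<^sup>2\<close> along its edge, and that edge is the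
  singular set (\<open>grim_reaper\<close>).

  The space form is used in its conformal chart, and \<open>r\<close> always denotes the Euclidean radius in the
  chart; \<open>geo_radius\<close> converts it to geodesic distance (\<open>geo_dist_origin\<close>).
\<close>

section \<open>Radial geometry of the space form\<close>

definition radial_conf :: "real \<Rightarrow> real \<Rightarrow> real" where
  "radial_conf \<epsilon> r = 1 / (1 + \<epsilon> * r\<^sup>2 / 4)"

text \<open>
  The principal curvatures of the sphere of chart radius \<open>r\<close> in the space form are reciprocal to
  this function. At geodesic distance \<open>s\<close> it equals \<open>s\<close> in the Euclidean case and \<open>tanh s\<close> in the
  hyperbolic case, where \<open>r = 2 tanh (s / 2)\<close>.
\<close>

definition tan_curv :: "real \<Rightarrow> real \<Rightarrow> real" where
  "tan_curv \<epsilon> r = r / (1 - \<epsilon> * r\<^sup>2 / 4)"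

text \<open>
  Geodesic distance from the origin of the points at chart radius \<open>r\<close>; the logarithm is
  \<open>2 artanh (r / 2)\<close>. The inverse function is \<open>chart_radius\<close>.
\<close>

definition geo_radius :: "real \<Rightarrow> real \<Rightarrow> real" where
  "geo_radius \<epsilon> r = (if \<epsilon> = 0 then r else ln ((2 + r) / (2 - r)))"

definition chart_radius :: "real \<Rightarrow> real \<Rightarrow> real" where
  "chart_radius \<epsilon> s = (if \<epsilon> = 0 then s else 2 * (exp s - 1) / (exp s + 1))"

locale curvature_sign =
  fixes \<epsilon> :: real
  assumes curv: "\<epsilon> = 0 \<or> \<epsilon> = -1"
begin

lemma chart_domain_iff: "0 < 1 + \<epsilon> * r\<^sup>2 / 4 \<longleftrightarrow> \<epsilon> = 0 \<or> \<bar>r\<bar> < 2"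
  using curv abs_square_less_1[of "r/2"] by (auto simp: power_divide field_simps)

lemma chart_domain_mono: "0 < 1 + \<epsilon> * r\<^sup>2 / 4 \<Longrightarrow> \<bar>q\<bar> \<le> \<bar>r\<bar> \<Longrightarrow> 0 < 1 + \<epsilon> * q\<^sup>2 / 4"
  unfolding chart_domain_iff by auto

lemma denom_ge_1: "1 - \<epsilon> * r\<^sup>2 / 4 \<ge> 1"
  using curv by auto

lemma radial_conf_ge_1: "0 < 1 + \<epsilon> * r\<^sup>2 / 4 \<Longrightarrow> 1 \<le> radial_conf \<epsilon> r"
  using curv by (auto simp: radial_conf_def field_simps)

lemma radial_conf_mono:
  assumes "0 < 1 + \<epsilon> * r\<^sup>2 / 4" "\<bar>q\<bar> \<le> \<bar>r\<bar>" shows "radial_conf \<epsilon> q \<le> radial_conf \<epsilon> r"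
proof -
  have "q\<^sup>2 \<le> r\<^sup>2" using assms(2) by (simp add: abs_le_square_iff)
  then show ?thesis
    unfolding radial_conf_def using curv assms chart_domain_mono[OF assms]
    by (intro divide_left_mono) auto
qed

lemma isCont_radial_conf: "0 < 1 + \<epsilon> * r\<^sup>2 / 4 \<Longrightarrow> isCont (radial_conf \<epsilon>) r"
  unfolding radial_conf_def by (intro continuous_intros) auto

lemma isCont_tan_curv: "isCont (tan_curv \<epsilon>) r"
  unfolding tan_curv_def using denom_ge_1[of r] by (intro continuous_intros) auto

lemma tan_curv_pos: "0 < r \<Longrightarrow> 0 < tan_curv \<epsilon> r"
  unfolding tan_curv_def using denom_ge_1[of r] by (intro divide_pos_pos) auto

lemma tan_curv_le: "0 \<le> r \<Longrightarrow> tan_curv \<epsilon> r \<le> r"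
  unfolding tan_curv_def using denom_ge_1[of r] mult_left_mono[of 1 "1 - \<epsilon> * r\<^sup>2 / 4" r] 
  by (subst pos_divide_le_eq) auto

lemma tan_curv_mono:
  assumes "0 < 1 + \<epsilon> * r\<^sup>2 / 4" "0 \<le> q" "q \<le> r" shows "tan_curv \<epsilon> q \<le> tan_curv \<epsilon> r"
proof (cases "\<epsilon> = 0")
  case False
  then have e: "\<epsilon> = -1" "r < 2" "q < 2" using curv assms chart_domain_iff[of r] by auto
  have "q * r \<le> 2 * 2" using e assms by (intro mult_mono) auto
  then have "(4 - q * r) * (r - q) \<ge> 0" using assms by (intro mult_nonneg_nonneg) auto
  then have "q * (4 + r\<^sup>2) \<le> r * (4 + q\<^sup>2)" by (simp add: algebra_simps power2_eq_square)
  moreover have "4 + q\<^sup>2 > 0" "4 + r\<^sup>2 > 0" by (simp_all add: add_pos_nonneg)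
  ultimately show ?thesis using e by (simp add: tan_curv_def divide_simps)
qed (use assms in \<open>simp add: tan_curv_def\<close>)

lemma geo_radius_deriv:
  assumes "0 < 1 + \<epsilon> * r\<^sup>2 / 4"
  shows "(geo_radius \<epsilon> has_real_derivative radial_conf \<epsilon> r) (at r)"
proof (cases "\<epsilon> = 0")
  case False
  then have e: "\<epsilon> = -1" "-2 < r" "r < 2" using curv assms chart_domain_iff[of r] by auto
  have nz: "4 - r\<^sup>2 > 0" using assms e by simp
  have "geo_radius \<epsilon> = (\<lambda>r. ln ((2 + r) / (2 - r)))" using e by (simp add: geo_radius_def fun_eq_iff)
  moreover have "((\<lambda>r. ln ((2 + r) / (2 - r))) has_real_derivative radial_conf \<epsilon> r) (at r)"
  proof -
    have "((\<lambda>r. ln (2 + r) - ln (2 - r)) has_real_derivative 1 / (2 + r) + 1 / (2 - r)) (at r)"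
      using e by (auto intro!: derivative_eq_intros)
    also have "1 / (2 + r) + 1 / (2 - r) = radial_conf \<epsilon> r"
      using e nz by (simp add: radial_conf_def divide_simps) (simp add: algebra_simps power2_eq_square)
    finally show ?thesis
    proof (rule has_field_derivative_transform_within_open)
      show "open {-2<..<(2::real)}" "r \<in> {-2<..<2}" using e by auto
      show "ln (2 + x) - ln (2 - x) = ln ((2 + x) / (2 - x))" if "x \<in> {-2<..<2}" for x :: real
        using that by (simp add: ln_div)
    qed
  qed
  ultimately show ?thesis by simp
next
  case True
  then have "geo_radius \<epsilon> = (\<lambda>r. r)" by (simp add: geo_radius_def fun_eq_iff)
  then show ?thesis using True by (auto simp: radial_conf_def)
qed

lemma geo_radius_0 [simp]: "geo_radius \<epsilon> 0 = 0" by (simp add: geo_radius_def)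

lemma geo_radius_strict_mono:
  assumes "0 < 1 + \<epsilon> * r\<^sup>2 / 4" "0 \<le> q" "q < r"
  shows "geo_radius \<epsilon> q < geo_radius \<epsilon> r"
proof (rule DERIV_pos_imp_increasing[OF assms(3)])
  fix x assume "q \<le> x" "x \<le> r"
  then have "0 < 1 + \<epsilon> * x\<^sup>2 / 4" using assms by (intro chart_domain_mono[OF assms(1)]) auto
  then show "\<exists>y. (geo_radius \<epsilon> has_real_derivative y) (at x) \<and> 0 < y"
    using geo_radius_deriv radial_conf_ge_1 by (meson less_le_trans zero_less_one)
qed

lemma geo_radius_less_iff:
  assumes "0 < 1 + \<epsilon> * r\<^sup>2 / 4" "0 < 1 + \<epsilon> * q\<^sup>2 / 4" "0 \<le> q" "0 \<le> r"
  shows "geo_radius \<epsilon> q < geo_radius \<epsilon> r \<longleftrightarrow> q < r"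
  using geo_radius_strict_mono[of r q] geo_radius_strict_mono[of q r] assms
  by (metis less_asym linorder_neqE_linordered_idom)

lemma geo_radius_eq_iff:
  assumes "0 < 1 + \<epsilon> * r\<^sup>2 / 4" "0 < 1 + \<epsilon> * q\<^sup>2 / 4" "0 \<le> q" "0 \<le> r"
  shows "geo_radius \<epsilon> q = geo_radius \<epsilon> r \<longleftrightarrow> q = r"
  using geo_radius_strict_mono[of r q] geo_radius_strict_mono[of q r] assms
  by (metis less_irrefl linorder_neqE_linordered_idom)

lemma chart_radius:
  assumes "0 \<le> s"
  shows "0 \<le> chart_radius \<epsilon> s" "0 < 1 + \<epsilon> * (chart_radius \<epsilon> s)\<^sup>2 / 4"
    "geo_radius \<epsilon> (chart_radius \<epsilon> s) = s"
proof -
  have s: "exp s \<ge> 1" "exp s + 1 > 0" using assms by (auto simp: add_pos_pos)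
  show pos: "0 \<le> chart_radius \<epsilon> s" using assms s by (auto simp: chart_radius_def)
  have "chart_radius \<epsilon> s < 2" if "\<epsilon> \<noteq> 0" using that s by (simp add: chart_radius_def field_simps)
  then show "0 < 1 + \<epsilon> * (chart_radius \<epsilon> s)\<^sup>2 / 4" unfolding chart_domain_iff using pos by auto
  have "(2 + 2 * (exp s - 1) / (exp s + 1)) / (2 - 2 * (exp s - 1) / (exp s + 1)) = exp s"
    using s by (simp add: field_simps)
  then show "geo_radius \<epsilon> (chart_radius \<epsilon> s) = s"
    by (simp add: geo_radius_def chart_radius_def)
qed

lemma chart_radius_geo_radius:
  assumes "0 < 1 + \<epsilon> * r\<^sup>2 / 4" "0 \<le> r"
  shows "chart_radius \<epsilon> (geo_radius \<epsilon> r) = r"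
proof -
  have "0 \<le> geo_radius \<epsilon> r" using geo_radius_strict_mono[of r 0] assms by (cases "r = 0") auto
  then show ?thesis using chart_radius geo_radius_eq_iff assms by metis
qed

lemma chart_radius_tendsto_0: "(chart_radius \<epsilon> \<longlongrightarrow> 0) (at_right 0)"
proof -
  have "exp (0::real) + 1 \<noteq> 0" by simp
  then have "isCont (chart_radius \<epsilon>) 0"
    unfolding chart_radius_def by (cases "\<epsilon> = 0") (auto intro!: continuous_intros)
  then show ?thesis unfolding isCont_def chart_radius_def
    by (auto intro: tendsto_within_subset split: if_splits)
qed

end

section \<open>The profile equation\<close>

text \<open>
  A solution of the separated equation that starts at chart radius \<open>r\<^sub>0\<close> with angle \<open>a\<^sub>0\<close> and
  reaches the angle \<open>\<pi> / 2\<close> at \<open>r\<^sub>1\<close>; here \<open>m = n - 1\<close>. The factor \<open>radial_conf\<close> in both derivatives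
  is the derivative of geodesic distance. The angle is continued by the constant \<open>a\<^sub>0\<close> below \<open>r\<^sub>0\<close>:
  for \<open>a\<^sub>0 = 0\<close> this makes \<open>U\<close> vanish there, so that the same function \<open>U\<close> is the \<open>C\<^sup>1\<close> extension of
  the height across the inner edge which the definition of a boundary point requires.
\<close>

locale translator_profile = curvature_sign +
  fixes r0 r1 a0 :: real and m :: nat and a U :: "real \<Rightarrow> real"
  assumes r0: "0 \<le> r0" and r01: "r0 < r1" and dom: "0 < 1 + \<epsilon> * r1\<^sup>2 / 4"
    and a0: "0 \<le> a0" "a0 < pi / 2"
    and cont_a: "\<And>r. r < r1 \<Longrightarrow> isCont a r"
    and a_le: "\<And>r. r \<le> r0 \<Longrightarrow> a r = a0"
    and a_bounds: "\<And>r. r0 < r \<Longrightarrow> r < r1 \<Longrightarrow> a0 < a r \<and> a r < pi / 2"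
    and deriv_a: "\<And>r. r0 < r \<Longrightarrow> r < r1 \<Longrightarrow>
      (a has_real_derivative tan_curv \<epsilon> r ^ m * radial_conf \<epsilon> r / sin (a r) ^ m) (at r)"
    and deriv_U: "\<And>r. -r1 < r \<Longrightarrow> r < r1 \<Longrightarrow>
      (U has_real_derivative radial_conf \<epsilon> r * tan (a r)) (at r)"
    and U_r0: "U r0 = 0"
    and U_top: "filterlim U at_top (at_left r1)"

lemma sin_power_antiderivative:
  obtains F :: "real \<Rightarrow> real" where "F 0 = 0" "\<And>x. (F has_real_derivative sin x ^ m) (at x)"
    "strict_mono_on {0..pi/2} F" "continuous_on UNIV F"
proof -
  obtain F0 :: "real \<Rightarrow> real" where F0: "\<And>x. (F0 has_vector_derivative sin x ^ m) (at x)"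
    using einterval_antiderivative[of "-\<infinity>" "\<infinity>" "\<lambda>x. sin x ^ m"] by auto
  define F where "F x = F0 x - F0 0" for x
  have d: "(F has_real_derivative sin x ^ m) (at x)" for x
    unfolding F_def using F0[of x]
    by (auto simp: has_real_derivative_iff_has_vector_derivative intro!: derivative_eq_intros)
  have c: "continuous_on UNIV F"
    using d by (meson DERIV_isCont continuous_at_imp_continuous_on)
  show thesis
  proof (rule that[OF _ d _ c])
    show "F 0 = 0" by (simp add: F_def)
    show "strict_mono_on {0..pi/2} F"
    proof (rule strict_mono_onI)
      fix x y :: real assume xy: "x \<in> {0..pi/2}" "y \<in> {0..pi/2}" "x < y"
      show "F x < F y"
      proof (rule DERIV_pos_imp_increasing_open[OF xy(3)])
        fix z assume "x < z" "z < y"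
        then have "0 < sin z" using xy by (intro sin_gt_zero) auto
        then show "\<exists>D. (F has_real_derivative D) (at z) \<and> D > 0" using d by (auto intro!: exI[of _ "sin z ^ m"])
      qed (use c in \<open>auto intro: continuous_on_subset\<close>)
    qed
  qed
qed

context curvature_sign begin

text \<open>
  The right-hand side of the separated equation has an unbounded antiderivative because past a
  fixed radius its density dominates a multiple of the derivative of \<open>geo_radius\<close>, and geodesic
  distance is unbounded.
\<close>

lemma tan_curv_power_antiderivative:
  assumes "0 \<le> r0" "0 < 1 + \<epsilon> * r0\<^sup>2 / 4"
  obtains G where "\<And>r. 0 < 1 + \<epsilon> * r\<^sup>2 / 4 \<Longrightarrow>
      (G has_real_derivative tan_curv \<epsilon> r ^ m * radial_conf \<epsilon> r) (at r)"
    "\<And>q r. 0 \<le> q \<Longrightarrow> q < r \<Longrightarrow> 0 < 1 + \<epsilon> * r\<^sup>2 / 4 \<Longrightarrow> G q < G r"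
    "\<And>B. \<exists>r>r0. 0 < 1 + \<epsilon> * r\<^sup>2 / 4 \<and> G r > B"
proof -
  let ?g = "\<lambda>r. tan_curv \<epsilon> r ^ m * radial_conf \<epsilon> r"
  have cont: "isCont ?g r" if "0 < 1 + \<epsilon> * r\<^sup>2 / 4" for r
    using isCont_radial_conf[OF that] isCont_tan_curv[of r] by (intro continuous_intros)
  \<comment> \<open>\<open>(- h, h)\<close> is the range of radii covered by the chart.\<close>
  define h :: ereal where "h = (if \<epsilon> = 0 then \<infinity> else 2)"
  have h: "- h < ereal r \<and> ereal r < h \<longleftrightarrow> 0 < 1 + \<epsilon> * r\<^sup>2 / 4" for r
  proof -
    have "-2 < ereal r \<longleftrightarrow> -2 < r" "ereal r < 2 \<longleftrightarrow> r < 2"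
      by (metis ereal_less(2) ereal_less_eq(3) less_ereal.simps(1) numeral_eq_ereal uminus_ereal.simps(1))+
    then show ?thesis unfolding chart_domain_iff h_def by auto
  qed
  have "- h < h" by (auto simp: h_def)
  then have "\<exists>G. \<forall>r::real. - h < r \<longrightarrow> r < h \<longrightarrow> (G has_vector_derivative ?g r) (at r)"
    by (rule einterval_antiderivative) (use cont h in blast)
  then obtain G where G: "(G has_real_derivative ?g r) (at r)" if "0 < 1 + \<epsilon> * r\<^sup>2 / 4" for r
    using h by (auto simp: has_real_derivative_iff_has_vector_derivative)
  have mono: "G q < G r" if "0 \<le> q" "q < r" "0 < 1 + \<epsilon> * r\<^sup>2 / 4" for q r
  proof (rule DERIV_pos_imp_increasing_open[OF that(2)])
    fix x assume x: "q < x" "x < r"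
    then have d: "0 < 1 + \<epsilon> * x\<^sup>2 / 4" using that by (intro chart_domain_mono[OF that(3)]) auto
    have "?g x > 0" using radial_conf_ge_1[OF d] tan_curv_pos[of x] x that by (intro mult_pos_pos zero_less_power) auto
    then show "\<exists>y. (G has_real_derivative y) (at x) \<and> 0 < y" using G[OF d] by blast
  next
    show "continuous_on {q..r} G" 
      using that by (intro continuous_at_imp_continuous_on ballI DERIV_isCont[OF G] chart_domain_mono[OF that(3)]) auto
  qed
  have unb: "\<exists>r>r0. 0 < 1 + \<epsilon> * r\<^sup>2 / 4 \<and> G r > B" for B
  proof -
    define s1 where "s1 = geo_radius \<epsilon> r0 + 1"
    have "geo_radius \<epsilon> r0 \<ge> 0" using geo_radius_strict_mono[of r0 0] assms by (cases "r0 = 0") auto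
    then have s1: "s1 > 0" by (simp add: s1_def)
    define q where "q = chart_radius \<epsilon> s1"
    have q: "0 \<le> q" "0 < 1 + \<epsilon> * q\<^sup>2 / 4" "geo_radius \<epsilon> q = s1"
      using chart_radius[of s1] s1 by (auto simp: q_def)
    have qr0: "r0 < q" using geo_radius_less_iff[OF q(2) assms(2)] q assms by (auto simp: s1_def)
    define K where "K = tan_curv \<epsilon> q ^ m"
    have K: "K > 0" using tan_curv_pos[of q] qr0 assms by (simp add: K_def)
    define s2 where "s2 = s1 + (\<bar>B - G q\<bar> + 1) / K"
    have s2: "s2 > s1" using K by (auto simp: s2_def intro!: divide_pos_pos)
    define r where "r = chart_radius \<epsilon> s2"
    have r: "0 \<le> r" "0 < 1 + \<epsilon> * r\<^sup>2 / 4" "geo_radius \<epsilon> r = s2"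
      using chart_radius[of s2] s1 s2 by (auto simp: r_def)
    have qr: "q < r" using geo_radius_less_iff[OF r(2) q(2)] q r s2 by auto
    have "G q - K * geo_radius \<epsilon> q \<le> G r - K * geo_radius \<epsilon> r"
    proof (rule DERIV_nonneg_imp_nondecreasing[of q r "\<lambda>r. G r - K * geo_radius \<epsilon> r"])
      show "q \<le> r" using qr by simp
      fix x assume x: "q \<le> x" "x \<le> r"
      then have d: "0 < 1 + \<epsilon> * x\<^sup>2 / 4" using q by (intro chart_domain_mono[OF r(2)]) auto
      have "((\<lambda>x. G x - K * geo_radius \<epsilon> x) has_real_derivative ?g x - K * radial_conf \<epsilon> x) (at x)"
        using G[OF d] geo_radius_deriv[OF d] by (auto intro!: derivative_eq_intros)
      moreover have "K \<le> tan_curv \<epsilon> x ^ m" unfolding K_def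
        using tan_curv_pos[of q] qr0 assms x q d by (intro power_mono tan_curv_mono) auto
      then have "?g x - K * radial_conf \<epsilon> x \<ge> 0"
        using radial_conf_ge_1[OF d] by (simp add: mult_right_mono)
      ultimately show "\<exists>y. ((\<lambda>x. G x - K * geo_radius \<epsilon> x) has_real_derivative y) (at x) \<and> 0 \<le> y" by blast
    qed
    moreover have "K * (s2 - s1) = \<bar>B - G q\<bar> + 1" using K by (simp add: s2_def)
    ultimately have "G r > B" using q r by (simp add: algebra_simps)
    then show ?thesis using qr qr0 r by (intro exI[of _ r]) auto
  qed
  show thesis using that[OF G mono unb] by blast
qed

text \<open>
  Solving \<open>F a = G r - G r\<^sub>0 + F a\<^sub>0\<close> for \<open>a\<close>. The right-hand side attains the value \<open>F (\<pi> / 2)\<close>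
  at some \<open>r\<^sub>1\<close>, and \<open>F\<close> is invertible on \<open>[0, \<pi> / 2]\<close>. Its inverse is continuous on the closed
  interval and differentiable inside, where \<open>F'\<close> is a power of \<open>sin\<close> and does not vanish.
\<close>

lemma profile_angle_exists:
  assumes r0: "0 \<le> r0" "0 < 1 + \<epsilon> * r0\<^sup>2 / 4" and a0: "0 \<le> a0" "a0 < pi / 2"
  obtains r1 a where "r0 < r1" "0 < 1 + \<epsilon> * r1\<^sup>2 / 4" "continuous_on {..r1} a" "a r1 = pi / 2"
    "\<And>r. r \<le> r0 \<Longrightarrow> a r = a0"
    "\<And>r. r0 < r \<Longrightarrow> r < r1 \<Longrightarrow> a0 < a r \<and> a r < pi / 2"
    "\<And>r. r0 < r \<Longrightarrow> r < r1 \<Longrightarrow>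
      (a has_real_derivative tan_curv \<epsilon> r ^ m * radial_conf \<epsilon> r / sin (a r) ^ m) (at r)"
proof -
  obtain F :: "real \<Rightarrow> real" where F: "F 0 = 0" "\<And>x. (F has_real_derivative sin x ^ m) (at x)"
    "strict_mono_on {0..pi/2} F" "continuous_on UNIV F"
    by (rule sin_power_antiderivative[of m]) blast
  obtain G where G: "\<And>r. 0 < 1 + \<epsilon> * r\<^sup>2 / 4 \<Longrightarrow>
      (G has_real_derivative tan_curv \<epsilon> r ^ m * radial_conf \<epsilon> r) (at r)"
    "\<And>q r. 0 \<le> q \<Longrightarrow> q < r \<Longrightarrow> 0 < 1 + \<epsilon> * r\<^sup>2 / 4 \<Longrightarrow> G q < G r"
    "\<And>B. \<exists>r>r0. 0 < 1 + \<epsilon> * r\<^sup>2 / 4 \<and> G r > B"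
    by (rule tan_curv_power_antiderivative[OF r0, of m]) blast
  define Y where "Y r = G (max r r0) - G r0 + F a0" for r
  obtain r2 where r2: "r0 < r2" "0 < 1 + \<epsilon> * r2\<^sup>2 / 4" "G r2 > G r0 - F a0 + F (pi / 2)"
    using G(3)[of "G r0 - F a0 + F (pi / 2)"] by blast
  have d2: "0 < 1 + \<epsilon> * r\<^sup>2 / 4" if "0 \<le> r" "r \<le> r2" for r
    using that by (intro chart_domain_mono[OF r2(2)]) auto
  have contG: "continuous_on {r0..r2} G"
    using r0 by (intro continuous_at_imp_continuous_on ballI DERIV_isCont[OF G(1)] d2) auto
  have F_a0: "F a0 < F (pi / 2)" using a0 by (intro strict_mono_onD[OF F(3)]) auto
  obtain r1 where r1: "r0 \<le> r1" "r1 \<le> r2" "G r1 = G r0 - F a0 + F (pi / 2)"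
    using IVT'[of G r0 "G r0 - F a0 + F (pi / 2)" r2] F_a0 r2 contG by auto
  have r01: "r0 < r1" using r1 F_a0 by (cases "r0 = r1") auto
  have d1: "0 < 1 + \<epsilon> * r\<^sup>2 / 4" if "0 \<le> r" "r \<le> r1" for r using that r1 d2 by auto
  have Gle: "G r0 \<le> G r" if "r0 \<le> r" "r \<le> r1" for r
    using G(2)[of r0 r] d1[of r] r0 that by (cases "r0 = r") auto
  have Gle1: "G r \<le> G r1" if "r0 \<le> r" "r \<le> r1" for r
    using G(2)[of r r1] d1[of r1] r0 r01 that by (cases "r = r1") auto
  have inj: "inj_on F {0..pi/2}" by (rule strict_mono_on_imp_inj_on[OF F(3)])
  have cF: "continuous_on S F" for S by (rule continuous_on_subset[OF F(4)]) simp
  have img: "F ` {0..pi/2} = {F 0..F (pi/2)}"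
  proof
    show "F ` {0..pi/2} \<subseteq> {F 0..F (pi/2)}"
      using monotone_onD[OF strict_mono_on_imp_mono_on[OF F(3)]] by fastforce
    show "{F 0..F (pi/2)} \<subseteq> F ` {0..pi/2}"
    proof
      fix y assume "y \<in> {F 0..F (pi/2)}"
      then show "y \<in> F ` {0..pi/2}" using IVT'[of F 0 y "pi/2"] cF[of "{0..pi/2}"] by auto
    qed
  qed
  have F0: "F 0 \<le> F a0" using a0 by (intro monotone_onD[OF strict_mono_on_imp_mono_on[OF F(3)]]) auto
  have Yb: "F a0 \<le> Y r" "Y r \<le> F (pi/2)" if "r \<le> r1" for r
    unfolding Y_def using Gle[of "max r r0"] Gle1[of "max r r0"] r1 r01 that by auto
  have Yin: "Y r \<in> F ` {0..pi/2}" if "r \<le> r1" for r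
    unfolding img using Yb[OF that] F0 by auto
  define A where "A = the_inv_into {0..pi/2} F"
  have FA: "F (A y) = y" "A y \<in> {0..pi/2}" if "y \<in> F ` {0..pi/2}" for y
    using f_the_inv_into_f[OF inj that] the_inv_into_into[OF inj that order_refl] by (auto simp: A_def)
  have AF: "A (F x) = x" if "x \<in> {0..pi/2}" for x
    using the_inv_into_f_f[OF inj that] by (simp add: A_def)
  have cA: "continuous_on (F ` {0..pi/2}) A"
    unfolding A_def by (rule continuous_on_inv_into[OF cF _ inj]) simp
  define a where "a r = A (Y r)" for r
  have contY: "continuous_on {..r1} Y"
    unfolding Y_def using r1 r01
    by (intro continuous_intros continuous_on_compose2[OF contG]) auto
  have conta: "continuous_on {..r1} a"
    unfolding a_def by (rule continuous_on_compose2[OF cA contY]) (use Yin in auto)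
  have ale: "a r = a0" if "r \<le> r0" for r
    using that a0 AF[of a0] by (simp add: a_def Y_def max_def)
  have Fa: "F (a r) = Y r" "a r \<in> {0..pi/2}" if "r \<le> r1" for r
    using FA[OF Yin[OF that]] by (auto simp: a_def)
  have less: "x < y" if "F x < F y" "x \<in> {0..pi/2}" "y \<in> {0..pi/2}" for x y
    using that strict_mono_onD[OF F(3), of y x] by (metis less_asym linorder_neqE_linordered_idom)
  have ab: "a0 < a r \<and> a r < pi / 2" if "r0 < r" "r < r1" for r
  proof -
    have "F a0 < F (a r)" "F (a r) < F (pi / 2)"
      using G(2)[of r0 r] G(2)[of r r1] d1[of r] d1[of r1] that r0 Fa(1)[of r] r1
      by (auto simp: Y_def max_def)
    then show ?thesis using less[of a0 "a r"] less[of "a r" "pi/2"] Fa(2)[of r] that a0 by auto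
  qed
  show thesis
  proof (rule that[OF r01 _ conta _ ale ab])
    show "0 < 1 + \<epsilon> * r1\<^sup>2 / 4" using d1 r0 r01 by auto
    have "Y r1 = F (pi/2)" using r1 r01 by (simp add: Y_def)
    then show "a r1 = pi / 2" using AF[of "pi/2"] by (simp add: a_def)
    fix r assume r: "r0 < r" "r < r1"
    have "a r > 0" "a r < pi / 2" using ab[OF r] a0 by auto
    then have s: "sin (a r) > 0" by (intro sin_gt_zero) auto
    have "isCont a r" using continuous_on_subset[OF conta, of "{..<r1}"] r
      by (simp add: continuous_on_eq_continuous_at lessThan_subset_iff subset_iff)
    have dY: "(Y has_real_derivative tan_curv \<epsilon> r ^ m * radial_conf \<epsilon> r) (at r)"
    proof -
      have "((\<lambda>r. G r - G r0 + F a0) has_real_derivative tan_curv \<epsilon> r ^ m * radial_conf \<epsilon> r) (at r)"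
        using G(1)[of r] d1[of r] r r0 by (auto intro!: derivative_eq_intros)
      then show ?thesis
        by (rule has_field_derivative_transform_within_open[where S = "{r0<..}"])
          (use r in \<open>auto simp: Y_def max_def\<close>)
    qed
    have Yr: "F 0 < Y r" "Y r < F (pi/2)"
      using G(2)[of r0 r] G(2)[of r r1] d1[of r] d1[of r1] r r0 r1 F0 by (auto simp: Y_def max_def)
    have "(A has_real_derivative inverse (sin (A (Y r)) ^ m)) (at (Y r))"
    proof (rule DERIV_inverse_function[where f = F])
      show "(F has_real_derivative sin (A (Y r)) ^ m) (at (A (Y r)))" by (rule F(2))
      show "sin (A (Y r)) ^ m \<noteq> 0" using s by (simp add: a_def)
      show "F 0 < Y r" "Y r < F (pi/2)" by (rule Yr)+
      show "F (A y) = y" if "F 0 < y" "y < F (pi/2)" for y using FA(1)[of y] that img by auto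
      show "isCont A (Y r)" using cA Yr unfolding img
        by (metis continuous_on_interior greaterThanLessThan_iff interior_atLeastAtMost_real)
    qed
    from DERIV_chain2[OF this dY] show "(a has_real_derivative tan_curv \<epsilon> r ^ m * radial_conf \<epsilon> r / sin (a r) ^ m) (at r)"
      unfolding a_def by (simp add: field_simps)
  qed
qed

text \<open>
  What remains is the height and its divergence. Near \<open>r\<^sub>1\<close> the denominator \<open>sin\<^sup>m a\<close> stays away
  from 0, so the mean value theorem gives \<open>cos a \<le> \<pi> / 2 - a \<le> M (r\<^sub>1 - r)\<close>. Hence
  \<open>tan a \<ge> K / (r\<^sub>1 - r)\<close> and \<open>U + K ln (r\<^sub>1 - r)\<close> is nondecreasing.
\<close>

lemma translator_profile_exists:
  assumes r0: "0 \<le> r0" "0 < 1 + \<epsilon> * r0\<^sup>2 / 4" and a0: "0 \<le> a0" "a0 < pi / 2"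
  obtains r1 a U where "translator_profile \<epsilon> r0 r1 a0 m a U"
proof -
  obtain r1 a where r01: "r0 < r1" and dom: "0 < 1 + \<epsilon> * r1\<^sup>2 / 4"
    and conta: "continuous_on {..r1} a" and a1: "a r1 = pi / 2"
    and ale: "\<And>r. r \<le> r0 \<Longrightarrow> a r = a0"
    and ab: "\<And>r. r0 < r \<Longrightarrow> r < r1 \<Longrightarrow> a0 < a r \<and> a r < pi / 2"
    and da: "\<And>r. r0 < r \<Longrightarrow> r < r1 \<Longrightarrow>
      (a has_real_derivative tan_curv \<epsilon> r ^ m * radial_conf \<epsilon> r / sin (a r) ^ m) (at r)"
    using profile_angle_exists[OF assms, of m] by metis
  have cta: "isCont a r" if "r < r1" for r
    using continuous_on_subset[OF conta, of "{..<r1}"] that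
    by (simp add: continuous_on_eq_continuous_at lessThan_subset_iff subset_iff)
  have a_range: "0 \<le> a r" "a r < pi / 2" if "r < r1" for r
    using ale[of r] ab[of r] that a0 by (cases "r \<le> r0"; simp)+
  have d1: "0 < 1 + \<epsilon> * r\<^sup>2 / 4" if "-r1 \<le> r" "r \<le> r1" for r
    using that by (intro chart_domain_mono[OF dom]) auto
  have "ereal (-r1) < ereal r1" using r0 r01 by simp
  then have "\<exists>V. \<forall>r::real. ereal (-r1) < r \<longrightarrow> r < ereal r1 \<longrightarrow>
      (V has_vector_derivative radial_conf \<epsilon> r * tan (a r)) (at r)"
  proof (rule einterval_antiderivative)
    fix r assume "ereal (-r1) < ereal r" "ereal r < ereal r1"
    then have r: "-r1 < r" "r < r1" by auto
    have "0 < cos (a r)" using a_range[OF r(2)] by (intro cos_gt_zero_pi) auto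
    then show "isCont (\<lambda>r. radial_conf \<epsilon> r * tan (a r)) r"
      using isCont_radial_conf[OF d1[of r]] cta[of r] r by (intro continuous_intros) auto
  qed
  then obtain V where V: "\<And>r. -r1 < r \<Longrightarrow> r < r1 \<Longrightarrow> (V has_vector_derivative radial_conf \<epsilon> r * tan (a r)) (at r)"
    by auto
  define U where "U r = V r - V r0" for r
  have dU: "(U has_real_derivative radial_conf \<epsilon> r * tan (a r)) (at r)" if "-r1 < r" "r < r1" for r
    unfolding U_def using V[OF that]
    by (auto simp: has_real_derivative_iff_has_vector_derivative intro!: derivative_eq_intros)
  \<comment> \<open>From \<open>q\<close> on, \<open>sin a\<close> is bounded below by \<open>\<sigma>\<close> and \<open>a'\<close> is bounded above by \<open>M\<close>.\<close>
  define q where "q = (r0 + r1) / 2"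
  have q: "r0 < q" "q < r1" "0 < q" using r0 r01 by (auto simp: q_def)
  define \<sigma> where "\<sigma> = sin (a q)"
  have aq: "0 < a q" "a q < pi / 2" using ab[of q] q a0 by auto
  have \<sigma>: "0 < \<sigma>" unfolding \<sigma>_def using aq by (intro sin_gt_zero) auto
  define M where "M = r1 ^ m * radial_conf \<epsilon> r1 / \<sigma> ^ m"
  have r1: "0 < r1" using r0 r01 by simp
  have M: "M > 0" unfolding M_def using r1 \<sigma> radial_conf_ge_1[OF dom] by (intro divide_pos_pos mult_pos_pos) auto
  have mono_a: "a x \<le> a y" if "r0 < x" "x \<le> y" "y < r1" for x y
  proof (rule DERIV_nonneg_imp_nondecreasing[OF that(2)])
    fix z assume "x \<le> z" "z \<le> y"
    then have z: "r0 < z" "z < r1" "0 < z" using that r0 by auto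
    have "0 < sin (a z)" using ab[OF z(1,2)] a0 by (intro sin_gt_zero) auto
    then have "0 \<le> tan_curv \<epsilon> z ^ m * radial_conf \<epsilon> z / sin (a z) ^ m"
      using tan_curv_pos[OF z(3)] radial_conf_ge_1[OF d1[of z]] z by (intro divide_nonneg_nonneg mult_nonneg_nonneg) auto
    then show "\<exists>D. (a has_real_derivative D) (at z) \<and> 0 \<le> D" using da[OF z(1,2)] by blast
  qed
  have sin_ge: "\<sigma> \<le> sin (a r)" if "q \<le> r" "r < r1" for r
    unfolding \<sigma>_def using mono_a[of q r] ab[of r] aq q that by (subst sin_mono_le_eq) auto
  have close: "pi / 2 - a r \<le> M * (r1 - r)" if r: "q \<le> r" "r < r1" for r
  proof -
    have "\<exists>l z. r < z \<and> z < r1 \<and> (a has_real_derivative l) (at z) \<and> a r1 - a r = (r1 - r) * l"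
    proof (rule MVT[OF r(2)])
      show "continuous_on {r..r1} a" by (rule continuous_on_subset[OF conta]) auto
      show "a differentiable at x" if "r < x" "x < r1" for x
        using da[of x] that r q real_differentiable_def by (metis less_le_trans less_trans)
    qed
    then obtain l z where z: "r < z" "z < r1" "(a has_real_derivative l) (at z)" "a r1 - a r = (r1 - r) * l" by blast
    have z': "r0 < z" "0 < z" "q \<le> z" using z q r by auto
    have dz: "0 < 1 + \<epsilon> * z\<^sup>2 / 4" using z z' by (intro d1) auto
    have "l = tan_curv \<epsilon> z ^ m * radial_conf \<epsilon> z / sin (a z) ^ m"
      using DERIV_unique[OF z(3) da[OF z'(1) z(2)]] .
    also have "\<dots> \<le> M" unfolding M_def
    proof (intro frac_le mult_mono power_mono)
      show "tan_curv \<epsilon> z \<le> r1" using tan_curv_le[of z] z z' by auto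
      show "radial_conf \<epsilon> z \<le> radial_conf \<epsilon> r1" using z z' by (intro radial_conf_mono[OF dom]) auto
      show "\<sigma> \<le> sin (a z)" using sin_ge z z' by auto
      show "0 < \<sigma> ^ m" using \<sigma> by simp
    qed (use r1 \<sigma> tan_curv_pos[OF z'(2)] radial_conf_ge_1[OF dom] radial_conf_ge_1[OF dz] in \<open>auto intro!: mult_nonneg_nonneg\<close>)
    finally show ?thesis using z(4) a1 r by (simp add: mult.commute[of M] mult_left_mono)
  qed
  define K where "K = \<sigma> / M"
  have K: "K > 0" using \<sigma> M by (simp add: K_def)
  have tan_ge: "K / (r1 - r) \<le> radial_conf \<epsilon> r * tan (a r)" if r: "q \<le> r" "r < r1" for r
  proof -
    have c: "0 < cos (a r)" using a_range[OF r(2)] by (intro cos_gt_zero_pi) auto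
    have "cos (a r) = sin (pi / 2 - a r)" by (simp add: sin_diff)
    also have "\<dots> \<le> pi / 2 - a r" using a_range[OF r(2)] by (intro sin_x_le_x) auto
    also have "\<dots> \<le> M * (r1 - r)" by (rule close[OF r])
    finally have "cos (a r) \<le> M * (r1 - r)" .
    then have "\<sigma> / (M * (r1 - r)) \<le> sin (a r) / cos (a r)"
      using c sin_ge[OF r] \<sigma> by (intro frac_le) auto
    then have t: "K / (r1 - r) \<le> tan (a r)" by (simp add: K_def tan_def)
    have "0 \<le> tan (a r)" using t K r by (meson divide_pos_pos diff_gt_0_iff_gt less_le order.trans)
    then have "1 * tan (a r) \<le> radial_conf \<epsilon> r * tan (a r)"
      using radial_conf_ge_1[OF d1[of r]] r q by (intro mult_right_mono) auto
    with t show ?thesis by simp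
  qed
  have U_ge: "U q + K * ln (r1 - q) - K * ln (r1 - r) \<le> U r" if r: "q \<le> r" "r < r1" for r
  proof -
    have "U q + K * ln (r1 - q) \<le> U r + K * ln (r1 - r)"
    proof (rule DERIV_nonneg_imp_nondecreasing[of q r "\<lambda>r. U r + K * ln (r1 - r)"])
      fix x assume "q \<le> x" "x \<le> r"
      then have x: "q \<le> x" "x < r1" "-r1 < x" using r q r1 by auto
      have "((\<lambda>r. U r + K * ln (r1 - r)) has_real_derivative radial_conf \<epsilon> x * tan (a x) - K / (r1 - x)) (at x)"
        using dU[OF x(3,2)] x by (auto intro!: derivative_eq_intros)
      then show "\<exists>y. ((\<lambda>r. U r + K * ln (r1 - r)) has_real_derivative y) (at x) \<and> 0 \<le> y"
        using tan_ge[OF x(1,2)] by (intro exI conjI) auto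
    qed (use r in auto)
    then show ?thesis by simp
  qed
  have "filterlim U at_top (at_left r1)"
  proof (rule filterlim_at_top_mono)
    have l: "filterlim (\<lambda>r. r1 - r) (at_right 0) (at_left r1)"
      unfolding filterlim_at
      by (auto intro!: tendsto_eq_intros simp: eventually_at_filter)
    have "filterlim (\<lambda>r. - ln (r1 - r)) at_top (at_left r1)"
      using filterlim_compose[OF ln_at_0 l] by (simp add: filterlim_uminus_at_top)
    then have "filterlim (\<lambda>r. K * (- ln (r1 - r))) at_top (at_left r1)"
      by (intro filterlim_tendsto_pos_mult_at_top[OF tendsto_const K])
    then show "filterlim (\<lambda>r. (U q + K * ln (r1 - q)) + K * (- ln (r1 - r))) at_top (at_left r1)"
      by (rule filterlim_tendsto_add_at_top[OF tendsto_const])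
    show "\<forall>\<^sub>F r in at_left r1. U q + K * ln (r1 - q) + K * - ln (r1 - r) \<le> U r"
      unfolding eventually_at_left_field using U_ge q by (intro exI[of _ q]) auto
  qed
  then have "translator_profile \<epsilon> r0 r1 a0 m a U"
    using curv r0 r01 dom a0 cta ale ab da dU by unfold_locales (auto simp: U_def)
  then show thesis by (rule that)
qed

end

section \<open>Geodesic balls and spheres\<close>

context curvature_sign begin

lemma space_form_iff: "x \<in> space_form \<epsilon> \<longleftrightarrow> 0 < 1 + \<epsilon> * (norm x)\<^sup>2 / 4"
  by (simp add: space_form_def)

lemma conf_eq: "conf \<epsilon> x = radial_conf \<epsilon> (norm x)"
  by (simp add: conf_def radial_conf_def)

lemma conf_pos: "x \<in> space_form \<epsilon> \<Longrightarrow> 0 < conf \<epsilon> x"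
  by (simp add: conf_def space_form_def)

lemma cball_subset_space_form:
  "0 < 1 + \<epsilon> * b\<^sup>2 / 4 \<Longrightarrow> norm x \<le> b \<Longrightarrow> x \<in> space_form \<epsilon>"
  unfolding space_form_iff by (rule chart_domain_mono[of b]) auto

lemma continuous_on_conf: "continuous_on (space_form \<epsilon>) (conf \<epsilon>)"
  unfolding conf_def space_form_def by (intro continuous_intros) auto

lemma curve_length_integrable:
  assumes "\<gamma> C1_differentiable_on {0..1}" "\<gamma> ` {0..1} \<subseteq> space_form \<epsilon>"
  shows "(\<lambda>t. conf \<epsilon> (\<gamma> t) * norm (vector_derivative \<gamma> (at t))) integrable_on {0..1}"
proof (rule integrable_continuous_real, intro continuous_intros)
  have "continuous_on {0..1} \<gamma>"
    using assms(1) C1_differentiable_imp_continuous_on by blast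
  then show "continuous_on {0..1} (\<lambda>t. conf \<epsilon> (\<gamma> t))"
    by (rule continuous_on_compose2[OF continuous_on_conf _ assms(2)])
  show "continuous_on {0..1} (\<lambda>t. vector_derivative \<gamma> (at t))"
    using assms(1) C1_differentiable_on_eq by blast
qed

lemma curve_length_nonneg:
  assumes "\<gamma> C1_differentiable_on {0..1}" "\<gamma> ` {0..1} \<subseteq> space_form \<epsilon>"
  shows "0 \<le> curve_length \<epsilon> \<gamma>"
  unfolding curve_length_def
  by (rule integral_nonneg[OF curve_length_integrable[OF assms]])
    (use assms(2) in \<open>auto intro!: mult_nonneg_nonneg less_imp_le[OF conf_pos]\<close>)

lemma geo_dist_le_curve_length:
  assumes "\<gamma> C1_differentiable_on {0..1}" "\<gamma> ` {0..1} \<subseteq> space_form \<epsilon>" "\<gamma> 0 = x" "\<gamma> 1 = y"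
  shows "geo_dist \<epsilon> x y \<le> curve_length \<epsilon> \<gamma>"
  unfolding geo_dist_def
  by (rule cInf_lower) (use assms in \<open>auto intro!: bdd_belowI[of _ 0] curve_length_nonneg\<close>)

lemma segment_curve:
  fixes y z :: "real ^ 'n" and \<gamma> :: "real \<Rightarrow> real ^ 'n"
  assumes \<gamma>_def: "\<gamma> = (\<lambda>t. y + t *\<^sub>R (z - y))"
    and b: "0 < 1 + \<epsilon> * b\<^sup>2 / 4" "norm y \<le> b" "norm z \<le> b"
  shows "\<gamma> C1_differentiable_on {0..1}" "\<And>t. t \<in> {0..1} \<Longrightarrow> norm (\<gamma> t) \<le> b"
    "\<gamma> ` {0..1} \<subseteq> space_form \<epsilon>" "\<gamma> 0 = y" "\<gamma> 1 = z"
    "\<And>t. vector_derivative \<gamma> (at t) = z - y"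
proof -
  have d: "(\<gamma> has_vector_derivative z - y) (at t)" for t
    unfolding \<gamma>_def by (auto intro!: derivative_eq_intros)
  then show "\<And>t. vector_derivative \<gamma> (at t) = z - y" by (rule vector_derivative_at)
  show "\<gamma> C1_differentiable_on {0..1}"
    unfolding C1_differentiable_on_def using d by (intro exI[of _ "\<lambda>_. z - y"]) auto
  show n: "norm (\<gamma> t) \<le> b" if "t \<in> {0..1}" for t
  proof -
    have "\<gamma> t = (1 - t) *\<^sub>R y + t *\<^sub>R z" by (simp add: \<gamma>_def algebra_simps)
    also have "\<dots> \<in> cball 0 b"
      using that b by (intro convexD[OF convex_cball]) auto
    finally show ?thesis unfolding mem_cball_0 .
  qed
  show "\<gamma> ` {0..1} \<subseteq> space_form \<epsilon>" using n cball_subset_space_form[OF b(1)] by blast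
qed (simp_all add: \<gamma>_def)

text \<open>
  The straight segment is a competitor, and along it the conformal factor is at most its value at
  the largest radius.
\<close>

lemma geo_dist_le:
  fixes y z :: "real ^ 'n"
  assumes b: "0 < 1 + \<epsilon> * b\<^sup>2 / 4" "norm y \<le> b" "norm z \<le> b"
  shows "geo_dist \<epsilon> y z \<le> radial_conf \<epsilon> b * norm (z - y)"
proof -
  define \<gamma> where "\<gamma> = (\<lambda>t::real. y + t *\<^sub>R (z - y))"
  note s = segment_curve[OF \<gamma>_def b]
  have "curve_length \<epsilon> \<gamma> \<le> integral {0..1} (\<lambda>t::real. radial_conf \<epsilon> b * norm (z - y))"
    unfolding curve_length_def
  proof (rule integral_le[OF curve_length_integrable[OF s(1,3)] integrable_const_ivl])
    fix t :: real assume "t \<in> {0..1}"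
    then show "conf \<epsilon> (\<gamma> t) * norm (vector_derivative \<gamma> (at t)) \<le> radial_conf \<epsilon> b * norm (z - y)"
      unfolding conf_eq s(6) using s(2)[of t] by (intro mult_right_mono radial_conf_mono[OF b(1)]) auto
  qed
  with geo_dist_le_curve_length[OF s(1,3,4,5)] show ?thesis by simp
qed

text \<open>
  The radial segment has length \<open>geo_radius (norm x)\<close>. No curve is shorter: its component along
  the direction of \<open>x\<close> moves on a line through the origin with at most the same speed and, the
  conformal factor being radially increasing, with at most the same conformal factor. Projecting on
  a fixed direction avoids differentiating the norm where the curve meets the origin.
\<close>

lemma geo_dist_origin:
  fixes x :: "real ^ 'n"
  assumes x: "x \<in> space_form \<epsilon>"
  shows "geo_dist \<epsilon> 0 x = geo_radius \<epsilon> (norm x)"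
proof -
  define \<gamma> where "\<gamma> = (\<lambda>t::real. 0 + t *\<^sub>R (x - 0))"
  have dx: "0 < 1 + \<epsilon> * (norm x)\<^sup>2 / 4" using x by (simp add: space_form_iff)
  note s = segment_curve[OF \<gamma>_def dx _ order_refl, unfolded norm_zero, OF norm_ge_zero]
  have "((\<lambda>t. conf \<epsilon> (\<gamma> t) * norm (vector_derivative \<gamma> (at t))) has_integral
      geo_radius \<epsilon> (1 * norm x) - geo_radius \<epsilon> (0 * norm x)) {0..1}"
  proof (rule fundamental_theorem_of_calculus)
    fix t :: real assume t: "t \<in> {0..1}"
    have "0 < 1 + \<epsilon> * (t * norm x)\<^sup>2 / 4"
      using t by (intro chart_domain_mono[OF dx]) (auto simp: abs_mult mult_left_le_one_le)
    then have "((\<lambda>t. geo_radius \<epsilon> (t * norm x)) has_real_derivative radial_conf \<epsilon> (t * norm x) * norm x) (at t)"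
      by (intro DERIV_chain2[OF geo_radius_deriv]) (auto intro!: derivative_eq_intros)
    then show "((\<lambda>t. geo_radius \<epsilon> (t * norm x)) has_vector_derivative
        conf \<epsilon> (\<gamma> t) * norm (vector_derivative \<gamma> (at t))) (at t within {0..1})"
      using t unfolding conf_eq s(6)
      by (auto simp: \<gamma>_def has_real_derivative_iff_has_vector_derivative intro: has_vector_derivative_at_within)
  qed simp
  then have len: "curve_length \<epsilon> \<gamma> = geo_radius \<epsilon> (norm x)"
    unfolding curve_length_def by (simp add: integral_unique)
  show ?thesis
  proof (rule antisym)
    show "geo_dist \<epsilon> 0 x \<le> geo_radius \<epsilon> (norm x)"
      using geo_dist_le_curve_length[OF s(1,3,4,5)] len by simp
    show "geo_radius \<epsilon> (norm x) \<le> geo_dist \<epsilon> 0 x"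
      unfolding geo_dist_def
    proof (rule cInf_greatest)
      show "{curve_length \<epsilon> \<gamma> |\<gamma>. \<gamma> C1_differentiable_on {0..1} \<and> \<gamma> ` {0..1} \<subseteq> space_form \<epsilon> \<and> \<gamma> 0 = 0 \<and> \<gamma> 1 = x} \<noteq> {}"
        using s(1,3,4,5) by blast
      fix L assume "L \<in> {curve_length \<epsilon> \<gamma> |\<gamma>. \<gamma> C1_differentiable_on {0..1} \<and> \<gamma> ` {0..1} \<subseteq> space_form \<epsilon> \<and> \<gamma> 0 = 0 \<and> \<gamma> 1 = x}"
      then obtain \<beta> where L: "L = curve_length \<epsilon> \<beta>" and \<beta>: "\<beta> C1_differentiable_on {0..1}"
        "\<beta> ` {0..1} \<subseteq> space_form \<epsilon>" "\<beta> 0 = 0" "\<beta> 1 = x" by blast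
      define e where "e = x /\<^sub>R norm x"
      have ne: "norm e \<le> 1" by (cases "x = 0") (simp_all add: e_def)
      have xe: "x \<bullet> e = norm x" by (cases "x = 0") (simp_all add: e_def dot_square_norm power2_eq_square)
      have le: "\<bar>y \<bullet> e\<bar> \<le> norm y" for y
        using Cauchy_Schwarz_ineq2[of y e] mult_left_mono[OF ne, of "norm y"] by simp
      let ?D = "\<lambda>t. vector_derivative \<beta> (at t)"
      have "((\<lambda>t. radial_conf \<epsilon> (\<beta> t \<bullet> e) * (?D t \<bullet> e)) has_integral
          geo_radius \<epsilon> (\<beta> 1 \<bullet> e) - geo_radius \<epsilon> (\<beta> 0 \<bullet> e)) {0..1}"
      proof (rule fundamental_theorem_of_calculus)
        fix t :: real assume t: "t \<in> {0..1}"
        have "\<beta> t \<in> space_form \<epsilon>" using \<beta>(2) t by auto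
        then have "0 < 1 + \<epsilon> * (\<beta> t \<bullet> e)\<^sup>2 / 4"
          unfolding space_form_iff by (rule chart_domain_mono) (use le[of "\<beta> t"] in auto)
        moreover have "((\<lambda>t. \<beta> t \<bullet> e) has_real_derivative (?D t \<bullet> e)) (at t)"
        proof -
          have "(\<beta> has_vector_derivative ?D t) (at t)"
            using \<beta>(1) t by (simp add: C1_differentiable_on_eq vector_derivative_works)
          from bounded_linear.has_vector_derivative[OF bounded_linear_inner_left this]
          show ?thesis by (simp add: has_real_derivative_iff_has_vector_derivative)
        qed
        ultimately have "((\<lambda>t. geo_radius \<epsilon> (\<beta> t \<bullet> e)) has_real_derivative radial_conf \<epsilon> (\<beta> t \<bullet> e) * (?D t \<bullet> e)) (at t)"
          by (intro DERIV_chain2[OF geo_radius_deriv])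
        then show "((\<lambda>t. geo_radius \<epsilon> (\<beta> t \<bullet> e)) has_vector_derivative
          radial_conf \<epsilon> (\<beta> t \<bullet> e) * (?D t \<bullet> e)) (at t within {0..1})"
          by (auto simp: has_real_derivative_iff_has_vector_derivative intro: has_vector_derivative_at_within)
      qed simp
      then have "geo_radius \<epsilon> (norm x) = integral {0..1} (\<lambda>t. radial_conf \<epsilon> (\<beta> t \<bullet> e) * (?D t \<bullet> e))"
        and int: "(\<lambda>t. radial_conf \<epsilon> (\<beta> t \<bullet> e) * (?D t \<bullet> e)) integrable_on {0..1}"
        using \<beta> xe by (auto simp: integral_unique)
      note this(1)
      also have "integral {0..1} (\<lambda>t. radial_conf \<epsilon> (\<beta> t \<bullet> e) * (?D t \<bullet> e)) \<le> curve_length \<epsilon> \<beta>" unfolding curve_length_def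
      proof (rule integral_le[OF int curve_length_integrable[OF \<beta>(1,2)]])
        fix t :: real assume t: "t \<in> {0..1}"
        have d: "0 < 1 + \<epsilon> * (norm (\<beta> t))\<^sup>2 / 4" using \<beta>(2) t unfolding space_form_iff[symmetric] by auto
        have d': "0 < 1 + \<epsilon> * (\<beta> t \<bullet> e)\<^sup>2 / 4" using le[of "\<beta> t"] by (intro chart_domain_mono[OF d]) auto
        have "radial_conf \<epsilon> (\<beta> t \<bullet> e) * (?D t \<bullet> e) \<le> radial_conf \<epsilon> (\<beta> t \<bullet> e) * norm (?D t)"
          using radial_conf_ge_1[OF d'] le[of "?D t"] by (intro mult_left_mono) auto
        also have "\<dots> \<le> conf \<epsilon> (\<beta> t) * norm (?D t)"
          unfolding conf_eq using le[of "\<beta> t"] by (intro mult_right_mono radial_conf_mono[OF d]) auto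
        finally show "radial_conf \<epsilon> (\<beta> t \<bullet> e) * (?D t \<bullet> e) \<le> conf \<epsilon> (\<beta> t) * norm (?D t)" .
      qed
      finally show "geo_radius \<epsilon> (norm x) \<le> L" using L by simp
    qed
  qed
qed

lemma geo_ball_eq:
  assumes "0 \<le> r" "0 < 1 + \<epsilon> * r\<^sup>2 / 4"
  shows "geo_ball \<epsilon> (geo_radius \<epsilon> r) = {x :: real ^ 'n. norm x < r}"
proof (intro set_eqI iffI)
  fix x :: "real ^ 'n" assume "x \<in> geo_ball \<epsilon> (geo_radius \<epsilon> r)"
  then show "x \<in> {x. norm x < r}"
    using assms by (auto simp: geo_ball_def geo_dist_origin geo_radius_less_iff space_form_iff)
next
  fix x :: "real ^ 'n" assume "x \<in> {x. norm x < r}"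
  then show "x \<in> geo_ball \<epsilon> (geo_radius \<epsilon> r)"
    using assms cball_subset_space_form[OF assms(2), of x]
    by (auto simp: geo_ball_def geo_dist_origin geo_radius_strict_mono)
qed

lemma geo_sphere_eq:
  assumes "0 \<le> r" "0 < 1 + \<epsilon> * r\<^sup>2 / 4"
  shows "geo_sphere \<epsilon> (geo_radius \<epsilon> r) = {x :: real ^ 'n. norm x = r}"
proof (intro set_eqI iffI)
  fix x :: "real ^ 'n" assume "x \<in> geo_sphere \<epsilon> (geo_radius \<epsilon> r)"
  then show "x \<in> {x. norm x = r}"
    using assms by (auto simp: geo_sphere_def geo_dist_origin geo_radius_eq_iff space_form_iff)
next
  fix x :: "real ^ 'n" assume "x \<in> {x. norm x = r}"
  then show "x \<in> geo_sphere \<epsilon> (geo_radius \<epsilon> r)"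
    using assms cball_subset_space_form[OF assms(2), of x]
    by (auto simp: geo_sphere_def geo_dist_origin)
qed

end

section \<open>Graphs as hypersurfaces\<close>

text \<open>
  In finite dimension a field of derivatives is continuous as soon as its value on each fixed
  vector is.
\<close>

lemma C1_onI:
  fixes f :: "'a::euclidean_space \<Rightarrow> 'b::real_normed_vector"
  assumes D: "\<And>x. x \<in> S \<Longrightarrow> (f has_derivative D x) (at x)"
    and cont: "\<And>v. continuous_on S (\<lambda>x. D x v)"
  shows "C1_on S f"
  unfolding C1_on_def
proof (intro exI conjI ballI)
  have ap: "blinfun_apply (Blinfun (D x)) = D x" if "x \<in> S" for x
    using has_derivative_bounded_linear[OF D[OF that]] by (rule bounded_linear_Blinfun_apply)
  show "(f has_derivative blinfun_apply (Blinfun (D x))) (at x)" if "x \<in> S" for x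
    using D[OF that] ap[OF that] by simp
  show "continuous_on S (\<lambda>x. Blinfun (D x))"
  proof (rule continuous_on_blinfun_componentwise)
    fix i :: 'a
    show "continuous_on S (\<lambda>x. blinfun_apply (Blinfun (D x)) i)"
      using cont[of i] by (subst continuous_on_cong[OF refl]) (auto simp: ap)
  qed
qed

lemma C1_on_imp_continuous_on: "C1_on S f \<Longrightarrow> continuous_on S f"
  unfolding C1_on_def
  by (metis has_derivative_continuous continuous_at_imp_continuous_on)

lemma C2_on_imp_C1_on: "C2_on S f \<Longrightarrow> C1_on S f"
  unfolding C2_on_def C1_on_def[of S f] using C1_on_imp_continuous_on by blast

lemma C1_on_has_frechet_derivative:
  "C1_on S f \<Longrightarrow> x \<in> S \<Longrightarrow> (f has_derivative frechet_derivative f (at x)) (at x)"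
  unfolding C1_on_def using frechet_derivative_works differentiableI by metis

lemma C1_on_compose_fst:
  fixes g :: "'a::euclidean_space \<Rightarrow> real"
  assumes "C1_on B g" shows "C1_on (B \<times> (UNIV :: real set)) (\<lambda>q. g (fst q))"
proof -
  obtain g' where g': "\<And>x. x \<in> B \<Longrightarrow> (g has_derivative blinfun_apply (g' x)) (at x)"
    "continuous_on B g'" using assms unfolding C1_on_def by blast
  show ?thesis
  proof (rule C1_onI)
    fix q :: "'a \<times> real" assume "q \<in> B \<times> UNIV"
    then have "fst q \<in> B" by auto
    then show "((\<lambda>q. g (fst q)) has_derivative (\<lambda>v. g' (fst q) (fst v))) (at q)"
      by (intro has_derivative_compose[OF has_derivative_fst[OF has_derivative_ident] g'(1)])
  next
    fix v :: "'a \<times> real"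
    show "continuous_on (B \<times> UNIV) (\<lambda>q :: 'a \<times> real. g' (fst q) (fst v))"
      by (intro continuous_intros continuous_on_compose2[OF g'(2)]) auto
  qed
qed

lemma C1_on_vertical_defect:
  fixes u :: "'a::euclidean_space \<Rightarrow> real"
  assumes "C1_on B u" shows "C1_on (B \<times> UNIV) (\<lambda>q. snd q - u (fst q))"
proof -
  obtain u' where u': "\<And>x. x \<in> B \<Longrightarrow> (u has_derivative blinfun_apply (u' x)) (at x)"
    "continuous_on B u'" using assms unfolding C1_on_def by blast
  show ?thesis
  proof (rule C1_onI)
    fix q :: "'a \<times> real" assume "q \<in> B \<times> UNIV"
    then have "fst q \<in> B" by auto
    then have "((\<lambda>q. u (fst q)) has_derivative (\<lambda>v. u' (fst q) (fst v))) (at q)"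
      by (intro has_derivative_compose[OF has_derivative_fst[OF has_derivative_ident] u'(1)])
    then show "((\<lambda>q. snd q - u (fst q)) has_derivative (\<lambda>v. snd v - u' (fst q) (fst v))) (at q)"
      by (intro has_derivative_diff has_derivative_snd has_derivative_ident)
  next
    fix v :: "'a \<times> real"
    show "continuous_on (B \<times> UNIV) (\<lambda>q :: 'a \<times> real. snd v - u' (fst q) (fst v))"
      by (intro continuous_intros continuous_on_compose2[OF u'(2)]) auto
  qed
qed

lemma C2_on_vertical_defect:
  fixes u :: "'a::euclidean_space \<Rightarrow> real"
  assumes "C2_on B u" shows "C2_on (B \<times> UNIV) (\<lambda>q. snd q - u (fst q))"
proof -
  obtain u' u'' where u': "\<And>x. x \<in> B \<Longrightarrow> (u has_derivative blinfun_apply (u' x)) (at x)"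
    and u'': "\<And>x. x \<in> B \<Longrightarrow> (u' has_derivative blinfun_apply (u'' x)) (at x)" "continuous_on B u''"
    using assms unfolding C2_on_def C1_on_def by blast
  define P :: "('a \<times> real) \<Rightarrow>\<^sub>L 'a" where "P = Blinfun fst"
  define Q :: "('a \<times> real) \<Rightarrow>\<^sub>L real" where "Q = Blinfun snd"
  have PQ: "blinfun_apply P = fst" "blinfun_apply Q = snd"
    unfolding P_def Q_def by (auto intro!: bounded_linear_Blinfun_apply bounded_linear_fst bounded_linear_snd)
  show ?thesis unfolding C2_on_def
  proof (intro exI conjI ballI)
    fix q :: "'a \<times> real" assume "q \<in> B \<times> UNIV"
    then have "fst q \<in> B" by auto
    then have "((\<lambda>q. u (fst q)) has_derivative (\<lambda>v. u' (fst q) (fst v))) (at q)"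
      by (intro has_derivative_compose[OF has_derivative_fst[OF has_derivative_ident] u'(1)])
    then have "((\<lambda>q. snd q - u (fst q)) has_derivative (\<lambda>v. snd v - u' (fst q) (fst v))) (at q)"
      by (intro has_derivative_diff has_derivative_snd has_derivative_ident)
    then show "((\<lambda>q. snd q - u (fst q)) has_derivative blinfun_apply (Q - (u' (fst q) o\<^sub>L P))) (at q)"
      by (rule has_derivative_eq_rhs) (simp add: fun_eq_iff PQ blinfun.diff_left)
  next
    show "C1_on (B \<times> UNIV) (\<lambda>q :: 'a \<times> real. Q - (u' (fst q) o\<^sub>L P))"
    proof (rule C1_onI)
      fix q :: "'a \<times> real" assume "q \<in> B \<times> UNIV"
      then have "fst q \<in> B" by auto
      then have "((\<lambda>q. u' (fst q)) has_derivative (\<lambda>v. u'' (fst q) (fst v))) (at q)"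
        by (intro has_derivative_compose[OF has_derivative_fst[OF has_derivative_ident] u''(1)])
      from bounded_linear.has_derivative[OF bounded_bilinear.bounded_linear_left[OF bounded_bilinear_blinfun_compose] this]
      have "((\<lambda>q. (u' (fst q) o\<^sub>L P)) has_derivative (\<lambda>v. (u'' (fst q) (fst v) o\<^sub>L P))) (at q)" .
      from has_derivative_diff[OF has_derivative_const[of Q] this]
      show "((\<lambda>q :: 'a \<times> real. Q - (u' (fst q) o\<^sub>L P)) has_derivative (\<lambda>v. 0 - (u'' (fst q) (fst v) o\<^sub>L P))) (at q)" .
    next
      fix v :: "'a \<times> real"
      show "continuous_on (B \<times> UNIV) (\<lambda>q :: 'a \<times> real. 0 - (u'' (fst q) (fst v) o\<^sub>L P))"
        by (intro continuous_intros bounded_bilinear.continuous_on[OF bounded_bilinear_blinfun_compose] 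
              continuous_on_compose2[OF u''(2)]) auto
    qed
  qed
qed

lemma interior_point_C2_imp_C1:
  assumes "interior_point C2_on \<Sigma> p" shows "interior_point C1_on \<Sigma> p"
  using assms C2_on_imp_C1_on unfolding interior_point_def by meson

lemma interior_point_graph:
  fixes u :: "real ^ 'n \<Rightarrow> real"
  assumes B: "open B" "x \<in> B" "B \<subseteq> D" and C1: "C1_on B u"
    and C: "C (B \<times> UNIV) (\<lambda>q. snd q - u (fst q))"
  shows "interior_point C ((\<lambda>y. (y, u y)) ` D) (x, u x)"
  unfolding interior_point_def
proof (intro conjI exI)
  let ?F = "\<lambda>q :: 'n amb. snd q - u (fst q)"
  show "open (B \<times> (UNIV :: real set))" using B by (intro open_Times) auto
  show "(\<lambda>y. (y, u y)) ` D \<inter> B \<times> UNIV = {q \<in> B \<times> UNIV. ?F q = 0}" using B by force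
  obtain L where L: "(u has_derivative L) (at x)"
    using C1 B unfolding C1_on_def by blast
  have "((\<lambda>q. u (fst q)) has_derivative (\<lambda>v. L (fst v))) (at (x, u x))"
    by (rule has_derivative_compose[OF has_derivative_fst[OF has_derivative_ident]]) (use L in simp)
  then have "(?F has_derivative (\<lambda>v. snd v - L (fst v))) (at (x, u x))"
    by (intro has_derivative_diff has_derivative_snd has_derivative_ident)
  then have "frechet_derivative ?F (at (x, u x)) = (\<lambda>v. snd v - L (fst v))"
    by (rule frechet_derivative_at[symmetric])
  moreover have "L 0 = 0" using has_derivative_linear[OF L] by (rule linear_0)
  then have "surj (\<lambda>v. snd v - L (fst v))"
    by (intro surjI[of _ "\<lambda>s. (0, s)"]) simp
  ultimately show "surj (frechet_derivative ?F (at (x, u x)))" by simp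
qed (use B C in auto)

text \<open>
  The function \<open>u\<close> is defined on a full neighbourhood \<open>B\<close>; the part of the graph over
  \<open>{y. 0 \<le> g y}\<close> has a boundary point over \<open>x\<close> if \<open>g\<close> is regular there.
\<close>

lemma boundary_point_graph:
  fixes u g :: "real ^ 'n \<Rightarrow> real"
  assumes B: "open B" "x \<in> B" and D: "D \<inter> B = {y \<in> B. 0 \<le> g y}" and gx: "g x = 0"
    and C1: "C1_on B u" "C1_on B g" and g': "(g has_derivative g') (at x)" "g' w \<noteq> 0"
  shows "boundary_point C1_on ((\<lambda>y. (y, u y)) ` D) (x, u x)"
proof -
  let ?F = "\<lambda>q :: 'n amb. snd q - u (fst q)"
  let ?G = "\<lambda>q :: 'n amb. g (fst q)"
  obtain L where L: "(u has_derivative L) (at x)"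
    using C1(1) B unfolding C1_on_def by blast
  have "((\<lambda>q. u (fst q)) has_derivative (\<lambda>v. L (fst v))) (at (x, u x))"
    by (rule has_derivative_compose[OF has_derivative_fst[OF has_derivative_ident]]) (use L in simp)
  then have "(?F has_derivative (\<lambda>v. snd v - L (fst v))) (at (x, u x))"
    by (intro has_derivative_diff has_derivative_snd has_derivative_ident)
  then have F: "frechet_derivative ?F (at (x, u x)) = (\<lambda>v. snd v - L (fst v))"
    by (rule frechet_derivative_at[symmetric])
  have "(?G has_derivative (\<lambda>v. g' (fst v))) (at (x, u x))"
    by (rule has_derivative_compose[OF has_derivative_fst[OF has_derivative_ident]]) (use g' in simp)
  then have G: "frechet_derivative ?G (at (x, u x)) = (\<lambda>v. g' (fst v))"
    by (rule frechet_derivative_at[symmetric])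
  have lin: "linear g'" using g'(1) by (rule has_derivative_linear)
  have "open (B \<times> (UNIV :: real set))" using B by (intro open_Times) auto
  moreover have "(\<lambda>y. (y, u y)) ` D \<inter> B \<times> UNIV = {q \<in> B \<times> UNIV. ?F q = 0 \<and> 0 \<le> ?G q}" using D by force
  moreover have "surj (\<lambda>v. (frechet_derivative ?F (at (x, u x)) v, frechet_derivative ?G (at (x, u x)) v))"
    unfolding F G
    by (rule surjI[of _ "\<lambda>st. ((snd st / g' w) *\<^sub>R w, fst st + L ((snd st / g' w) *\<^sub>R w))"])
      (use g'(2) linear_cmul[OF lin] in \<open>simp add: prod_eq_iff\<close>)
  moreover have "(x, u x) \<in> (\<lambda>y. (y, u y)) ` D" using D B gx by auto
  moreover have "(x, u x) \<in> B \<times> UNIV" "?G (x, u x) = 0" using B gx by auto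
  moreover note C1_on_vertical_defect[OF C1(1)] C1_on_compose_fst[OF C1(2)]
  ultimately show ?thesis
    unfolding boundary_point_def
    by blast
qed

text \<open>
  Boundary points are intrinsic. If the graph were also described by \<open>F = 0 \<le> G\<close> with \<open>G = 0\<close> at
  the point, then \<open>F\<close> and \<open>G\<close> restricted to the graph would both have a local minimum there, so both
  differentials would vanish on the tangent hyperplane. Then the pair of differentials has rank
  at most 1 and cannot be onto the plane.
\<close>

lemma not_boundary_point_graph:
  fixes u :: "real ^ 'n \<Rightarrow> real"
  assumes B: "open B" "x \<in> B" "B \<subseteq> D" and L: "(u has_derivative L) (at x)"
  shows "\<not> boundary_point C1_on ((\<lambda>y. (y, u y)) ` D) (x, u x)"
proof
  let ?p = "(x, u x)"
  assume "boundary_point C1_on ((\<lambda>y. (y, u y)) ` D) ?p"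
  then obtain V and F G :: "'n amb \<Rightarrow> real" where V: "open V" "?p \<in> V" "C1_on V F" "C1_on V G"
    and eq: "(\<lambda>y. (y, u y)) ` D \<inter> V = {q \<in> V. F q = 0 \<and> 0 \<le> G q}" and Gp: "G ?p = 0"
    and surj: "surj (\<lambda>v. (frechet_derivative F (at ?p) v, frechet_derivative G (at ?p) v))"
    unfolding boundary_point_def by blast
  have dgr: "((\<lambda>y. (y, u y)) has_derivative (\<lambda>v. (v, L v))) (at x)"
    using L by (intro has_derivative_Pair has_derivative_ident)
  have "\<forall>\<^sub>F y in at x. (y, u y) \<in> V"
    using has_derivative_continuous[OF dgr] V(2)
    unfolding continuous_within by (rule topological_tendstoD[OF _ V(1)])
  moreover have "\<forall>\<^sub>F y in at x. y \<in> B"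
    using B(1,2) by (rule eventually_at_in_open')
  ultimately have "\<forall>\<^sub>F y in at x. F (y, u y) = 0 \<and> 0 \<le> G (y, u y)"
    by eventually_elim (use eq B in auto)
  then have "\<forall>\<^sub>F y in nhds x. F (y, u y) = 0 \<and> 0 \<le> G (y, u y)"
    unfolding eventually_nhds_conv_at using eq B V by auto
  then obtain e where e: "e > 0" "\<And>y. dist y x < e \<Longrightarrow> F (y, u y) = 0 \<and> 0 \<le> G (y, u y)"
    unfolding eventually_nhds_metric by blast
  have zero: "frechet_derivative f (at ?p) (v, L v) = 0"
    if f: "C1_on V f" "\<And>y. dist y x < e \<Longrightarrow> f ?p \<le> f (y, u y)"
    for f :: "'n amb \<Rightarrow> real" and v
  proof -
    have "((\<lambda>y. f (y, u y)) has_derivative (\<lambda>v. frechet_derivative f (at ?p) (v, L v))) (at x)"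
      by (rule has_derivative_compose[OF dgr C1_on_has_frechet_derivative[OF f(1) V(2)]])
    then have "(\<lambda>v. frechet_derivative f (at ?p) (v, L v)) = (\<lambda>v. 0)"
      by (rule has_derivative_local_min)
        (use e(1) f(2) in \<open>auto simp: eventually_at intro!: exI[of _ e]\<close>)
    then show ?thesis by (rule fun_cong)
  qed
  have F0: "frechet_derivative F (at ?p) (v, L v) = 0" for v
    by (rule zero[OF V(3)]) (use e in auto)
  have G0: "frechet_derivative G (at ?p) (v, L v) = 0" for v
    by (rule zero[OF V(4)]) (use e Gp in auto)
  \<comment> \<open>A linear form that vanishes on the tangent hyperplane is determined by its value on the vertical vector.\<close>
  have lin: "f (v, s) = (s - L v) * f (0, 1)" if "linear f" "\<And>v. f (v, L v) = 0"
    for f :: "'n amb \<Rightarrow> real" and v s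
  proof -
    have "(v, s) = (v, L v) + (s - L v) *\<^sub>R (0, 1)" by simp
    then have "f (v, s) = f (v, L v) + (s - L v) *\<^sub>R f (0, 1)"
      using linear_add[OF that(1), of "(v, L v)" "(s - L v) *\<^sub>R (0, 1)"]
        linear_cmul[OF that(1), of "s - L v" "(0, 1)"] by simp
    then show ?thesis using that(2) by simp
  qed
  note linF = lin[OF has_derivative_linear[OF C1_on_has_frechet_derivative[OF V(3,2)]] F0]
  note linG = lin[OF has_derivative_linear[OF C1_on_has_frechet_derivative[OF V(4,2)]] G0]
  define b c where "b = frechet_derivative F (at ?p) (0, 1)" and "c = frechet_derivative G (at ?p) (0, 1)"
  have "\<exists>k::real. (y, z) = (k * b, k * c)" for y z
  proof -
    obtain w where "(y, z) = (frechet_derivative F (at ?p) w, frechet_derivative G (at ?p) w)"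
      using surjD[OF surj, of "(y, z)"] by auto
    then have "y = (snd w - L (fst w)) * b" "z = (snd w - L (fst w)) * c"
      using linF[of "fst w" "snd w"] linG[of "fst w" "snd w"] unfolding b_def c_def by auto
    then show ?thesis by blast
  qed
  from this[of 1 0] this[of 0 1] show False by auto
qed

text \<open>
  Velocities of one-sided curves are transported even by a derivative that is only known within
  the set containing the curve.
\<close>

lemma curve_velocity_image:
  fixes f :: "'a::real_normed_vector \<Rightarrow> 'b::real_normed_vector"
  assumes \<gamma>: "\<gamma> (0::real) \<in> S" "\<forall>\<^sub>F t in at_right 0. \<gamma> t \<in> S" "(\<gamma> has_vector_derivative v) (at_right 0)"
    and f: "(f has_derivative f') (at (\<gamma> 0) within S)"
  shows "((\<lambda>t. f (\<gamma> t)) has_vector_derivative f' v) (at_right 0)"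
proof -
  obtain d where d: "d > 0" "\<And>t. 0 < t \<Longrightarrow> t < d \<Longrightarrow> \<gamma> t \<in> S"
    using \<gamma>(2) unfolding eventually_at_right_field by blast
  have eq: "at 0 within {0..<d} = at_right 0"
    by (rule at_within_nhd[of _ "{..<d}"]) (use d(1) in auto)
  have "\<gamma> ` {0..<d} \<subseteq> S" using d \<gamma>(1) by (metis atLeastLessThan_iff image_subsetI le_less)
  from vector_derivative_diff_chain_within[OF \<gamma>(3)[folded eq] has_derivative_subset[OF f this]]
  show ?thesis unfolding eq by (simp add: o_def)
qed

text \<open>
  The function \<open>u\<close> may be an extension of the function whose graph is considered; the assumption
  on directions pointing into \<open>D\<close> covers interior points and smooth edges alike.
\<close>

lemma tangent_space_graph:
  fixes u :: "real ^ 'n \<Rightarrow> real"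
  assumes x: "x \<in> D" and L: "(u has_derivative L) (at x)"
    and D: "span {v. \<forall>\<^sub>F t in at_right 0. x + t *\<^sub>R v \<in> D} = UNIV"
  shows "tangent_space ((\<lambda>y. (y, u y)) ` D) (x, u x) = range (\<lambda>v. (v, L v))" (is "tangent_space ?\<Sigma> ?p = ?T")
proof
  have lin: "linear (\<lambda>v. (v, L v))"
    using linear_add[OF has_derivative_linear[OF L]] linear_cmul[OF has_derivative_linear[OF L]]
    by (intro linearI) auto
  have "subspace ?T" by (rule linear_subspace_image[OF lin subspace_UNIV])
  then show "tangent_space ?\<Sigma> ?p \<subseteq> ?T"
    unfolding tangent_space_def
  proof (intro span_minimal subsetI, clarify)
    fix v s and \<gamma> :: "real \<Rightarrow> 'n amb"
    assume \<gamma>: "\<gamma> 0 = ?p" "\<forall>\<^sub>F t in at_right 0. \<gamma> t \<in> ?\<Sigma>" "(\<gamma> has_vector_derivative (v, s)) (at_right 0)"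
    have m: "\<gamma> 0 \<in> ?\<Sigma>" using \<gamma>(1) x by auto
    have "((\<lambda>q. u (fst q)) has_derivative (\<lambda>v. L (fst v))) (at (\<gamma> 0) within ?\<Sigma>)"
      by (rule has_derivative_compose[OF has_derivative_fst[OF has_derivative_ident]]) (use L \<gamma>(1) in simp)
    from curve_velocity_image[OF m \<gamma>(2,3) has_derivative_diff[OF has_derivative_snd[OF has_derivative_ident] this]]
    have "((\<lambda>t. snd (\<gamma> t) - u (fst (\<gamma> t))) has_vector_derivative s - L v) (at_right 0)" by simp
    moreover have "((\<lambda>q. snd q - u (fst q)) has_derivative (\<lambda>_. 0)) (at (\<gamma> 0) within ?\<Sigma>)"
      by (rule has_derivative_transform[OF m _ has_derivative_const[of 0]]) auto
    from curve_velocity_image[OF m \<gamma>(2,3) this]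
    have "((\<lambda>t. snd (\<gamma> t) - u (fst (\<gamma> t))) has_vector_derivative 0) (at_right 0)" .
    ultimately have "s - L v = 0"
      by (intro vector_derivative_unique_within[of 0 "{0<..}"]) (auto simp: trivial_limit_at_right_real)
    then show "(v, s) \<in> ?T" by simp
  qed
  show "?T \<subseteq> tangent_space ?\<Sigma> ?p"
  proof -
    have "(\<lambda>v. (v, L v)) ` {v. \<forall>\<^sub>F t in at_right 0. x + t *\<^sub>R v \<in> D} \<subseteq> tangent_space ?\<Sigma> ?p"
    proof clarify
      fix v assume v: "\<forall>\<^sub>F t in at_right 0. x + t *\<^sub>R v \<in> D"
      let ?\<gamma> = "\<lambda>t. (x + t *\<^sub>R v, u (x + t *\<^sub>R v))"
      have d: "((\<lambda>t. x + t *\<^sub>R v) has_vector_derivative v) (at_right 0)"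
        by (auto intro!: derivative_eq_intros)
      have "((\<lambda>t. u (x + t *\<^sub>R v)) has_vector_derivative L v) (at_right 0)"
        using vector_derivative_diff_chain_within[OF d has_derivative_at_withinI] L by (simp add: o_def)
      from has_vector_derivative_Pair[OF d this]
      have "(?\<gamma> has_vector_derivative (v, L v)) (at_right 0)" .
      moreover have "\<forall>\<^sub>F t in at_right 0. ?\<gamma> t \<in> ?\<Sigma>"
        using v by eventually_elim auto
      ultimately show "(v, L v) \<in> tangent_space ?\<Sigma> ?p"
        unfolding tangent_space_def by (intro span_base CollectI exI[of _ ?\<gamma>]) auto
    qed
    then have "span ((\<lambda>v. (v, L v)) ` {v. \<forall>\<^sub>F t in at_right 0. x + t *\<^sub>R v \<in> D}) \<subseteq> tangent_space ?\<Sigma> ?p"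
      by (intro span_minimal) (simp_all add: tangent_space_def)
    then show ?thesis unfolding linear_span_image[OF lin] D .
  qed
qed

lemma span_directions_open:
  fixes x :: "real ^ 'n"
  assumes "open B" "x \<in> B" "B \<subseteq> D"
  shows "span {v. \<forall>\<^sub>F t in at_right 0. x + t *\<^sub>R v \<in> D} = UNIV"
proof -
  have "\<forall>\<^sub>F t in at_right 0. x + t *\<^sub>R v \<in> D" for v
  proof -
    have "((\<lambda>t::real. x + t *\<^sub>R v) \<longlongrightarrow> x) (at_right 0)" by (auto intro!: tendsto_eq_intros)
    from topological_tendstoD[OF this assms(1,2)] show ?thesis
      by (rule eventually_mono) (use assms(3) in auto)
  qed
  then have "{v. \<forall>\<^sub>F t in at_right 0. x + t *\<^sub>R v \<in> D} = UNIV" by auto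
  then show ?thesis by simp
qed

text \<open>
  Two derivatives within \<open>\<Sigma>\<close> agree on velocities of curves in \<open>\<Sigma>\<close>, hence on their span. So the
  derivative of the normal within the surface can be computed from any extension to the ambient
  space.
\<close>

lemma frechet_derivative_tangent:
  fixes N :: "'n::finite amb \<Rightarrow> 'n amb"
  assumes p: "p \<in> \<Sigma>" and N: "(N has_derivative N') (at p)" and v: "v \<in> tangent_space \<Sigma> p"
  shows "frechet_derivative N (at p within \<Sigma>) v = N' v"
proof -
  let ?D = "frechet_derivative N (at p within \<Sigma>)"
  have N1: "(N has_derivative N') (at p within \<Sigma>)" using N by (rule has_derivative_at_withinI)
  then have N2: "(N has_derivative ?D) (at p within \<Sigma>)"
    using frechet_derivative_works differentiableI by blast
  have lin: "linear (\<lambda>v. ?D v - N' v)"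
    using has_derivative_linear[OF N1] has_derivative_linear[OF N2] by (intro linear_compose_sub)
  have "tangent_space \<Sigma> p \<subseteq> {v. ?D v - N' v = 0}"
    unfolding tangent_space_def
  proof (rule span_minimal[OF _ linear_subspace_kernel[OF lin]], clarify)
    fix a b and \<gamma> :: "real \<Rightarrow> 'n amb"
    assume \<gamma>: "p = \<gamma> 0" "\<forall>\<^sub>F t in at_right 0. \<gamma> t \<in> \<Sigma>" "(\<gamma> has_vector_derivative (a, b)) (at_right 0)"
    have "?D (a, b) = N' (a, b)"
      using curve_velocity_image[OF p[unfolded \<gamma>(1)] \<gamma>(2,3) N1[unfolded \<gamma>(1)]]
        curve_velocity_image[OF p[unfolded \<gamma>(1)] \<gamma>(2,3) N2[unfolded \<gamma>(1)]] \<gamma>(1)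
      by (intro vector_derivative_unique_within[of 0 "{0<..}"]) (auto simp: trivial_limit_at_right_real)
    then show "frechet_derivative N (at (\<gamma> 0) within \<Sigma>) (a, b) - N' (a, b) = 0" using \<gamma>(1) by simp
  qed
  then show ?thesis using v by auto
qed

section \<open>Null sets\<close>

text \<open>
  A negligible set lies in an open set of small measure, which contains a cover by
  nonoverlapping cubes. In dimension \<open>n\<close>, the \<open>n\<close>-th power of the diameter of a cube is at most \<open>n\<^sup>n\<close>
  times its volume.
\<close>

lemma hausdorff_null_negligible:
  fixes S :: "'a::euclidean_space set"
  assumes "bounded S" "negligible S"
  shows "hausdorff_null DIM('a) S"
  unfolding hausdorff_null_def
proof (intro allI impI)
  fix e :: real assume e: "e > 0"
  let ?n = "DIM('a)"
  define C :: real where "C = real ?n ^ ?n"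
  have C: "C > 0" by (simp add: C_def)
  have "S \<in> sets lebesgue" "measure lebesgue S = 0" "S \<in> lmeasurable"
    using assms(2) by (auto simp: negligible_iff_measure)
  then obtain T where T: "open T" "S \<subseteq> T" "T - S \<in> lmeasurable" "emeasure lebesgue (T - S) < ennreal (e / (2 * C))"
    using sets_lebesgue_outer_open[of S "e / (2 * C)"] e C by auto
  have Tm: "T \<in> lmeasurable"
    using fmeasurable.Un[OF \<open>S \<in> lmeasurable\<close> T(3)] T(2) by (simp add: Un_absorb1)
  have "measure lebesgue (T - S) = measure lebesgue T"
    using assms(2) Tm by (intro measure_Diff_null_set) (auto simp: negligible_iff_null_sets)
  then have mT: "measure lebesgue T < e / (2 * C)"
    using T(3,4) e C by (simp add: emeasure_eq_measure2 ennreal_less_iff)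
  obtain b0 where b0: "S \<subseteq> cbox (- b0) b0"
    using bounded_subset_cbox_symmetric[OF assms(1)] by auto
  \<comment> \<open>The covering lemma bisects a box; starting from a cube, all pieces are cubes.\<close>
  define l :: real where "l = 1 + (\<Sum>i\<in>Basis. \<bar>b0 \<bullet> i\<bar>)"
  define b :: 'a where "b = l *\<^sub>R One"
  have l: "l > 0" "\<bar>b0 \<bullet> i\<bar> \<le> l" if "i \<in> Basis" for i
    unfolding l_def using member_le_sum[OF that, of "\<lambda>i. \<bar>b0 \<bullet> i\<bar>"] by (auto simp: add_pos_nonneg sum_nonneg)
  have bi: "b \<bullet> i = l" if "i \<in> Basis" for i using that by (simp add: b_def)
  have Sb: "S \<subseteq> cbox (- b) b"
  proof
    fix x assume "x \<in> S"
    then have "- (b0 \<bullet> i) \<le> x \<bullet> i \<and> x \<bullet> i \<le> b0 \<bullet> i" if "i \<in> Basis" for i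
      using b0 that by (auto simp: mem_box)
    then show "x \<in> cbox (- b) b" using l(2) bi by (fastforce simp: mem_box inner_minus_left)
  qed
  have box: "box (- b) b \<noteq> {}" using l(1)[OF SOME_Basis] bi by (simp add: box_ne_empty inner_minus_left)
  define g where "g x = (if x \<in> T then T else UNIV)" for x
  have g: "gauge g" using T(1) by (auto simp: gauge_def g_def)
  obtain \<D> where D: "countable \<D>" "\<Union>\<D> \<subseteq> cbox (- b) b"
    "\<And>K. K \<in> \<D> \<Longrightarrow> interior K \<noteq> {} \<and> (\<exists>c d. K = cbox c d)"
    "pairwise (\<lambda>A B. interior A \<inter> interior B = {}) \<D>"
    "\<And>K. K \<in> \<D> \<Longrightarrow> \<exists>x \<in> S \<inter> K. K \<subseteq> g x"
    "\<And>u v. cbox u v \<in> \<D> \<Longrightarrow> \<exists>n. \<forall>i \<in> Basis. v \<bullet> i - u \<bullet> i = (b \<bullet> i - (- b) \<bullet> i) / 2^n"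
    "S \<subseteq> \<Union>\<D>"
    by (rule covering_lemma[OF Sb box g]) (rule that)
  have KT: "K \<subseteq> T" if K: "K \<in> \<D>" for K
  proof -
    obtain x where "x \<in> S" "K \<subseteq> g x" using D(5)[OF K] by blast
    then show ?thesis using T(2) by (auto simp: g_def subset_iff)
  qed
  have diam: "bounded K \<and> diameter K ^ ?n \<le> C * measure lebesgue (interior K)" if K: "K \<in> \<D>" for K
  proof -
    obtain c d where cd: "K = cbox c d" using D(3)[OF K] by blast
    obtain k where k: "d \<bullet> i - c \<bullet> i = 2 * l / 2 ^ k" if "i \<in> Basis" for i
      using D(6)[of c d] K cd bi by (auto simp: inner_minus_left)
    define h where "h = 2 * l / 2 ^ k"
    have h: "h > 0" using l(1)[OF SOME_Basis] by (simp add: h_def)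
    have dc: "d \<bullet> i - c \<bullet> i = h" if "i \<in> Basis" for i using k[OF that] by (simp add: h_def)
    have "diameter K \<le> real ?n * h"
    proof (rule diameter_le)
      show "K \<noteq> {} \<or> 0 \<le> real ?n * h" using h by simp
      fix x y assume xy: "x \<in> K" "y \<in> K"
      have "norm (x - y) \<le> (\<Sum>i\<in>Basis. \<bar>(x - y) \<bullet> i\<bar>)" by (rule norm_le_l1)
      also have "\<dots> \<le> (\<Sum>i\<in>(Basis::'a set). h)"
      proof (rule sum_mono)
        fix i :: 'a assume i: "i \<in> Basis"
        then have "c \<bullet> i \<le> x \<bullet> i \<and> x \<bullet> i \<le> d \<bullet> i" "c \<bullet> i \<le> y \<bullet> i \<and> y \<bullet> i \<le> d \<bullet> i"
          using xy cd by (auto simp: mem_box)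
        then show "\<bar>(x - y) \<bullet> i\<bar> \<le> h" using dc[OF i] unfolding inner_diff_left by linarith
      qed
      finally show "norm (x - y) \<le> real ?n * h" by simp
    qed
    then have "diameter K ^ ?n \<le> (real ?n * h) ^ ?n"
      by (intro power_mono diameter_ge_0) (auto simp: cd)
    also have "\<dots> = C * h ^ ?n" by (simp add: C_def power_mult_distrib)
    also have "h ^ ?n = measure lebesgue (interior K)"
    proof -
      have "c \<bullet> i \<le> d \<bullet> i" if "i \<in> Basis" for i using dc[OF that] h by linarith
      then have "measure lebesgue (box c d) = (\<Prod>i\<in>Basis. (d - c) \<bullet> i)"
        by (subst measure_completion) (auto simp: measure_lborel_box_eq)
      also have "\<dots> = (\<Prod>i\<in>(Basis :: 'a set). h)" using dc by (intro prod.cong) (auto simp: inner_diff_left)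
      finally show ?thesis by (simp add: cd)
    qed
    finally show ?thesis using cd by simp
  qed
  \<comment> \<open>The cover may be finite, so its enumeration is padded with empty sets instead of repetitions.\<close>
  define B where "B i = (if i \<in> to_nat_on \<D> ` \<D> then from_nat_into \<D> i else {})" for i
  have Bin: "B i \<in> \<D>" "to_nat_on \<D> (B i) = i" if "i \<in> to_nat_on \<D> ` \<D>" for i
    using that D(1) by (auto simp: B_def from_nat_into_to_nat_on)
  have Bcov: "S \<subseteq> (\<Union>i. B i)"
  proof
    fix x assume "x \<in> S"
    then obtain K where K: "x \<in> K" "K \<in> \<D>" using D(7) by blast
    then have "B (to_nat_on \<D> K) = K" using D(1) by (simp add: B_def)
    then show "x \<in> (\<Union>i. B i)" using K by blast
  qed
  have nn: "0 \<le> diameter (B i) ^ ?n" and bd: "bounded (B i)" for i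
    using diam[OF Bin(1)[of i]] by (cases "i \<in> to_nat_on \<D> ` \<D>"; simp add: B_def diameter_ge_0)+
  have part: "(\<Sum>i<k. diameter (B i) ^ ?n) \<le> e / 2" for k
  proof -
    define I where "I = {i. i < k \<and> i \<in> to_nat_on \<D> ` \<D>}"
    have fI: "finite I" by (simp add: I_def)
    have "(\<Sum>i<k. diameter (B i) ^ ?n) = (\<Sum>i\<in>I. diameter (B i) ^ ?n)"
      by (rule sum.mono_neutral_right) (auto simp: I_def B_def)
    also have "\<dots> \<le> (\<Sum>i\<in>I. C * measure lebesgue (interior (B i)))"
      using diam Bin(1) by (intro sum_mono) (auto simp: I_def)
    also have "\<dots> = C * (\<Sum>i\<in>I. measure lebesgue (interior (B i)))" by (simp add: sum_distrib_left)
    also have "(\<Sum>i\<in>I. measure lebesgue (interior (B i))) = measure lebesgue (\<Union>i\<in>I. interior (B i))"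
    proof (rule measure_UNION'[symmetric, OF fI])
      fix i assume "i \<in> I"
      then show "interior (B i) \<in> lmeasurable" using Bin(1)[of i] diam[of "B i"] by (auto simp: I_def intro!: lmeasurable_interior)
    next
      show "pairwise (\<lambda>i j. disjnt (interior (B i)) (interior (B j))) I"
      proof (rule pairwiseI)
        fix i j assume ij: "i \<in> I" "j \<in> I" "i \<noteq> j"
        then have "B i \<noteq> B j" using Bin(2)[of i] Bin(2)[of j] by (auto simp: I_def)
        then show "disjnt (interior (B i)) (interior (B j))"
          using D(4) Bin(1)[of i] Bin(1)[of j] ij by (auto simp: pairwise_def disjnt_def I_def)
      qed
    qed
    also have "C * \<dots> \<le> C * (e / (2 * C))"
    proof (rule mult_left_mono)
      have "measure lebesgue (\<Union>i\<in>I. interior (B i)) \<le> measure lebesgue T"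
      proof (rule measure_mono_fmeasurable[OF _ _ Tm])
        show "(\<Union>i\<in>I. interior (B i)) \<subseteq> T" 
          using KT[OF Bin(1)] interior_subset by (intro UN_least) (force simp: I_def)
        show "(\<Union>i\<in>I. interior (B i)) \<in> sets lebesgue" 
          by (intro sets_completionI_sets) auto
      qed
      then show "measure lebesgue (\<Union>i\<in>I. interior (B i)) \<le> e / (2 * C)" using mT by simp
    qed (use C in simp)
    finally show ?thesis using C by simp
  qed
  have sm: "summable (\<lambda>i. diameter (B i) ^ ?n)"
    using nn part by (intro summableI_nonneg_bounded[of _ "e/2"])
  moreover have "(\<Sum>i. diameter (B i) ^ ?n) < e"
    using suminf_le_const[OF sm part] e by simp
  ultimately show "\<exists>B :: nat \<Rightarrow> 'a set. S \<subseteq> (\<Union>i. B i) \<and> (\<forall>i. bounded (B i)) \<and>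
      summable (\<lambda>i. diameter (B i) ^ ?n) \<and> (\<Sum>i. diameter (B i) ^ ?n) < e"
    using Bcov bd by (intro exI[of _ B]) simp
qed

lemma hausdorff_null_empty: "hausdorff_null n {}" if "n > 0"
  unfolding hausdorff_null_def
  using that by (intro allI impI exI[of _ "\<lambda>_. {}"]) (auto simp: diameter_def power_0_left)

lemma hausdorff_null_isometric_image:
  fixes f :: "'a::metric_space \<Rightarrow> 'b::metric_space"
  assumes S: "hausdorff_null n S" and f: "\<And>x y. dist (f x) (f y) = dist x y"
  shows "hausdorff_null n (f ` S)"
  unfolding hausdorff_null_def
proof (intro allI impI)
  fix e :: real assume "e > 0"
  then obtain B where B: "S \<subseteq> (\<Union>i. B i)" "\<And>i. bounded (B i)"
    "summable (\<lambda>i. diameter (B i) ^ n)" "(\<Sum>i. diameter (B i) ^ n) < e"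
    using S unfolding hausdorff_null_def by meson
  have d: "diameter (f ` A) = diameter A" for A
    by (simp add: diameter_def image_image f case_prod_unfold flip: image_paired_Times)
  have "bounded (f ` A)" if "bounded A" for A
    using that unfolding bounded_def by (metis (no_types, lifting) f image_iff)
  with B d show "\<exists>B. f ` S \<subseteq> (\<Union>i. B i) \<and> (\<forall>i. bounded (B i)) \<and>
      summable (\<lambda>i. diameter (B i) ^ n) \<and> (\<Sum>i. diameter (B i) ^ n) < e"
    by (intro exI[of _ "\<lambda>i. f ` B i"]) (simp add: image_mono flip: image_UN)
qed

section \<open>Radial functions and fields\<close>

lemma has_derivative_radial:
  fixes x :: "'a::real_inner"
  assumes "x \<noteq> 0" and f: "(f has_real_derivative f') (at (norm x))"
  shows "((\<lambda>y. f (norm y)) has_derivative (\<lambda>v. (f' / norm x) * (x \<bullet> v))) (at x)"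
proof -
  have "((\<lambda>y. f (norm y)) has_derivative (\<lambda>v. f' * (v \<bullet> sgn x))) (at x)"
    using has_derivative_compose[OF has_derivative_norm[OF \<open>x \<noteq> 0\<close>] f[unfolded has_field_derivative_def]]
    by simp
  then show ?thesis
    by (rule has_derivative_eq_rhs) (auto simp: fun_eq_iff sgn_div_norm inner_commute field_simps)
qed

lemma has_derivative_radial_field:
  fixes x :: "'a::real_inner"
  assumes "x \<noteq> 0" and f: "(f has_real_derivative f') (at (norm x))"
  shows "((\<lambda>y. f (norm y) *\<^sub>R y) has_derivative
    (\<lambda>v. f (norm x) *\<^sub>R v + ((f' / norm x) * (x \<bullet> v)) *\<^sub>R x)) (at x)"
  by (rule has_derivative_scaleR[OF has_derivative_radial[OF assms] has_derivative_ident])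

lemma filterlim_norm_at_right_0:
  "filterlim norm (at_right 0) (at (0::'a::real_normed_vector))"
  unfolding filterlim_at by (auto intro!: tendsto_eq_intros simp: eventually_at_filter)

lemma has_derivative_radial_at_0:
  fixes f :: "real \<Rightarrow> real"
  assumes "((\<lambda>r. (f r - f 0) / r) \<longlongrightarrow> 0) (at_right 0)"
  shows "((\<lambda>y :: 'a::real_normed_vector. f (norm y)) has_derivative (\<lambda>v. 0)) (at 0)"
proof -
  have "((\<lambda>y :: 'a. (f (norm y) - f 0) / norm y) \<longlongrightarrow> 0) (at 0)"
    by (rule filterlim_compose[OF assms filterlim_norm_at_right_0])
  then have "((\<lambda>y :: 'a. norm (f (norm y) - f 0) / norm y) \<longlongrightarrow> 0) (at 0)"
    using tendsto_rabs_zero by (fastforce simp: abs_divide)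
  then show ?thesis unfolding has_derivative_at by simp
qed

lemma has_derivative_radial_field_at_0:
  fixes f :: "real \<Rightarrow> real"
  assumes "(f \<longlongrightarrow> L) (at_right 0)"
  shows "((\<lambda>y :: 'a::real_normed_vector. f (norm y) *\<^sub>R y) has_derivative (\<lambda>v. L *\<^sub>R v)) (at 0)"
proof -
  have "((\<lambda>y :: 'a. f (norm y)) \<longlongrightarrow> L) (at 0)"
    by (rule filterlim_compose[OF assms filterlim_norm_at_right_0])
  then have l: "((\<lambda>y :: 'a. \<bar>f (norm y) - L\<bar>) \<longlongrightarrow> 0) (at 0)"
    using tendsto_rabs_zero LIM_zero by blast
  have "((\<lambda>y :: 'a. norm (f (norm y) *\<^sub>R y - L *\<^sub>R y) / norm y) \<longlongrightarrow> 0) (at 0)"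
  proof (rule Lim_transform_eventually[OF l])
    show "\<forall>\<^sub>F y :: 'a in at 0. \<bar>f (norm y) - L\<bar> = norm (f (norm y) *\<^sub>R y - L *\<^sub>R y) / norm y"
      by (auto simp: eventually_at_filter simp flip: scaleR_left_diff_distrib)
  qed
  then show ?thesis unfolding has_derivative_at by (simp add: bounded_linear_scaleR_right)
qed

text \<open>
  The condition at the origin is what a \<open>C\<^sup>1\<close> field requires: the derivative is
  \<open>f v + (f' / norm x) (x \<bullet> v) x\<close>, whose second term is bounded by \<open>norm x * f' * norm v\<close>. Applied to
  the gradient of the height, this decides whether a rotational graph is \<open>C\<^sup>2\<close>.
\<close>

lemma C1_on_radial_field:
  fixes f f' :: "real \<Rightarrow> real" and S :: "'a::euclidean_space set"
  assumes f: "\<And>r. 0 < r \<Longrightarrow> r \<in> norm ` S \<Longrightarrow> (f has_real_derivative f' r) (at r) \<and> isCont f' r"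
    and zero: "0 \<in> S \<Longrightarrow> (f \<longlongrightarrow> L) (at_right 0) \<and> ((\<lambda>r. r * f' r) \<longlongrightarrow> 0) (at_right 0)"
  shows "C1_on S (\<lambda>y. f (norm y) *\<^sub>R y)"
proof -
  define D where "D x v = (if x = 0 then L *\<^sub>R v else f (norm x) *\<^sub>R v + ((f' (norm x) / norm x) * (x \<bullet> v)) *\<^sub>R x)"
    for x v :: 'a
  have D: "((\<lambda>y. f (norm y) *\<^sub>R y) has_derivative D x) (at x)" if "x \<in> S" for x
  proof (cases "x = 0")
    case True
    then show ?thesis
      using has_derivative_radial_field_at_0[of f L] zero that by (simp add: D_def[abs_def])
  next
    case False
    then show ?thesis
      using has_derivative_radial_field[OF False, of f "f' (norm x)"] f[of "norm x"] that
      by (simp add: D_def[abs_def])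
  qed
  have c: "isCont (\<lambda>x. D x v) x" if x: "x \<in> S" for x v
  proof (cases "x = 0")
    case False
    have "isCont f (norm x)" "isCont f' (norm x)"
      using f[of "norm x"] False x DERIV_isCont by auto
    then have "isCont (\<lambda>x. f (norm x)) x" "isCont (\<lambda>x. f' (norm x)) x"
      by (auto intro: isCont_o2[OF isCont_norm[OF continuous_ident]])
    then have "isCont (\<lambda>x. f (norm x) *\<^sub>R v + ((f' (norm x) / norm x) * (x \<bullet> v)) *\<^sub>R x) x"
      using False by (intro continuous_intros) auto
    moreover have "\<forall>\<^sub>F y in nhds x. D y v = f (norm y) *\<^sub>R v + ((f' (norm y) / norm y) * (y \<bullet> v)) *\<^sub>R y"
      using t1_space_nhds[OF False] by (rule eventually_mono) (simp add: D_def)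
    ultimately show ?thesis by (subst isCont_cong)
  next
    case True
    have l: "((\<lambda>y :: 'a. f (norm y)) \<longlongrightarrow> L) (at 0)"
      "((\<lambda>y :: 'a. norm y * f' (norm y)) \<longlongrightarrow> 0) (at 0)"
      using zero x True filterlim_compose[OF _ filterlim_norm_at_right_0] by blast+
    have "((\<lambda>y :: 'a. ((f' (norm y) / norm y) * (y \<bullet> v)) *\<^sub>R y) \<longlongrightarrow> 0) (at 0)"
    proof (rule Lim_null_comparison)
      show "((\<lambda>y :: 'a. \<bar>norm y * f' (norm y)\<bar> * norm v) \<longlongrightarrow> 0) (at 0)"
        using tendsto_mult[OF tendsto_rabs_zero[OF l(2)] tendsto_const[of "norm v"]] by simp
      show "\<forall>\<^sub>F y :: 'a in at 0. norm (((f' (norm y) / norm y) * (y \<bullet> v)) *\<^sub>R y) \<le> \<bar>norm y * f' (norm y)\<bar> * norm v"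
      proof (rule always_eventually, rule allI)
        fix y :: 'a
        have "\<bar>f' (norm y)\<bar> * \<bar>y \<bullet> v\<bar> \<le> \<bar>f' (norm y)\<bar> * (norm y * norm v)"
          by (intro mult_left_mono Cauchy_Schwarz_ineq2) auto
        then show "norm (((f' (norm y) / norm y) * (y \<bullet> v)) *\<^sub>R y) \<le> \<bar>norm y * f' (norm y)\<bar> * norm v"
          by (simp add: abs_mult mult_ac)
      qed
    qed
    from tendsto_add[OF tendsto_scaleR[OF l(1) tendsto_const[of v]] this]
    have "((\<lambda>y. D y v) \<longlongrightarrow> L *\<^sub>R v + 0) (at 0)"
      by (rule Lim_transform_eventually) (auto simp: eventually_at_filter D_def)
    then show ?thesis using True by (simp add: isCont_def D_def)
  qed
  show ?thesis
    by (rule C1_onI[OF D]) (use c in \<open>auto intro: continuous_at_imp_continuous_on\<close>)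
qed

lemma C2_on_gradient:
  fixes u :: "'a::euclidean_space \<Rightarrow> real"
  assumes u: "\<And>x. x \<in> S \<Longrightarrow> (u has_derivative (\<lambda>v. W x \<bullet> v)) (at x)" and W: "C1_on S W"
  shows "C2_on S u"
  unfolding C2_on_def
proof (intro exI conjI ballI)
  show "(u has_derivative blinfun_apply (blinfun_inner_right (W x))) (at x)" if "x \<in> S" for x
    using u[OF that] by simp
  obtain W' where W': "\<And>x. x \<in> S \<Longrightarrow> (W has_derivative blinfun_apply (W' x)) (at x)" "continuous_on S W'"
    using W unfolding C1_on_def by blast
  show "C1_on S (\<lambda>x. blinfun_inner_right (W x))"
  proof (rule C1_onI)
    show "((\<lambda>x. blinfun_inner_right (W x)) has_derivative (\<lambda>v. blinfun_inner_right (W' x v))) (at x)" if "x \<in> S" for x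
      by (rule bounded_linear.has_derivative[OF bounded_linear_blinfun_inner_right W'(1)[OF that]])
    show "continuous_on S (\<lambda>x. blinfun_inner_right (W' x v))" for v
      by (intro bounded_linear.continuous_on[OF bounded_linear_blinfun_inner_right] continuous_intros W'(2))
  qed
qed

lemma C1_onI_gradient:
  fixes u :: "'a::euclidean_space \<Rightarrow> real"
  assumes u: "\<And>x. x \<in> S \<Longrightarrow> (u has_derivative (\<lambda>v. W x \<bullet> v)) (at x)" and W: "continuous_on S W"
  shows "C1_on S u"
  by (rule C1_onI[OF u]) (auto intro!: continuous_intros W)

lemma exists_norm_eq:
  assumes "0 \<le> r" shows "\<exists>x :: real ^ 'n. norm x = r"
  using vector_choose_size[OF assms] by blast

lemma orthonormal_frame_radial:
  fixes x :: "real ^ 'n"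
  assumes "x \<noteq> 0"
  obtains w :: "'n \<Rightarrow> real ^ 'n" and i0 where "w i0 = x /\<^sub>R norm x"
    "\<And>i j. w i \<bullet> w j = (if i = j then 1 else 0)" "span (range w) = UNIV"
proof -
  fix i0 :: 'n
  have n: "norm (axis i0 (1::real)) = 1" "norm (x /\<^sub>R norm x) = 1" using assms by auto
  obtain f :: "real ^ 'n \<Rightarrow> real ^ 'n" where f: "orthogonal_transformation f" "f (axis i0 1) = x /\<^sub>R norm x"
    using orthogonal_transformation_exists_1[OF n] by metis
  show thesis
  proof (rule that[of "\<lambda>i. f (axis i 1)"])
    show "f (axis i0 1) = x /\<^sub>R norm x" by (rule f)
    show "f (axis i 1) \<bullet> f (axis j 1) = (if i = j then 1 else 0)" for i j
      using f(1) by (simp add: orthogonal_transformation_def inner_axis_axis)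
    have "range (\<lambda>i. f (axis i 1)) = f ` (Basis :: (real ^ 'n) set)"
      by (auto simp: Basis_vec_def)
    then show "span (range (\<lambda>i. f (axis i 1))) = UNIV"
      using linear_span_image[OF orthogonal_transformation_linear[OF f(1)], of Basis]
        orthogonal_transformation_surj[OF f(1)] by simp
  qed
qed

section \<open>The profile at the axis\<close>

lemma antiderivative_power_asymptotics:
  fixes F f :: "real \<Rightarrow> real"
  assumes F: "\<forall>\<^sub>F x in at_right 0. (F has_real_derivative f x) (at x)" and F0: "(F \<longlongrightarrow> 0) (at_right 0)"
    and f: "((\<lambda>x. f x / x ^ m) \<longlongrightarrow> 1) (at_right 0)"
  shows "((\<lambda>x. F x / x ^ Suc m) \<longlongrightarrow> 1 / real (Suc m)) (at_right 0)"
proof (rule lhopital_right_0[OF F0 _ _ _ F])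
  show "((\<lambda>x::real. x ^ Suc m) \<longlongrightarrow> 0) (at_right 0)" by (auto intro!: tendsto_eq_intros)
  show "\<forall>\<^sub>F x::real in at_right 0. x ^ Suc m \<noteq> 0" "\<forall>\<^sub>F x in at_right 0. real (Suc m) * x ^ m \<noteq> 0"
    by (rule eventually_mono[OF eventually_at_right_less[of 0]]; simp)+
  show "\<forall>\<^sub>F x in at_right 0. ((\<lambda>x. x ^ Suc m) has_real_derivative real (Suc m) * x ^ m) (at x)"
    using DERIV_pow[of "Suc m"] by (intro always_eventually allI) simp
  show "filterlim (\<lambda>x. f x / (real (Suc m) * x ^ m)) (nhds (1 / real (Suc m))) (at_right 0)"
    using tendsto_divide[OF f tendsto_const[of "real (Suc m)"]] by (simp add: field_simps)
qed

text \<open>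
  Both sides of \<open>F (a r) = G r\<close> are asymptotic to \<open>(m + 1)\<close>-st powers with the same constant
  \<open>1 / (m + 1)\<close>; taking roots compares \<open>a r\<close> with \<open>r\<close>.
\<close>

lemma (in translator_profile) angle_asymptotics:
  assumes z: "r0 = 0" "a0 = 0"
  shows "((\<lambda>r. a r / r) \<longlongrightarrow> 1) (at_right 0)"
proof -
  have r1: "0 < r1" using r01 z by simp
  obtain F :: "real \<Rightarrow> real" where F: "F 0 = 0" "\<And>x. (F has_real_derivative sin x ^ m) (at x)"
    "strict_mono_on {0..pi/2} F" "continuous_on UNIV F"
    by (rule sin_power_antiderivative[of m]) blast
  have cF: "isCont F 0" using F(2) DERIV_isCont by blast
  have a_0: "a 0 = 0" using a_le[of 0] z by simp
  have a_lim: "(a \<longlongrightarrow> 0) (at_right 0)"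
    using cont_a[OF r1] a_0 by (simp add: isCont_def filterlim_at_split)
  have pos: "\<forall>\<^sub>F r in at_right 0. 0 < r \<and> 0 < a r \<and> a r < pi / 2 \<and> r < r1"
    unfolding eventually_at_right_field using a_bounds z r1 by (intro exI[of _ r1]) auto
  have "filterlim a (at_right 0) (at_right 0)"
    unfolding filterlim_at using a_lim pos by (auto elim!: eventually_mono)
  moreover have "((\<lambda>x. F x / x ^ Suc m) \<longlongrightarrow> 1 / real (Suc m)) (at_right 0)"
  proof (rule antiderivative_power_asymptotics)
    show "(F \<longlongrightarrow> 0) (at_right 0)" using cF F(1) by (simp add: isCont_def filterlim_at_split)
    have "((\<lambda>x::real. sin x / x) \<longlongrightarrow> 1) (at 0)"
      using DERIV_sin[of 0] unfolding has_field_derivative_iff by simp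
    then have "((\<lambda>x::real. sin x / x) \<longlongrightarrow> 1) (at_right 0)"
      by (rule tendsto_within_subset) simp
    from tendsto_power[OF this, of m]
    show "((\<lambda>x::real. sin x ^ m / x ^ m) \<longlongrightarrow> 1) (at_right 0)" by (simp add: power_divide)
  qed (use F(2) in simp)
  ultimately have l1: "((\<lambda>r. F (a r) / a r ^ Suc m) \<longlongrightarrow> 1 / real (Suc m)) (at_right 0)"
    by (rule filterlim_compose[rotated])
  have l2: "((\<lambda>r. F (a r) / r ^ Suc m) \<longlongrightarrow> 1 / real (Suc m)) (at_right 0)"
  proof (rule antiderivative_power_asymptotics)
    show "((\<lambda>r. F (a r)) \<longlongrightarrow> 0) (at_right 0)"
      using isCont_tendsto_compose[OF cF a_lim] F(1) by simp
    show "\<forall>\<^sub>F r in at_right 0. ((\<lambda>r. F (a r)) has_real_derivative tan_curv \<epsilon> r ^ m * radial_conf \<epsilon> r) (at r)"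
      using pos
    proof eventually_elim
      case (elim r)
      have "sin (a r) > 0" using elim by (intro sin_gt_zero) auto
      then show ?case using DERIV_chain2[OF F(2) deriv_a[of r]] elim z by simp
    qed
    have "((\<lambda>r. (1 / (1 - \<epsilon> * r\<^sup>2 / 4)) ^ m * radial_conf \<epsilon> r) \<longlongrightarrow> 1) (at_right 0)"
      unfolding radial_conf_def by (auto intro!: tendsto_eq_intros)
    then show "((\<lambda>r. tan_curv \<epsilon> r ^ m * radial_conf \<epsilon> r / r ^ m) \<longlongrightarrow> 1) (at_right 0)"
      by (rule Lim_transform_eventually)
        (auto simp: eventually_at_filter tan_curv_def power_divide)
  qed
  have l3: "((\<lambda>r. (a r / r) ^ Suc m) \<longlongrightarrow> 1) (at_right 0)"
  proof (rule Lim_transform_eventually)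
    show "((\<lambda>r. (F (a r) / r ^ Suc m) / (F (a r) / a r ^ Suc m)) \<longlongrightarrow> 1) (at_right 0)"
      using tendsto_divide[OF l2 l1] by simp
    show "\<forall>\<^sub>F r in at_right 0. (F (a r) / r ^ Suc m) / (F (a r) / a r ^ Suc m) = (a r / r) ^ Suc m"
      using pos
    proof eventually_elim
      case (elim r)
      then have "F 0 < F (a r)" by (intro strict_mono_onD[OF F(3)]) auto
      then show ?case using elim F(1) by (simp add: power_divide field_simps)
    qed
  qed
  have "((\<lambda>r. root (Suc m) ((a r / r) ^ Suc m)) \<longlongrightarrow> 1) (at_right 0)"
    using tendsto_real_root[OF l3, of "Suc m"] by simp
  then show ?thesis
    by (rule Lim_transform_eventually)
      (use pos in \<open>auto elim!: eventually_mono simp del: power_Suc simp: real_root_power_cancel\<close>)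
qed

section \<open>Curvature of a rotational graph\<close>

context translator_profile begin

text \<open>
  The gradient of the height at \<open>x\<close> is \<open>slope (norm x) *\<^sub>R x\<close>, and the horizontal part of the
  upward unit normal is \<open>- flux (norm x) *\<^sub>R x\<close>.
\<close>

definition slope :: "real \<Rightarrow> real" where
  "slope r = radial_conf \<epsilon> r * tan (a r) / r"

definition flux :: "real \<Rightarrow> real" where
  "flux r = sin (a r) / (radial_conf \<epsilon> r * r)"

definition surface :: "(real ^ 'n) set \<Rightarrow> 'n::finite amb set" where
  "surface D = (\<lambda>y. (y, U (norm y))) ` D"

text \<open>
  The values depend on the base point alone, so the field is defined near the surface and can be
  differentiated in the ambient space. Over the origin \<open>flux\<close> divides by zero, but it multiplies
  the zero vector: the value there is \<open>(0, cos (a 0))\<close>.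
\<close>

definition normal :: "'n::finite amb \<Rightarrow> 'n amb" where
  "normal q = (- (flux (norm (fst q)) *\<^sub>R fst q), cos (a (norm (fst q))))"

definition annulus :: "(real ^ 'n::finite) set" where
  "annulus = {y. r0 < norm y \<and> norm y < r1}"

lemma r1_pos: "0 < r1" using r0 r01 by simp

lemma chart_domain_le: "\<bar>r\<bar> \<le> r1 \<Longrightarrow> 0 < 1 + \<epsilon> * r\<^sup>2 / 4"
  using dom by (rule chart_domain_mono) auto

lemma a_range: "r < r1 \<Longrightarrow> 0 \<le> a r" "r < r1 \<Longrightarrow> a r < pi / 2"
  using a_le[of r] a_bounds[of r] a0 by (cases "r \<le> r0"; simp)+

lemma cos_a_pos: "r < r1 \<Longrightarrow> 0 < cos (a r)"
  using a_range[of r] by (intro cos_gt_zero_pi) auto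

lemma sin_a_pos: "r0 < r \<Longrightarrow> r < r1 \<Longrightarrow> 0 < sin (a r)"
  using a_bounds[of r] a0 by (intro sin_gt_zero) auto

lemma radial_conf_pos: "\<bar>r\<bar> \<le> r1 \<Longrightarrow> 0 < radial_conf \<epsilon> r"
  using radial_conf_ge_1[OF chart_domain_le] by fastforce

lemma isCont_slope: "r \<noteq> 0 \<Longrightarrow> \<bar>r\<bar> < r1 \<Longrightarrow> isCont slope r"
  unfolding slope_def using isCont_radial_conf[OF chart_domain_le[of r]] cont_a[of r] cos_a_pos[of r]
  by (intro continuous_intros) (auto simp: abs_less_iff)

lemma isCont_flux: "r \<noteq> 0 \<Longrightarrow> \<bar>r\<bar> < r1 \<Longrightarrow> isCont flux r"
  unfolding flux_def using isCont_radial_conf[OF chart_domain_le[of r]] cont_a[of r] radial_conf_pos[of r]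
  by (intro continuous_intros) (auto simp: abs_less_iff abs_le_iff)

definition angle_deriv :: "real \<Rightarrow> real" where
  "angle_deriv r = tan_curv \<epsilon> r ^ m * radial_conf \<epsilon> r / sin (a r) ^ m"

lemma angle_deriv: "r0 < r \<Longrightarrow> r < r1 \<Longrightarrow> (a has_real_derivative angle_deriv r) (at r)"
  unfolding angle_deriv_def by (rule deriv_a)

lemma angle_deriv_pos: "r0 < r \<Longrightarrow> r < r1 \<Longrightarrow> 0 < angle_deriv r"
  unfolding angle_deriv_def using sin_a_pos[of r] tan_curv_pos[of r] radial_conf_pos[of r] r0 by simp

lemma isCont_angle_deriv: "r0 < r \<Longrightarrow> r < r1 \<Longrightarrow> isCont angle_deriv r"
  unfolding angle_deriv_def
  using isCont_radial_conf[OF chart_domain_le[of r]] cont_a[of r] sin_a_pos[of r] isCont_tan_curv[of r] r0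
  by (intro continuous_intros) auto

definition slope_deriv :: "real \<Rightarrow> real" where
  "slope_deriv r = (- (\<epsilon> * r / 2) * (radial_conf \<epsilon> r)\<^sup>2 * tan (a r)
     + radial_conf \<epsilon> r * (1 + (tan (a r))\<^sup>2) * angle_deriv r - radial_conf \<epsilon> r * (tan (a r) / r)) / r"

lemma radial_conf_has_derivative:
  "\<bar>r\<bar> \<le> r1 \<Longrightarrow> (radial_conf \<epsilon> has_real_derivative - (\<epsilon> * r / 2) * (radial_conf \<epsilon> r)\<^sup>2) (at r)"
  unfolding radial_conf_def using chart_domain_le[of r]
  by (auto intro!: derivative_eq_intros simp: power2_eq_square power_divide)

lemma slope_has_derivative:
  assumes r: "r0 < r" "r < r1"
  shows "(slope has_real_derivative slope_deriv r) (at r)"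
proof -
  have c: "cos (a r) \<noteq> 0" using cos_a_pos[OF r(2)] by simp
  have r': "r \<noteq> 0" "\<bar>r\<bar> \<le> r1" using r r0 by auto
  have t: "((\<lambda>r. tan (a r)) has_real_derivative (1 + (tan (a r))\<^sup>2) * angle_deriv r) (at r)"
  proof -
    have "inverse ((cos (a r))\<^sup>2) = 1 + (tan (a r))\<^sup>2"
      using c by (rule tan_sec[symmetric, unfolded power_inverse])
    then show ?thesis using DERIV_chain2[OF DERIV_tan[OF c] angle_deriv[OF r]] by simp
  qed
  show ?thesis unfolding slope_def slope_deriv_def
    by (rule DERIV_cong[OF DERIV_divide[OF DERIV_mult[OF radial_conf_has_derivative[OF r'(2)] t] DERIV_ident r'(1)]])
      (use r'(1) in \<open>simp add: field_simps\<close>)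
qed

lemma isCont_slope_deriv: "r0 < r \<Longrightarrow> r < r1 \<Longrightarrow> isCont slope_deriv r"
  unfolding slope_deriv_def
  using isCont_radial_conf[OF chart_domain_le[of r]] cont_a[of r] cos_a_pos[of r] isCont_angle_deriv[of r] r0
  by (intro continuous_intros) auto

lemma flux_has_derivative:
  assumes r: "r0 < r" "r < r1"
  shows "(flux has_real_derivative cos (a r) * angle_deriv r / (radial_conf \<epsilon> r * r)
    - sin (a r) * (1 / r\<^sup>2 - \<epsilon> / 4)) (at r)"
proof -
  have r': "r \<noteq> 0" "\<bar>r\<bar> \<le> r1" "r > 0" using r r0 by auto
  have eq: "flux = (\<lambda>r. sin (a r) * ((1 + \<epsilon> * r\<^sup>2 / 4) / r))"
    by (simp add: flux_def radial_conf_def fun_eq_iff)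
  have "((\<lambda>r. (1 + \<epsilon> * r\<^sup>2 / 4) / r) has_real_derivative - (1 / r\<^sup>2 - \<epsilon> / 4)) (at r)"
    using r' by (auto intro!: derivative_eq_intros simp: field_simps power2_eq_square)
  from DERIV_mult[OF DERIV_chain2[OF DERIV_sin angle_deriv[OF r]] this]
  show ?thesis unfolding eq
    by (rule DERIV_cong) (simp add: radial_conf_def algebra_simps)
qed

lemma height_has_derivative:
  fixes x :: "real ^ 'n"
  assumes "x \<noteq> 0" "norm x < r1"
  shows "((\<lambda>y. U (norm y)) has_derivative (\<lambda>v. slope (norm x) * (x \<bullet> v))) (at x)"
proof -
  have "(U has_real_derivative radial_conf \<epsilon> (norm x) * tan (a (norm x))) (at (norm x))"
    using assms(2) r1_pos norm_ge_zero[of x] by (intro deriv_U) linarith+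
  from has_derivative_radial[OF assms(1) this] show ?thesis by (simp add: slope_def)
qed

lemma C1_on_height: "C1_on {x :: real ^ 'n. x \<noteq> 0 \<and> norm x < r1} (\<lambda>y. U (norm y))"
proof (rule C1_onI_gradient)
  show "((\<lambda>y. U (norm y)) has_derivative (\<lambda>v. (slope (norm x) *\<^sub>R x) \<bullet> v)) (at x)"
    if "x \<in> {x. x \<noteq> 0 \<and> norm x < r1}" for x :: "real ^ 'n"
    using height_has_derivative[of x] that by simp
  show "continuous_on {x :: real ^ 'n. x \<noteq> 0 \<and> norm x < r1} (\<lambda>x. slope (norm x) *\<^sub>R x)"
    by (intro continuous_at_imp_continuous_on ballI continuous_intros isCont_o2[OF isCont_norm[OF continuous_ident] isCont_slope]) auto
qed

lemma open_annulus: "open (annulus :: (real ^ 'n) set)"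
  unfolding annulus_def by (intro open_Collect_conj open_Collect_less continuous_intros)

lemma C2_on_height_annulus: "C2_on (annulus :: (real ^ 'n) set) (\<lambda>y. U (norm y))"
proof (rule C2_on_gradient)
  show "((\<lambda>y. U (norm y)) has_derivative (\<lambda>v. (slope (norm x) *\<^sub>R x) \<bullet> v)) (at x)"
    if "x \<in> annulus" for x :: "real ^ 'n"
  proof -
    have "x \<noteq> 0" "norm x < r1" using that r0 by (auto simp: annulus_def)
    then show ?thesis using height_has_derivative by simp
  qed
  show "C1_on (annulus :: (real ^ 'n) set) (\<lambda>x. slope (norm x) *\<^sub>R x)"
    by (rule C1_on_radial_field[where f' = slope_deriv and L = 0])
      (use r0 slope_has_derivative isCont_slope_deriv in \<open>auto simp: annulus_def\<close>)
qed

lemma normal_has_derivative: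
  fixes x :: "real ^ 'n"
  assumes x: "x \<in> annulus"
  defines "r \<equiv> norm x"
  shows "(normal has_derivative (\<lambda>v. (- (flux r *\<^sub>R fst v +
      (((cos (a r) * angle_deriv r / (radial_conf \<epsilon> r * r) - sin (a r) * (1 / r\<^sup>2 - \<epsilon> / 4)) / r) * (x \<bullet> fst v)) *\<^sub>R x),
      (- sin (a r) * angle_deriv r / r) * (x \<bullet> fst v)))) (at (x, t))"
proof -
  have r: "r0 < r" "r < r1" "x \<noteq> 0" using x r0 by (auto simp: annulus_def r_def)
  have "((\<lambda>r. cos (a r)) has_real_derivative - sin (a r) * angle_deriv r) (at r)"
    by (rule DERIV_chain2[OF DERIV_cos angle_deriv[OF r(1,2)]])
  from has_derivative_radial[OF r(3) this[unfolded r_def]]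
  have c: "((\<lambda>y. cos (a (norm y))) has_derivative (\<lambda>v. (- sin (a r) * angle_deriv r / r) * (x \<bullet> v))) (at x)"
    by (simp add: r_def)
  note f = has_derivative_radial_field[OF r(3) flux_has_derivative[OF r(1,2), unfolded r_def], folded r_def]
  have p: "((\<lambda>y. (- (flux (norm y) *\<^sub>R y), cos (a (norm y)))) has_derivative (\<lambda>v. (- (flux r *\<^sub>R v +
      (((cos (a r) * angle_deriv r / (radial_conf \<epsilon> r * r) - sin (a r) * (1 / r\<^sup>2 - \<epsilon> / 4)) / r) * (x \<bullet> v)) *\<^sub>R x),
      (- sin (a r) * angle_deriv r / r) * (x \<bullet> v)))) (at (fst (x, t)))"
    using has_derivative_Pair[OF has_derivative_minus[OF f] c] by simp
  from has_derivative_compose[OF has_derivative_fst[OF has_derivative_ident] p]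
  show ?thesis by (simp add: normal_def[abs_def])
qed

lemma tangent_space_surface:
  fixes x :: "real ^ 'n"
  assumes "x \<in> D" "x \<noteq> 0" "norm x < r1"
    and "span {v. \<forall>\<^sub>F t in at_right 0. x + t *\<^sub>R v \<in> D} = UNIV"
  shows "tangent_space (surface D) (x, U (norm x)) = range (\<lambda>v. (v, slope (norm x) * (x \<bullet> v)))"
  unfolding surface_def
  using tangent_space_graph[OF assms(1) height_has_derivative[OF assms(2,3)] assms(4)] .

text \<open>
  The radial direction of a frame adapted to \<open>x\<close> lifts to the meridian and the other directions are
  tangent to the parallels. On the latter the Christoffel term is a multiple of the vector and turns
  the Euclidean curvature into that of the space form. On the meridian it cancels the contribution
  of the conformal factor to the derivative of \<open>flux\<close>.
\<close>

lemma principal_curvatures_annulus: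
  fixes x :: "real ^ 'n"
  assumes x: "x \<in> annulus" and D: "annulus \<subseteq> D"
  defines "r \<equiv> norm x"
  obtains i0 where "principal_curvatures \<epsilon> (surface D) normal (x, U (norm x))
    (\<lambda>i. if i = i0 then angle_deriv r * cos (a r) / radial_conf \<epsilon> r else sin (a r) / tan_curv \<epsilon> r)"
proof -
  have r: "r0 < r" "r < r1" "0 < r" "x \<noteq> 0" using x r0 by (auto simp: annulus_def r_def)
  define \<delta> where "\<delta> = 1 + \<epsilon> * r\<^sup>2 / 4"
  have \<delta>: "\<delta> > 0" "radial_conf \<epsilon> r = 1 / \<delta>" "conf \<epsilon> x = 1 / \<delta>"
    using chart_domain_le[of r] r by (auto simp: \<delta>_def radial_conf_def conf_eq r_def)
  have flux: "flux r = sin (a r) * \<delta> / r" using \<delta> by (simp add: flux_def)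
  have cpos: "cos (a r) > 0" by (rule cos_a_pos[OF r(2)])
  have slope: "slope r = sin (a r) / (\<delta> * cos (a r) * r)"
    using \<delta> by (simp add: slope_def tan_def)
  have xx: "x \<bullet> x = r * r" by (simp add: r_def dot_square_norm power2_eq_square)
  let ?p = "(x, U (norm x))"
  let ?\<Sigma> = "surface D"
  have xD: "x \<in> D" using x D by auto
  have p: "?p \<in> ?\<Sigma>" using xD by (auto simp: surface_def)
  have T: "tangent_space ?\<Sigma> ?p = range (\<lambda>v. (v, slope r * (x \<bullet> v)))"
    unfolding r_def using xD r by (intro tangent_space_surface span_directions_open[OF open_annulus x D]) (auto simp: r_def)
  obtain w :: "'n \<Rightarrow> real ^ 'n" and i0 where w: "w i0 = x /\<^sub>R norm x"
    "\<And>i j. w i \<bullet> w j = (if i = j then 1 else 0)" "span (range w) = UNIV"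
    using orthonormal_frame_radial[OF r(4)] by blast
  have xw: "x \<bullet> w i = (if i = i0 then r else 0)" for i
  proof -
    have "x = r *\<^sub>R w i0" using r by (simp add: w(1) r_def)
    then have "x \<bullet> w i = r * (w i0 \<bullet> w i)" by (metis inner_scaleR_left)
    then show ?thesis by (simp add: w(2))
  qed
  \<comment> \<open>The lift of the radial unit vector has length \<open>1 / (\<delta> cos a)\<close> and the other lifts have length \<open>1 / \<delta>\<close>.\<close>
  define e :: "'n \<Rightarrow> 'n amb" where
    "e i = (if i = i0 then ((cos (a r) * \<delta>) *\<^sub>R w i, sin (a r)) else (\<delta> *\<^sub>R w i, 0))" for i
  have e: "e i = (if i = i0 then cos (a r) * \<delta> else \<delta>) *\<^sub>R (w i, slope r * (x \<bullet> w i))" for i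
    using \<delta> cpos r by (auto simp: e_def xw slope)
  let ?k = "\<lambda>i. if i = i0 then angle_deriv r * cos (a r) / radial_conf \<epsilon> r else sin (a r) / tan_curv \<epsilon> r"
  define N' where "N' v = (- (flux r *\<^sub>R fst v +
      (((cos (a r) * angle_deriv r / (radial_conf \<epsilon> r * r) - sin (a r) * (1 / r\<^sup>2 - \<epsilon> / 4)) / r) * (x \<bullet> fst v)) *\<^sub>R x),
      (- sin (a r) * angle_deriv r / r) * (x \<bullet> fst v))" for v :: "'n amb"
  have N': "(normal has_derivative N') (at ?p)"
    unfolding N'_def[abs_def] r_def by (rule normal_has_derivative[OF x])
  show thesis
  proof (rule that[of i0], unfold principal_curvatures_def, intro conjI exI[of _ e] allI)
    show "normal differentiable at ?p within ?\<Sigma>"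
      using N' by (meson differentiableI differentiable_at_withinI)
    have lin: "linear (\<lambda>v. (v, slope r * (x \<bullet> v)))"
      by (rule linearI) (auto simp: inner_add_right algebra_simps)
    have eT: "e i \<in> tangent_space ?\<Sigma> ?p" for i
    proof -
      have "e i = (\<lambda>v. (v, slope r * (x \<bullet> v))) ((if i = i0 then cos (a r) * \<delta> else \<delta>) *\<^sub>R w i)"
        unfolding e by simp
      then show ?thesis unfolding T by blast
    qed
    show "span (range e) = tangent_space ?\<Sigma> ?p"
    proof
      show "span (range e) \<subseteq> tangent_space ?\<Sigma> ?p"
        using eT by (intro span_minimal) (auto simp: tangent_space_def)
      have "(\<lambda>v. (v, slope r * (x \<bullet> v))) ` range w \<subseteq> span (range e)"
      proof clarify
        fix i
        let ?c = "if i = i0 then cos (a r) * \<delta> else \<delta>"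
        have "(w i, slope r * (x \<bullet> w i)) = (1 / ?c) *\<^sub>R e i" unfolding e using \<delta> cpos by auto
        then show "(w i, slope r * (x \<bullet> w i)) \<in> span (range e)"
          by (metis rangeI span_base span_scale)
      qed
      then have "span ((\<lambda>v. (v, slope r * (x \<bullet> v))) ` range w) \<subseteq> span (range e)"
        by (intro span_minimal subspace_span)
      then show "tangent_space ?\<Sigma> ?p \<subseteq> span (range e)"
        unfolding T linear_span_image[OF lin] w(3) .
    qed
    show "metric \<epsilon> ?p (e i) (e j) = (if i = j then 1 else 0)" for i j
      using \<delta> sin_cos_squared_add[of "a r"]
      by (auto simp: metric_def e_def w(2) \<delta>(3) power2_eq_square)
    fix i
    have "shape_operator \<epsilon> ?\<Sigma> normal ?p (e i) = - (N' (e i) + christoffel \<epsilon> ?p (e i) (normal ?p))"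
      unfolding shape_operator_def frechet_derivative_tangent[OF p N' eT] ..
    also have "\<dots> = ?k i *\<^sub>R e i"
    proof (cases "i = i0")
      case True
      define h where "h = (cos (a r) * angle_deriv r / (radial_conf \<epsilon> r * r) - sin (a r) * (1 / r\<^sup>2 - \<epsilon> / 4)) / r"
      define \<kappa> where "\<kappa> = cos (a r) * \<delta> / r"
      have v: "e i = (\<kappa> *\<^sub>R x, sin (a r))"
        using True by (simp add: e_def w(1) r_def \<kappa>_def divide_inverse)
      have n: "fst (normal ?p) = - (flux r *\<^sub>R x)" by (simp add: normal_def r_def)
      have "- (N' (e i) + christoffel \<epsilon> ?p (e i) (normal ?p)) =
        ((flux r * \<kappa> + h * (\<kappa> * (r * r)) - \<epsilon> / \<delta> / 2 * (flux r * (\<kappa> * (r * r)))) *\<^sub>R x,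
          sin (a r) * angle_deriv r / r * (\<kappa> * (r * r)))"
        unfolding N'_def h_def[symmetric] christoffel_def v n fst_conv \<delta>(3)
        by (simp add: xx algebra_simps)
      also have "\<dots> = ?k i *\<^sub>R e i"
      proof -
        have "h = cos (a r) * angle_deriv r * \<delta> / r\<^sup>2 - sin (a r) * (1 / r\<^sup>2 - \<epsilon> / 4) / r"
          using r(3) unfolding h_def \<delta>(2) by (simp add: field_simps power2_eq_square)
        then have "h * (r * r) = cos (a r) * angle_deriv r * \<delta> - sin (a r) * (1 / r - \<epsilon> * r / 4)"
          using r(3) by (simp add: field_simps power2_eq_square)
        moreover have "flux r * (1 - \<epsilon> / \<delta> / 2 * (r * r)) = sin (a r) * (\<delta> / r - \<epsilon> * r / 2)"
          using r(3) \<delta>(1) by (simp add: flux field_simps)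
        moreover have "\<delta> / r = 1 / r + \<epsilon> * r / 4"
          using r(3) by (simp add: \<delta>_def field_simps power2_eq_square)
        ultimately have curv_id: "flux r * (1 - \<epsilon> / \<delta> / 2 * (r * r)) + h * (r * r) = cos (a r) * angle_deriv r * \<delta>"
          by (simp add: algebra_simps)
        have "flux r * \<kappa> + h * (\<kappa> * (r * r)) - \<epsilon> / \<delta> / 2 * (flux r * (\<kappa> * (r * r)))
            = angle_deriv r * cos (a r) / radial_conf \<epsilon> r * \<kappa>"
        proof -
          have "flux r * \<kappa> + h * (\<kappa> * (r * r)) - \<epsilon> / \<delta> / 2 * (flux r * (\<kappa> * (r * r)))
            = (flux r * (1 - \<epsilon> / \<delta> / 2 * (r * r)) + h * (r * r)) * \<kappa>"
            by (simp add: algebra_simps)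
          then show ?thesis unfolding curv_id \<delta>(2) by simp
        qed
        moreover have "sin (a r) * angle_deriv r / r * (\<kappa> * (r * r)) = angle_deriv r * cos (a r) / radial_conf \<epsilon> r * sin (a r)"
          using r(3) \<delta>(2) by (simp add: \<kappa>_def field_simps)
        ultimately show ?thesis unfolding v using True by simp
      qed
      finally show ?thesis .
    next
      case False
      then have v: "e i = (\<delta> *\<^sub>R w i, 0)" "x \<bullet> w i = 0" by (auto simp: e_def xw)
      have n: "fst (normal ?p) = - (flux r *\<^sub>R x)" by (simp add: normal_def r_def)
      have "- (N' (e i) + christoffel \<epsilon> ?p (e i) (normal ?p)) =
        ((flux r * \<delta> - \<epsilon> / \<delta> / 2 * (flux r * (\<delta> * (r * r)))) *\<^sub>R w i, 0)"
        unfolding N'_def christoffel_def v(1) n fst_conv \<delta>(3)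
        using v(2) by (simp add: xx algebra_simps inner_commute)
      also have "\<dots> = ?k i *\<^sub>R e i"
      proof -
        have "flux r * \<delta> - \<epsilon> / \<delta> / 2 * (flux r * (\<delta> * (r * r))) = sin (a r) * (\<delta> - \<epsilon> / 2 * r\<^sup>2) * \<delta> / r"
          using r(3) \<delta>(1) by (simp add: flux field_simps power2_eq_square)
        also have "\<delta> - \<epsilon> / 2 * r\<^sup>2 = 1 - \<epsilon> * r\<^sup>2 / 4" by (simp add: \<delta>_def)
        finally have "flux r * \<delta> - \<epsilon> / \<delta> / 2 * (flux r * (\<delta> * (r * r))) = sin (a r) / tan_curv \<epsilon> r * \<delta>"
          by (simp add: tan_curv_def)
        then show ?thesis using False v by simp
      qed
      finally show ?thesis .
    qed
    finally show "shape_operator \<epsilon> ?\<Sigma> normal ?p (e i) = ?k i *\<^sub>R e i" .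
  qed
qed

end

section \<open>Global shape of a rotational graph\<close>

context translator_profile begin

lemma U_continuous: "\<bar>r\<bar> < r1 \<Longrightarrow> isCont U r"
  using DERIV_isCont[OF deriv_U[of r]] by (simp add: abs_less_iff)

lemma U_mono:
  assumes "r0 \<le> p" "p \<le> q" "q < r1" shows "U p \<le> U q"
proof (rule DERIV_nonneg_imp_nondecreasing[OF assms(2)])
  fix z assume z: "p \<le> z" "z \<le> q"
  have z': "-r1 < z" "z < r1" "\<bar>z\<bar> \<le> r1" using z assms r0 r01 by auto
  have "0 \<le> sin (a z)" using a_range[OF z'(2)] by (intro sin_ge_zero) auto
  then have "0 \<le> radial_conf \<epsilon> z * tan (a z)"
    using cos_a_pos[OF z'(2)] radial_conf_pos[OF z'(3)] by (simp add: tan_def)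
  then show "\<exists>y. (U has_real_derivative y) (at z) \<and> 0 \<le> y"
    using deriv_U[OF z'(1,2)] by blast
qed

lemma U_nonneg: "r0 \<le> r \<Longrightarrow> r < r1 \<Longrightarrow> 0 \<le> U r"
  using U_mono[of r0 r] U_r0 by simp

lemma surface_subset_ambient:
  assumes "\<And>x. x \<in> D \<Longrightarrow> norm x < r1" shows "surface D \<subseteq> ambient \<epsilon>"
  using assms cball_subset_space_form[OF dom] by (force simp: surface_def ambient_def)

lemma vertical_graph_surface:
  assumes "\<And>x. x \<in> D \<Longrightarrow> norm x < r1"
  shows "vertical_graph (surface D) (\<lambda>y. U (norm y)) D"
  unfolding vertical_graph_def surface_def
  by (intro conjI refl continuous_at_imp_continuous_on ballI
      isCont_o2[OF isCont_norm[OF continuous_ident] U_continuous]) (use assms in simp)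

lemma rotational_surface: "rotational (surface {y :: real ^ 'n. P (norm y)})"
  unfolding rotational_def
proof (intro allI impI)
  fix A :: "real ^ 'n ^ 'n" assume "rotation_matrix A"
  then have A: "orthogonal_matrix A" by (simp add: rotation_matrix_def)
  have n: "norm (A *v y) = norm y" for y
  proof -
    have "orthogonal_transformation ((*v) A)" using A by (simp add: orthogonal_transformation_matrix)
    then show ?thesis by (rule orthogonal_transformation_norm)
  qed
  have onto: "\<exists>z. y = A *v z \<and> norm z = norm y" for y
  proof (intro exI conjI)
    have "A ** transpose A = mat 1" using A by (simp add: orthogonal_matrix_def)
    then show eq: "y = A *v (transpose A *v y)" by (metis matrix_vector_mul_assoc matrix_vector_mul_lid)
    show "norm (transpose A *v y) = norm y" using n[of "transpose A *v y"] eq by simp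
  qed
  show "(\<lambda>p. (A *v fst p, snd p)) ` surface {y. P (norm y)} = surface {y. P (norm y)}"
    unfolding surface_def image_image fst_conv snd_conv
  proof (intro equalityI image_subsetI)
    fix y :: "real ^ 'n" assume "y \<in> {y. P (norm y)}"
    then show "(A *v y, U (norm y)) \<in> (\<lambda>y. (y, U (norm y))) ` {y. P (norm y)}"
      by (intro image_eqI[of _ _ "A *v y"]) (auto simp: n)
  next
    fix y :: "real ^ 'n" assume y: "y \<in> {y. P (norm y)}"
    obtain z where "y = A *v z" "norm z = norm y" using onto by blast
    then show "(y, U (norm y)) \<in> (\<lambda>y. (A *v y, U (norm y))) ` {y. P (norm y)}"
      using y by (intro image_eqI[of _ _ z]) auto
  qed
qed

text \<open>
  The inner edge belongs to the surface, and a sequence whose base points approach the outer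
  sphere has unbounded heights.
\<close>

lemma closed_surface: "closed (surface {y :: real ^ 'n. r0 \<le> norm y \<and> norm y < r1})"
  unfolding closed_sequential_limits
proof (intro allI impI, elim conjE)
  fix p :: "nat \<Rightarrow> 'n amb" and l assume p: "\<forall>k. p k \<in> surface {y. r0 \<le> norm y \<and> norm y < r1}" and lim: "p \<longlonglongrightarrow> l"
  define y where "y k = fst (p k)" for k
  have y: "r0 \<le> norm (y k)" "norm (y k) < r1" "snd (p k) = U (norm (y k))" for k
    using p[rule_format, of k] by (auto simp: surface_def y_def)
  have yl: "(\<lambda>k. norm (y k)) \<longlonglongrightarrow> norm (fst l)"
    unfolding y_def by (intro tendsto_intros lim)
  have Ul: "(\<lambda>k. U (norm (y k))) \<longlonglongrightarrow> snd l"
    using tendsto_snd[OF lim] by (simp add: y(3))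
  have b: "r0 \<le> norm (fst l)" "norm (fst l) \<le> r1"
    using LIMSEQ_le_const[OF yl] LIMSEQ_le_const2[OF yl] y by (blast, meson less_imp_le)
  have "norm (fst l) \<noteq> r1"
  proof
    assume "norm (fst l) = r1"
    then have "filterlim (\<lambda>k. norm (y k)) (at_left r1) sequentially"
      unfolding filterlim_at using yl y(2) by (auto simp: less_imp_neq)
    from filterlim_compose[OF U_top this] have "filterlim (\<lambda>k. U (norm (y k))) at_infinity sequentially"
      by (rule filterlim_at_top_imp_at_infinity)
    from not_tendsto_and_filterlim_at_infinity[OF _ Ul this] show False by simp
  qed
  with b have b': "norm (fst l) < r1" by simp
  have "(\<lambda>k. U (norm (y k))) \<longlonglongrightarrow> U (norm (fst l))"
    by (rule isCont_tendsto_compose[OF U_continuous yl]) (use b' in simp)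
  then have "snd l = U (norm (fst l))" using Ul LIMSEQ_unique by blast
  then show "l \<in> surface {y. r0 \<le> norm y \<and> norm y < r1}"
    using b b' by (auto simp: surface_def image_iff prod_eq_iff)
qed

lemma height_unbounded:
  assumes "annulus \<subseteq> (D :: (real ^ 'n) set)" shows "\<not> bdd_above (snd ` surface D)"
proof
  assume "bdd_above (snd ` surface D)"
  then obtain M where M: "\<And>x. x \<in> D \<Longrightarrow> U (norm x) \<le> M"
    unfolding bdd_above_def surface_def by auto
  have "\<forall>\<^sub>F r in at_left r1. M + 1 \<le> U r" using U_top by (simp add: filterlim_at_top)
  moreover have "\<forall>\<^sub>F r in at_left r1. r0 < r \<and> r < r1"
    using r01 by (auto simp: eventually_at_left_field)
  ultimately obtain r where r: "M + 1 \<le> U r" "r0 < r" "r < r1"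
    using eventually_happens[OF eventually_conj] trivial_limit_at_left_real by blast
  obtain x :: "real ^ 'n" where "norm x = r" using exists_norm_eq[of r] r r0 by auto
  then show False using M[of x] r assms by (auto simp: annulus_def)
qed

text \<open>
  Height is monotone and tends to infinity at \<open>r\<^sub>1\<close>, so a high section lies over radii close to
  \<open>r\<^sub>1\<close>; conversely the intermediate value theorem finds every high level on every ray.
\<close>

lemma vertically_asymptotic_surface:
  assumes D: "annulus \<subseteq> D" "D \<subseteq> {y :: real ^ 'n. r0 \<le> norm y \<and> norm y < r1}"
  shows "vertically_asymptotic \<epsilon> (surface D) ({y. norm y = r1} \<times> UNIV)"
  unfolding vertically_asymptotic_def
proof (intro allI impI)
  fix e :: real assume e: "e > 0"
  define C where "C = radial_conf \<epsilon> r1"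
  have C: "C > 0" using radial_conf_pos[of r1] r1_pos by (simp add: C_def)
  \<comment> \<open>\<open>q\<close> is chosen with \<open>C * (r1 - q) < e\<close>: beyond it, moving radially to the outer sphere costs less than \<open>e\<close>.\<close>
  define q where "q = max ((r0 + r1) / 2) (r1 - e / (2 * C))"
  have q: "r0 < q" "q < r1" using r01 e C by (auto simp: q_def max_def)
  have "r1 - q \<le> e / (2 * C)" by (simp add: q_def)
  also have "e / (2 * C) < e / C" using e C by (simp add: field_simps)
  finally have Cq: "C * (r1 - q) < e" using C by (simp add: field_simps)
  have near: "geo_dist \<epsilon> x y < e" if "norm x \<le> r1" "norm y \<le> r1" "norm (y - x) \<le> r1 - q" for x y :: "real ^ 'n"
  proof -
    have "C * norm (y - x) \<le> C * (r1 - q)" using C that(3) by (intro mult_left_mono) auto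
    then show ?thesis using geo_dist_le[OF dom that(1,2), folded C_def] Cq by linarith
  qed
  show "\<exists>h. \<forall>t\<ge>h. (\<forall>x. (x, t) \<in> surface D \<longrightarrow> (\<exists>y. (y, t) \<in> {y. norm y = r1} \<times> UNIV \<and> geo_dist \<epsilon> x y < e)) \<and>
      (\<forall>y. (y, t) \<in> {y. norm y = r1} \<times> UNIV \<longrightarrow> (\<exists>x. (x, t) \<in> surface D \<and> geo_dist \<epsilon> x y < e))"
  proof (intro exI[of _ "U q + 1"] allI impI conjI)
    fix t x assume t: "U q + 1 \<le> t" and "(x, t) \<in> surface D"
    then have x: "t = U (norm x)" "r0 \<le> norm x" "norm x < r1" using D by (auto simp: surface_def)
    have "q < norm x" using U_mono[of "norm x" q] x t q by (cases "norm x \<le> q") auto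
    moreover from this have nz: "norm x > 0" using q r0 by linarith
    have "(r1 / norm x) *\<^sub>R x - x = ((r1 - norm x) / norm x) *\<^sub>R x"
      using nz by (simp add: diff_divide_distrib scaleR_left_diff_distrib)
    then have "norm ((r1 / norm x) *\<^sub>R x - x) = r1 - norm x" using nz x by simp
    moreover have "norm ((r1 / norm x) *\<^sub>R x) = r1" using nz r1_pos by simp
    ultimately show "\<exists>y. (y, t) \<in> {y. norm y = r1} \<times> UNIV \<and> geo_dist \<epsilon> x y < e"
      using x by (intro exI[of _ "(r1 / norm x) *\<^sub>R x"] conjI near) auto
  next
    fix t y assume t: "U q + 1 \<le> t" and "(y, t) \<in> {y :: real ^ 'n. norm y = r1} \<times> UNIV"
    then have y: "norm y = r1" by simp
    have "\<forall>\<^sub>F r in at_left r1. t \<le> U r" using U_top by (simp add: filterlim_at_top)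
    moreover have "\<forall>\<^sub>F r in at_left r1. q < r \<and> r < r1"
      using q by (auto simp: eventually_at_left_field)
    ultimately obtain r2 where r2: "t \<le> U r2" "q < r2" "r2 < r1"
      using eventually_happens[OF eventually_conj] trivial_limit_at_left_real by blast
    have "continuous_on {q..r2} U"
      using r2 q r0 by (intro continuous_at_imp_continuous_on ballI U_continuous) auto
    then obtain r where r: "q \<le> r" "r \<le> r2" "U r = t"
      using IVT'[of U q t r2] t r2 by auto
    have r': "r0 < r" "0 < r" "r < r1" using r r2 q r0 by auto
    let ?x = "(r / r1) *\<^sub>R y"
    have nx: "norm ?x = r" using y r1_pos r' by simp
    have "y - ?x = (1 - r / r1) *\<^sub>R y" by (simp add: scaleR_left_diff_distrib)
    then have "norm (y - ?x) = \<bar>1 - r / r1\<bar> * r1" by (simp only: norm_scaleR y)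
    also have "\<dots> = r1 - r" using r1_pos r' by (simp add: abs_if field_simps)
    finally have "norm (y - ?x) = r1 - r" .
    then have "geo_dist \<epsilon> ?x y < e" using nx r r' y by (intro near) auto
    moreover have "?x \<in> D" using D nx r' by (auto simp: annulus_def)
    then have "(?x, t) \<in> surface D"
      unfolding surface_def using nx r by (intro image_eqI[of _ _ ?x]) auto
    ultimately show "\<exists>x. (x, t) \<in> surface D \<and> geo_dist \<epsilon> x y < e" by blast
  qed
qed

lemma angle_normal: "angle \<epsilon> normal (x, t) = cos (a (norm x))"
  by (simp add: angle_def metric_def normal_def)

lemma flux_unit: "x \<noteq> 0 \<Longrightarrow> norm x < r1 \<Longrightarrow> conf \<epsilon> x * (flux (norm x) * norm x) = sin (a (norm x))"
  using radial_conf_pos[of "norm x"] by (simp add: flux_def conf_eq)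

lemma metric_normal_self:
  assumes "norm x < r1" "x = 0 \<Longrightarrow> a 0 = 0"
  shows "metric \<epsilon> (x, t) (normal (x, t)) (normal (x, t)) = 1"
proof (cases "x = 0")
  case False
  have "(conf \<epsilon> x)\<^sup>2 * ((flux (norm x) *\<^sub>R x) \<bullet> (flux (norm x) *\<^sub>R x)) = (conf \<epsilon> x * (flux (norm x) * norm x))\<^sup>2"
    by (simp add: power_mult_distrib dot_square_norm power2_eq_square mult_ac)
  then show ?thesis unfolding flux_unit[OF False assms(1)]
    by (simp add: metric_def normal_def power2_eq_square[symmetric])
qed (use assms in \<open>simp add: metric_def normal_def\<close>)

lemma metric_normal_tangent:
  assumes "x \<noteq> 0" "norm x < r1"
  shows "metric \<epsilon> (x, t) (normal (x, t)) (v, slope (norm x) * (x \<bullet> v)) = 0"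
proof -
  have c: "cos (a (norm x)) > 0" "radial_conf \<epsilon> (norm x) > 0"
    using assms by (auto intro!: cos_a_pos radial_conf_pos)
  have "(conf \<epsilon> x)\<^sup>2 * flux (norm x) = cos (a (norm x)) * slope (norm x)"
    using c assms by (simp add: conf_eq flux_def slope_def tan_def power2_eq_square)
  then show ?thesis by (simp add: metric_def normal_def algebra_simps)
qed

lemma isCont_normal:
  assumes "x \<noteq> 0" "norm x < r1" shows "isCont normal (x, t :: real)"
  unfolding normal_def using assms
  by (intro continuous_intros isCont_o2[OF _ isCont_flux] isCont_o2[OF _ cont_a]) auto

end

section \<open>Regularity of the bowl on the axis\<close>

text \<open>
  Solutions starting horizontally on the axis. The limits at the axis of all radial functions
  attached to such a solution follow from \<open>angle_asymptotics\<close>.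
\<close>

locale bowl_profile = translator_profile +
  assumes r0_zero: "r0 = 0" and a0_zero: "a0 = 0"
begin

lemma a_0 [simp]: "a 0 = 0" using a_le[of 0] r0_zero a0_zero by simp

lemma eventually_interior: "\<forall>\<^sub>F r in at_right 0. 0 < r \<and> r < r1 \<and> 0 < a r \<and> a r < pi / 2"
  unfolding eventually_at_right_field using a_bounds r0_zero a0_zero r1_pos by (intro exI[of _ r1]) auto

lemma angle_tendsto_0: "(a \<longlongrightarrow> 0) (at_right 0)"
  using cont_a[OF r1_pos] by (simp add: isCont_def filterlim_at_split)

lemma sin_angle_asymptotics: "((\<lambda>r. sin (a r) / r) \<longlongrightarrow> 1) (at_right 0)"
proof -
  have "filterlim a (at 0) (at_right 0)"
    unfolding filterlim_at using angle_tendsto_0 eventually_interior by (auto elim!: eventually_mono)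
  moreover have "((\<lambda>x::real. sin x / x) \<longlongrightarrow> 1) (at 0)"
    using DERIV_sin[of 0] unfolding has_field_derivative_iff by simp
  ultimately have "((\<lambda>r. sin (a r) / a r) \<longlongrightarrow> 1) (at_right 0)" by (rule filterlim_compose[rotated])
  from tendsto_mult[OF this angle_asymptotics[OF r0_zero a0_zero]]
  have "((\<lambda>r. (sin (a r) / a r) * (a r / r)) \<longlongrightarrow> 1) (at_right 0)" by simp
  then show ?thesis
    by (rule Lim_transform_eventually) (use eventually_interior in \<open>auto elim!: eventually_mono\<close>)
qed

lemma radial_conf_tendsto_1: "(radial_conf \<epsilon> \<longlongrightarrow> 1) (at_right 0)"
  unfolding radial_conf_def by (auto intro!: tendsto_eq_intros)

lemma tan_angle_asymptotics: "((\<lambda>r. tan (a r) / r) \<longlongrightarrow> 1) (at_right 0)"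
proof -
  have "((\<lambda>r. (sin (a r) / r) / cos (a r)) \<longlongrightarrow> 1) (at_right 0)"
    using tendsto_divide[OF sin_angle_asymptotics tendsto_cos[OF angle_tendsto_0]] by simp
  then show ?thesis by (simp add: tan_def mult.commute)
qed

lemma slope_tendsto_1: "(slope \<longlongrightarrow> 1) (at_right 0)"
  unfolding slope_def using tendsto_mult[OF radial_conf_tendsto_1 tan_angle_asymptotics] by simp

lemma flux_tendsto_1: "(flux \<longlongrightarrow> 1) (at_right 0)"
proof -
  have "((\<lambda>r. (sin (a r) / r) / radial_conf \<epsilon> r) \<longlongrightarrow> 1) (at_right 0)"
    using tendsto_divide[OF sin_angle_asymptotics radial_conf_tendsto_1] by simp
  then show ?thesis by (simp add: flux_def[abs_def] mult.commute)
qed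

lemma angle_deriv_tendsto_1: "(angle_deriv \<longlongrightarrow> 1) (at_right 0)"
proof -
  have "((\<lambda>r. 1 / (1 - \<epsilon> * r\<^sup>2 / 4)) \<longlongrightarrow> 1) (at_right 0)" by (auto intro!: tendsto_eq_intros)
  from tendsto_mult[OF tendsto_power[OF tendsto_divide[OF this sin_angle_asymptotics], of m] radial_conf_tendsto_1]
  have "((\<lambda>r. ((1 / (1 - \<epsilon> * r\<^sup>2 / 4)) / (sin (a r) / r)) ^ m * radial_conf \<epsilon> r) \<longlongrightarrow> 1) (at_right 0)" by simp
  then show ?thesis
    by (rule Lim_transform_eventually)
      (use eventually_interior in \<open>auto elim!: eventually_mono simp: angle_deriv_def tan_curv_def power_divide power_mult_distrib\<close>)
qed

lemma slope_deriv_tendsto: "((\<lambda>r. r * slope_deriv r) \<longlongrightarrow> 0) (at_right 0)"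
proof -
  have t: "((\<lambda>r. tan (a r)) \<longlongrightarrow> 0) (at_right 0)"
    using tendsto_tan[OF angle_tendsto_0] by simp
  have l: "((\<lambda>r. - (\<epsilon> * r / 2)) \<longlongrightarrow> 0) (at_right 0)" by (auto intro!: tendsto_eq_intros)
  have "((\<lambda>r. - (\<epsilon> * r / 2) * (radial_conf \<epsilon> r)\<^sup>2 * tan (a r)
     + radial_conf \<epsilon> r * (1 + (tan (a r))\<^sup>2) * angle_deriv r - radial_conf \<epsilon> r * (tan (a r) / r)) \<longlongrightarrow> 0) (at_right 0)"
    using tendsto_diff[OF tendsto_add[OF
          tendsto_mult[OF tendsto_mult[OF l tendsto_power[OF radial_conf_tendsto_1, of 2]] t]
          tendsto_mult[OF tendsto_mult[OF radial_conf_tendsto_1 tendsto_add[OF tendsto_const[of 1] tendsto_power[OF t, of 2]]]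
            angle_deriv_tendsto_1]]
        tendsto_mult[OF radial_conf_tendsto_1 tan_angle_asymptotics]]
    by simp
  then show ?thesis
    by (rule Lim_transform_eventually)
      (rule eventually_mono[OF eventually_interior], simp add: slope_deriv_def)
qed

lemma height_has_derivative_0: "((\<lambda>y :: real ^ 'n. U (norm y)) has_derivative (\<lambda>v. 0)) (at 0)"
proof (rule has_derivative_radial_at_0)
  have "(U has_real_derivative 0) (at 0)" using deriv_U[of 0] r1_pos by simp
  then have "((\<lambda>r. (U r - U 0) / r) \<longlongrightarrow> 0) (at 0)" unfolding has_field_derivative_iff by simp
  then show "((\<lambda>r. (U r - U 0) / r) \<longlongrightarrow> 0) (at_right 0)"
    by (rule tendsto_within_subset) simp
qed

lemma C2_on_height_ball: "C2_on (ball (0 :: real ^ 'n) r1) (\<lambda>y. U (norm y))"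
proof (rule C2_on_gradient)
  show "((\<lambda>y. U (norm y)) has_derivative (\<lambda>v. (slope (norm x) *\<^sub>R x) \<bullet> v)) (at x)"
    if "x \<in> ball 0 r1" for x :: "real ^ 'n"
    using height_has_derivative[of x] height_has_derivative_0 that by (cases "x = 0") auto
  show "C1_on (ball (0 :: real ^ 'n) r1) (\<lambda>x. slope (norm x) *\<^sub>R x)"
    by (rule C1_on_radial_field[where f' = slope_deriv and L = 1])
      (use r0_zero slope_has_derivative isCont_slope_deriv slope_tendsto_1 slope_deriv_tendsto in auto)
qed

text \<open>
  The horizontal part has derivative \<open>- v\<close> because \<open>flux \<rightarrow> 1\<close>; the vertical part \<open>cos a\<close> differs from
  1 only to second order.
\<close>

lemma normal_has_derivative_0:
  "(normal has_derivative (\<lambda>v. (- fst v, 0))) (at (0 :: real ^ 'n, t :: real))"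
proof -
  have "((\<lambda>r. (cos (a r) - cos (a 0)) / r) \<longlongrightarrow> 0) (at_right 0)"
  proof (rule Lim_transform_eventually)
    show "((\<lambda>r. - (sin (a r) / (1 + cos (a r)) * (sin (a r) / r))) \<longlongrightarrow> 0) (at_right 0)"
      using tendsto_minus[OF tendsto_mult[OF tendsto_divide[OF tendsto_sin[OF angle_tendsto_0]
            tendsto_add[OF tendsto_const[of 1] tendsto_cos[OF angle_tendsto_0]]] sin_angle_asymptotics]]
      by simp
    show "\<forall>\<^sub>F r in at_right 0. - (sin (a r) / (1 + cos (a r)) * (sin (a r) / r)) = (cos (a r) - cos (a 0)) / r"
      using eventually_interior
    proof eventually_elim
      case (elim r)
      then have "1 + cos (a r) > 0" using cos_a_pos[of r] by simp
      moreover have "sin (a r) * sin (a r) = (1 - cos (a r)) * (1 + cos (a r))"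
        using sin_cos_squared_add[of "a r"] by (simp add: algebra_simps power2_eq_square)
      ultimately have "sin (a r) / (1 + cos (a r)) * sin (a r) = 1 - cos (a r)" by simp
      then have "sin (a r) / (1 + cos (a r)) * (sin (a r) / r) = (1 - cos (a r)) / r" by simp
      then show ?case by (simp add: minus_divide_left)
    qed
  qed
  note c = has_derivative_radial_at_0[OF this]
  have "((\<lambda>y :: real ^ 'n. (- (flux (norm y) *\<^sub>R y), cos (a (norm y)))) has_derivative (\<lambda>v. (- (1 *\<^sub>R v), 0))) (at (fst (0, t)))"
    using has_derivative_Pair[OF has_derivative_minus[OF has_derivative_radial_field_at_0[OF flux_tendsto_1]] c] by simp
  from has_derivative_compose[OF has_derivative_fst[OF has_derivative_ident] this]
  show ?thesis by (simp add: normal_def[abs_def])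
qed

lemma tangent_space_vertex:
  assumes "ball 0 r1 \<subseteq> (D :: (real ^ 'n) set)"
  shows "tangent_space (surface D) (0, U 0) = range (\<lambda>v. (v, 0))"
proof -
  have "(0 :: real ^ 'n) \<in> ball 0 r1" using r1_pos by simp
  moreover from this have "0 \<in> D" using assms by blast
  ultimately show ?thesis
    using tangent_space_graph[OF _ height_has_derivative_0 span_directions_open[OF open_ball _ assms]]
    by (simp add: surface_def)
qed

lemma principal_curvatures_vertex:
  assumes D: "ball 0 r1 \<subseteq> (D :: (real ^ 'n) set)"
  shows "principal_curvatures \<epsilon> (surface D) normal (0, U 0) (\<lambda>i. 1)"
proof -
  let ?p = "(0 :: real ^ 'n, U 0)"
  have p: "?p \<in> surface D" using D r1_pos by (force simp: surface_def)
  let ?e = "\<lambda>i :: 'n. (axis i 1 :: real ^ 'n, 0 :: real)"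
  note T = tangent_space_vertex[OF D]
  have lin: "linear (\<lambda>v :: real ^ 'n. (v, 0 :: real))" by (rule linearI) auto
  show ?thesis
    unfolding principal_curvatures_def
  proof (intro conjI exI[of _ ?e] allI)
    show "normal differentiable at ?p within surface D"
      using normal_has_derivative_0 by (meson differentiableI differentiable_at_withinI)
    have "range ?e = (\<lambda>v. (v, 0)) ` (Basis :: (real ^ 'n) set)" by (auto simp: Basis_vec_def)
    then show "span (range ?e) = tangent_space (surface D) ?p"
      unfolding T by (simp add: linear_span_image[OF lin])
    show "metric \<epsilon> ?p (?e i) (?e j) = (if i = j then 1 else 0)" for i j
      by (simp add: metric_def conf_def inner_axis_axis)
    have "?e i \<in> tangent_space (surface D) ?p" for i unfolding T by auto
    from frechet_derivative_tangent[OF p normal_has_derivative_0 this]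
    show "shape_operator \<epsilon> (surface D) normal ?p (?e i) = 1 *\<^sub>R ?e i" for i
      by (simp add: shape_operator_def christoffel_def normal_def)
  qed
qed

end

section \<open>The three families\<close>

context translator_profile begin

lemma ball_surface: "(\<forall>p\<in>surface D. P p) \<longleftrightarrow> (\<forall>x\<in>D. P (x, U (norm x)))"
  by (simp add: surface_def)

lemma annulusD: "x \<in> annulus \<Longrightarrow> x \<noteq> 0 \<and> r0 < norm x \<and> norm x < r1"
  using r0 by (auto simp: annulus_def)

lemma interior_point_C2_annulus:
  fixes x :: "real ^ 'n"
  assumes "x \<in> annulus" "annulus \<subseteq> D"
  shows "interior_point C2_on (surface D) (x, U (norm x))"
  unfolding surface_def
  by (rule interior_point_graph[where u = "\<lambda>y. U (norm y)" and C = C2_on, OF open_annulus assms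
        C2_on_imp_C1_on[OF C2_on_height_annulus] C2_on_vertical_defect[OF C2_on_height_annulus]])

text \<open>
  With \<open>c\<close> the conformal factor, the product of the curvatures is \<open>(sin a / T)\<^sup>m a' cos a / c\<close>, and the
  differential equation turns it into \<open>cos a\<close>.
\<close>

lemma gauss_curvature_annulus:
  fixes x :: "real ^ 'n"
  assumes x: "x \<in> annulus" and D: "annulus \<subseteq> D" and m: "CARD('n) = Suc m"
  shows "gauss_curvature \<epsilon> (surface D) normal (x, U (norm x)) (angle \<epsilon> normal (x, U (norm x)))"
proof -
  define r where "r = norm x"
  have r: "r0 < r" "r < r1" "0 < r" using annulusD[OF x] by (auto simp: r_def)
  obtain i0 where pc: "principal_curvatures \<epsilon> (surface D) normal (x, U (norm x))
    (\<lambda>i. if i = i0 then angle_deriv r * cos (a r) / radial_conf \<epsilon> r else sin (a r) / tan_curv \<epsilon> r)"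
    (is "principal_curvatures _ _ _ _ ?k")
    using principal_curvatures_annulus[OF x D] unfolding r_def by blast
  have p: "sin (a r) > 0" "tan_curv \<epsilon> r > 0" "radial_conf \<epsilon> r > 0"
    using r sin_a_pos tan_curv_pos radial_conf_pos[of r] by auto
  have "(\<Prod>i\<in>UNIV. ?k i) = ?k i0 * (\<Prod>i\<in>UNIV - {i0}. ?k i)"
    by (rule prod.remove) auto
  also have "(\<Prod>i\<in>UNIV - {i0}. ?k i) = (\<Prod>i\<in>UNIV - {i0}. sin (a r) / tan_curv \<epsilon> r)"
    by (rule prod.cong) auto
  also have "\<dots> = (sin (a r) / tan_curv \<epsilon> r) ^ m" using m by (simp add: card_Diff_singleton)
  also have "?k i0 * \<dots> = cos (a r)" using p by (simp add: angle_deriv_def power_divide)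
  finally show ?thesis
    unfolding gauss_curvature_def angle_normal using pc by (intro exI[of _ ?k]) (simp add: r_def)
qed

lemma convex_annulus:
  fixes x :: "real ^ 'n"
  assumes x: "x \<in> annulus" and D: "annulus \<subseteq> D"
  shows "\<exists>k. principal_curvatures \<epsilon> (surface D) normal (x, U (norm x)) k \<and> (\<forall>i. 0 < k i)"
proof -
  define r where "r = norm x"
  have r: "r0 < r" "r < r1" "0 < r" using annulusD[OF x] by (auto simp: r_def)
  obtain i0 where pc: "principal_curvatures \<epsilon> (surface D) normal (x, U (norm x))
    (\<lambda>i. if i = i0 then angle_deriv r * cos (a r) / radial_conf \<epsilon> r else sin (a r) / tan_curv \<epsilon> r)"
    using principal_curvatures_annulus[OF x D] unfolding r_def by blast
  have "sin (a r) > 0" "tan_curv \<epsilon> r > 0" "radial_conf \<epsilon> r > 0" "cos (a r) > 0" "angle_deriv r > 0"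
    using r sin_a_pos tan_curv_pos radial_conf_pos[of r] cos_a_pos angle_deriv_pos by auto
  then show ?thesis using pc by (intro exI conjI) auto
qed

lemma unit_normal_surface:
  fixes D :: "(real ^ 'n) set"
  assumes D: "\<And>x. x \<in> D \<Longrightarrow> norm x < r1 \<and> x \<noteq> 0 \<and> span {v. \<forall>\<^sub>F t in at_right 0. x + t *\<^sub>R v \<in> D} = UNIV"
  shows "unit_normal \<epsilon> (surface D) normal"
  unfolding unit_normal_def
proof (intro conjI ballI)
  show "continuous_on (surface D) normal"
    by (rule continuous_at_imp_continuous_on) (use D isCont_normal in \<open>auto simp: surface_def\<close>)
  fix p assume "p \<in> surface D"
  then obtain x where p: "p = (x, U (norm x))" and x: "x \<in> D" by (auto simp: surface_def)
  show "metric \<epsilon> p (normal p) (normal p) = 1"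
    unfolding p using D[OF x] by (intro metric_normal_self) auto
  fix v assume "v \<in> tangent_space (surface D) p"
  then obtain w where "v = (w, slope (norm x) * (x \<bullet> w))"
    unfolding p using tangent_space_surface[OF x] D[OF x] by auto
  then show "metric \<epsilon> p (normal p) v = 0"
    unfolding p using metric_normal_tangent D[OF x] by auto
qed

lemma geo_ball_profile: "0 \<le> r \<Longrightarrow> r \<le> r1 \<Longrightarrow> geo_ball \<epsilon> (geo_radius \<epsilon> r) = {x :: real ^ 'n. norm x < r}"
  by (rule geo_ball_eq) (auto intro: chart_domain_le)

lemma geo_sphere_profile: "0 \<le> r \<Longrightarrow> r \<le> r1 \<Longrightarrow> geo_sphere \<epsilon> (geo_radius \<epsilon> r) = {x :: real ^ 'n. norm x = r}"
  by (rule geo_sphere_eq) (auto intro: chart_domain_le)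

lemma geo_radius_r1_pos: "0 < geo_radius \<epsilon> r1"
  using geo_radius_strict_mono[OF dom, of 0] r1_pos by simp

end

text \<open>
  Away from the axis the translator equation is the differential equation; on the axis all
  curvatures and the angle function equal 1.
\<close>

lemma (in bowl_profile) bowl_soliton:
  fixes D :: "(real ^ 'n) set"
  assumes m: "CARD('n) = Suc m"
  defines "D \<equiv> {y. norm y < r1}"
  shows "n_translator \<epsilon> (surface D) normal {}" "hyp_boundary (surface D) = {}" "rotational (surface D)"
    "strictly_convex \<epsilon> (surface D) normal" "vertical_graph (surface D) (\<lambda>y. U (norm y)) (geo_ball \<epsilon> (geo_radius \<epsilon> r1))"
    "surface D \<subseteq> {p. 0 \<le> snd p}" "\<not> bdd_above (snd ` surface D)"
    "vertically_asymptotic \<epsilon> (surface D) (geo_sphere \<epsilon> (geo_radius \<epsilon> r1) \<times> UNIV)"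
proof -
  have ball: "ball 0 r1 = D" by (auto simp: D_def)
  have oD: "open D" unfolding ball[symmetric] by simp
  have ann: "annulus \<subseteq> D" by (auto simp: annulus_def D_def)
  have D_eq: "D = {y. r0 \<le> norm y \<and> norm y < r1}" by (simp add: D_def r0_zero)
  have cases: "x = 0 \<or> x \<in> annulus" if "x \<in> D" for x
    using that unfolding annulus_def by (auto simp: D_def r0_zero)
  have C2: "C2_on D (\<lambda>y. U (norm y))" unfolding ball[symmetric] by (rule C2_on_height_ball)
  note C1 = C2_on_imp_C1_on[OF C2]
  have ip: "\<forall>x\<in>D. interior_point C2_on (surface D) (x, U (norm x))"
    unfolding surface_def
  proof
    fix x assume "x \<in> D"
    then show "interior_point C2_on ((\<lambda>y. (y, U (norm y))) ` D) (x, U (norm x))"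
      by (rule interior_point_graph[where u = "\<lambda>y. U (norm y)" and C = C2_on, OF oD _ order_refl C1 C2_on_vertical_defect[OF C2]])
  qed
  have N: "unit_normal \<epsilon> (surface D) normal"
    unfolding unit_normal_def
  proof (intro conjI ballI)
    have "isCont normal (x, U (norm x))" if "x \<in> D" for x
      using that isCont_normal[of x] has_derivative_continuous[OF normal_has_derivative_0]
      by (cases "x = 0") (auto simp: D_def)
    then show "continuous_on (surface D) normal"
      by (intro continuous_at_imp_continuous_on) (auto simp: surface_def)
    fix p assume "p \<in> surface D"
    then obtain x where p: "p = (x, U (norm x))" and x: "x \<in> D" by (auto simp: surface_def)
    show "metric \<epsilon> p (normal p) (normal p) = 1"
      unfolding p using x by (intro metric_normal_self) (auto simp: D_def)
    fix v assume v: "v \<in> tangent_space (surface D) p"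
    show "metric \<epsilon> p (normal p) v = 0"
    proof (cases "x = 0")
      case True
      then show ?thesis using v tangent_space_vertex[of D] ball unfolding p
        by (auto simp: metric_def normal_def)
    next
      case False
      then have "v \<in> range (\<lambda>v. (v, slope (norm x) * (x \<bullet> v)))"
        using v tangent_space_surface[OF x False _ span_directions_open[OF oD x order_refl]] x
        unfolding p by (auto simp: D_def)
      then show ?thesis unfolding p using metric_normal_tangent[OF False] x by (auto simp: D_def)
    qed
  qed
  have "gauss_curvature \<epsilon> (surface D) normal (x, U (norm x)) (angle \<epsilon> normal (x, U (norm x)))" if "x \<in> D" for x
  proof (cases "x = 0")
    case True
    then show ?thesis unfolding gauss_curvature_def angle_normal
      using principal_curvatures_vertex[of D] ball by (intro exI[of _ "\<lambda>i. 1"]) auto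
  qed (use cases[OF that] gauss_curvature_annulus[OF _ ann m] in auto)
  moreover have "hypersurface \<epsilon> (surface D) {}"
    unfolding hypersurface_def
  proof (intro conjI ballI hausdorff_null_empty)
    show "surface D \<subseteq> ambient \<epsilon>" by (rule surface_subset_ambient) (simp add: D_def)
  next
    show "p \<in> surface D \<Longrightarrow> interior_point C1_on (surface D) p \<or> boundary_point C1_on (surface D) p"
      "p \<in> surface D - {} \<Longrightarrow> interior_point C2_on (surface D) p \<or> boundary_point C2_on (surface D) p" for p
      using ip[folded ball_surface] interior_point_C2_imp_C1 by blast+
  qed simp_all
  ultimately show "n_translator \<epsilon> (surface D) normal {}"
    unfolding n_translator_def Diff_empty ball_surface using N by blast
  show "hyp_boundary (surface D) = {}"
  proof -
    have "\<not> boundary_point C1_on (surface D) (x, U (norm x))" if "x \<in> D" for x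
      unfolding surface_def
      by (rule not_boundary_point_graph[OF oD that order_refl C1_on_has_frechet_derivative[OF C1 that]])
    then show ?thesis unfolding hyp_boundary_def by (auto simp: boundary_point_def surface_def)
  qed
  show "rotational (surface D)" unfolding D_def by (rule rotational_surface)
  show "strictly_convex \<epsilon> (surface D) normal"
    unfolding strictly_convex_def
  proof
    fix p assume "p \<in> surface D"
    then obtain x where p: "p = (x, U (norm x))" and x: "x \<in> D" by (auto simp: surface_def)
    show "\<exists>k. principal_curvatures \<epsilon> (surface D) normal p k \<and> (\<forall>i. 0 < k i)"
    proof (cases "x = 0")
      case True
      then show ?thesis using principal_curvatures_vertex[of D] ball
        unfolding p by (intro exI[of _ "\<lambda>i. 1"]) auto
    next
      case False
      then show ?thesis unfolding p using cases[OF x] convex_annulus[OF _ ann] by blast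
    qed
  qed
  show "vertical_graph (surface D) (\<lambda>y. U (norm y)) (geo_ball \<epsilon> (geo_radius \<epsilon> r1))"
    using vertical_graph_surface[of D] r1_pos by (simp add: geo_ball_profile D_def)
  show "surface D \<subseteq> {p. 0 \<le> snd p}"
    using U_nonneg r0_zero by (auto simp: surface_def D_def)
  show "\<not> bdd_above (snd ` surface D)" by (rule height_unbounded[OF ann])
  show "vertically_asymptotic \<epsilon> (surface D) (geo_sphere \<epsilon> (geo_radius \<epsilon> r1) \<times> UNIV)"
    using vertically_asymptotic_surface[OF ann] r1_pos D_eq by (simp add: geo_sphere_profile)
qed

context translator_profile begin

text \<open>
  The tangent cone is the graph of \<open>tan a\<^sub>0 * norm v\<close>. A derivative of the height would be linear
  and equal to \<open>tan a\<^sub>0 > 0\<close> on every unit vector, which is impossible for opposite ones.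
\<close>

lemma conical_singularity_height:
  assumes z: "r0 = 0" and pos: "0 < a0"
  shows "conical_singularity (\<lambda>y :: real ^ 'n. U (norm y)) 0"
proof -
  have a_0: "a 0 = a0" using a_le[of 0] z by simp
  define \<kappa> where "\<kappa> = tan a0"
  have \<kappa>: "\<kappa> > 0" unfolding \<kappa>_def using pos a0 by (intro tan_gt_zero) auto
  have dU: "(U has_real_derivative \<kappa>) (at 0)"
    using deriv_U[of 0] r1_pos a_0 by (simp add: \<kappa>_def radial_conf_def)
  have lim: "((\<lambda>r. (U r - U 0 - \<kappa> * r) / r) \<longlongrightarrow> 0) (at_right 0)"
  proof -
    have "((\<lambda>r. (U r - U 0) / r - \<kappa>) \<longlongrightarrow> 0) (at 0)"
      using dU unfolding has_field_derivative_iff by (simp add: LIM_zero)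
    then have "((\<lambda>r. (U r - U 0) / r - \<kappa>) \<longlongrightarrow> 0) (at_right 0)" by (rule tendsto_within_subset) simp
    then show ?thesis
      by (rule Lim_transform_eventually)
        (rule eventually_mono[OF eventually_at_right_less[of 0]], simp add: diff_divide_distrib)
  qed
  have "\<not> (\<lambda>y :: real ^ 'n. U (norm y)) differentiable (at 0)"
  proof
    assume "(\<lambda>y :: real ^ 'n. U (norm y)) differentiable (at 0)"
    then obtain L where L: "((\<lambda>y :: real ^ 'n. U (norm y)) has_derivative L) (at 0)"
      unfolding differentiable_def by blast
    \<comment> \<open>Along the ray of \<open>v\<close> the height is \<open>U\<close> itself.\<close>
    have Lv: "L v = \<kappa>" if "norm v = 1" for v
    proof -
      have d: "((\<lambda>t. t *\<^sub>R v) has_vector_derivative v) (at 0 within {0..1})"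
        by (auto intro!: derivative_eq_intros)
      have "((\<lambda>t. U (norm (t *\<^sub>R v))) has_vector_derivative L v) (at 0 within {0..1})"
      proof -
        have "((\<lambda>y. U (norm y)) has_derivative L) (at (0 *\<^sub>R v) within (\<lambda>t. t *\<^sub>R v) ` {0..1})"
          using L by (simp add: has_derivative_at_withinI)
        from vector_derivative_diff_chain_within[OF d this] show ?thesis by (simp only: o_def)
      qed
      moreover have "((\<lambda>t. U (norm (t *\<^sub>R v))) has_vector_derivative \<kappa>) (at 0 within {0..1})"
      proof (rule has_vector_derivative_transform)
        show "(U has_vector_derivative \<kappa>) (at 0 within {0..1})"
          using dU by (simp add: has_real_derivative_iff_has_vector_derivative has_vector_derivative_at_within)
      qed (use that in auto)
      ultimately show ?thesis
        using vector_derivative_unique_within_closed_interval[of 0 1 0] by (simp add: cbox_interval)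
    qed
    obtain v :: "real ^ 'n" where v: "norm v = 1" using exists_norm_eq[of 1] by auto
    then have "L (- v) = - L v" using linear_neg[OF has_derivative_linear[OF L]] by blast
    then show False using Lv[of v] Lv[of "- v"] v \<kappa> by simp
  qed
  moreover have "((\<lambda>v :: real ^ 'n. (U (norm (0 + v)) - U (norm (0 :: real ^ 'n)) - \<kappa> * norm v) / norm v) \<longlongrightarrow> 0) (at 0)"
    using filterlim_compose[OF lim filterlim_norm_at_right_0] by simp
  ultimately show ?thesis
    unfolding conical_singularity_def
    by (intro conjI exI[of _ "\<lambda>v. \<kappa> * norm v"]) (auto intro!: continuous_intros)
qed

text \<open>
  Without its vertex the cone is the graph over the punctured ball, the \<open>annulus\<close> of inner radius
  0; with the vertex it is closed. The geodesic distance determines the chart radius and so the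
  angle.
\<close>

lemma peaked_bowl_soliton:
  fixes D :: "(real ^ 'n) set"
  assumes m: "CARD('n) = Suc m" and z: "r0 = 0" and pos: "0 < a0"
  defines "D \<equiv> {y. norm y < r1}"
  shows "n_translator \<epsilon> (surface D - {(0, 0)}) normal {}" "hyp_boundary (surface D - {(0, 0)}) = {}"
    "rotational (surface D)" "proper_in_ambient \<epsilon> (surface D)"
    "vertical_graph (surface D) (\<lambda>y. U (norm y)) (geo_ball \<epsilon> (geo_radius \<epsilon> r1))"
    "surface D \<subseteq> {p. 0 \<le> snd p}" "\<not> bdd_above (snd ` surface D)"
    "vertically_asymptotic \<epsilon> (surface D) (geo_sphere \<epsilon> (geo_radius \<epsilon> r1) \<times> UNIV)"
    "\<forall>x \<in> geo_ball \<epsilon> (geo_radius \<epsilon> r1) - {0 :: real ^ 'n}.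
       angle \<epsilon> normal (x, U (norm x)) = cos (a (chart_radius \<epsilon> (geo_dist \<epsilon> 0 x)))"
    "((\<lambda>s. (cos (a (chart_radius \<epsilon> s)))\<^sup>2) \<longlongrightarrow> 1 - (sin a0)\<^sup>2) (at_right 0)"
proof -
  have D_eq: "D = {y. r0 \<le> norm y \<and> norm y < r1}" by (simp add: D_def z)
  have ann: "annulus \<subseteq> D" by (auto simp: annulus_def D_def)
  have S: "surface D - {(0, 0)} = surface (annulus :: (real ^ 'n) set)"
  proof -
    have "D = insert 0 annulus" unfolding annulus_def using r1_pos by (auto simp: D_def z)
    then have "surface D = insert (0, 0) (surface annulus)"
      using U_r0 z by (simp add: surface_def)
    moreover have "(0, 0) \<notin> surface (annulus :: (real ^ 'n) set)"
      using annulusD by (auto simp: surface_def)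
    ultimately show ?thesis by simp
  qed
  have N: "unit_normal \<epsilon> (surface (annulus :: (real ^ 'n) set)) normal"
    by (rule unit_normal_surface) (use annulusD span_directions_open[OF open_annulus _ order_refl] in blast)
  have "hypersurface \<epsilon> (surface (annulus :: (real ^ 'n) set)) {}"
    unfolding hypersurface_def
  proof (intro conjI ballI hausdorff_null_empty)
    show "surface annulus \<subseteq> ambient \<epsilon>" by (rule surface_subset_ambient) (simp add: annulus_def)
  next
    have "\<forall>p\<in>surface (annulus :: (real ^ 'n) set). interior_point C2_on (surface annulus) p"
      unfolding ball_surface using interior_point_C2_annulus[OF _ order_refl] by blast
    then show "p \<in> surface annulus \<Longrightarrow> interior_point C1_on (surface annulus) p \<or> boundary_point C1_on (surface annulus) p"
      "p \<in> surface annulus - {} \<Longrightarrow> interior_point C2_on (surface annulus) p \<or> boundary_point C2_on (surface annulus) p"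
      for p :: "'n amb" using interior_point_C2_imp_C1 by blast+
  qed simp_all
  then show "n_translator \<epsilon> (surface D - {(0, 0)}) normal {}"
    unfolding S n_translator_def Diff_empty ball_surface
    using N gauss_curvature_annulus[OF _ order_refl m] by blast
  show "hyp_boundary (surface D - {(0, 0)}) = {}"
  proof -
    have "\<not> boundary_point C1_on (surface annulus) (x, U (norm x))" if x: "x \<in> annulus" for x :: "real ^ 'n"
      using not_boundary_point_graph[OF open_annulus x order_refl height_has_derivative] annulusD[OF x]
      by (simp add: surface_def)
    then show ?thesis unfolding S hyp_boundary_def by (auto simp: boundary_point_def surface_def)
  qed
  show "rotational (surface D)" unfolding D_def by (rule rotational_surface)
  show "proper_in_ambient \<epsilon> (surface D)" unfolding proper_in_ambient_def
  proof (rule closed_subset)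
    show "surface D \<subseteq> ambient \<epsilon>" by (rule surface_subset_ambient) (simp add: D_def)
    show "closed (surface D)" unfolding D_eq by (rule closed_surface)
  qed
  show "vertical_graph (surface D) (\<lambda>y. U (norm y)) (geo_ball \<epsilon> (geo_radius \<epsilon> r1))"
    using vertical_graph_surface[of D] r1_pos by (simp add: geo_ball_profile D_def)
  show "surface D \<subseteq> {p. 0 \<le> snd p}"
    using U_nonneg z by (auto simp: surface_def D_def)
  show "\<not> bdd_above (snd ` surface D)" by (rule height_unbounded[OF ann])
  show "vertically_asymptotic \<epsilon> (surface D) (geo_sphere \<epsilon> (geo_radius \<epsilon> r1) \<times> UNIV)"
    using vertically_asymptotic_surface[OF ann] r1_pos D_eq by (simp add: geo_sphere_profile)
  show "\<forall>x \<in> geo_ball \<epsilon> (geo_radius \<epsilon> r1) - {0 :: real ^ 'n}.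
       angle \<epsilon> normal (x, U (norm x)) = cos (a (chart_radius \<epsilon> (geo_dist \<epsilon> 0 x)))"
  proof
    fix x :: "real ^ 'n" assume "x \<in> geo_ball \<epsilon> (geo_radius \<epsilon> r1) - {0}"
    then have "norm x < r1" using r1_pos by (simp add: geo_ball_profile)
    then have "x \<in> space_form \<epsilon>" "0 < 1 + \<epsilon> * (norm x)\<^sup>2 / 4"
      using chart_domain_le[of "norm x"] by (simp_all add: space_form_iff)
    then show "angle \<epsilon> normal (x, U (norm x)) = cos (a (chart_radius \<epsilon> (geo_dist \<epsilon> 0 x)))"
      by (simp add: angle_normal geo_dist_origin chart_radius_geo_radius)
  qed
  have "((\<lambda>s. a (chart_radius \<epsilon> s)) \<longlongrightarrow> a 0) (at_right 0)"
    by (rule isCont_tendsto_compose[OF cont_a[OF r1_pos] chart_radius_tendsto_0])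
  then have "((\<lambda>s. (cos (a (chart_radius \<epsilon> s)))\<^sup>2) \<longlongrightarrow> (cos (a 0))\<^sup>2) (at_right 0)"
    by (intro tendsto_intros)
  then show "((\<lambda>s. (cos (a (chart_radius \<epsilon> s)))\<^sup>2) \<longlongrightarrow> 1 - (sin a0)\<^sup>2) (at_right 0)"
    using a_le[of 0] z by (simp add: cos_squared_eq)
qed

text \<open>
  Along the inner edge \<open>U\<close> and its gradient vanish, so the extension of \<open>U\<close> by 0 shows that the
  surface is \<open>C\<^sup>1\<close> with boundary and tangent to the horizontal slice. The remaining points are interior
  and \<open>C\<^sup>2\<close>.
\<close>

lemma grim_reaper:
  fixes D :: "(real ^ 'n) set"
  assumes m: "CARD('n) = Suc m" and pos: "0 < r0" and flat: "a0 = 0"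
  defines "D \<equiv> {y. r0 \<le> norm y \<and> norm y < r1}"
  shows "n_translator \<epsilon> (surface D) normal ({y. norm y = r0} \<times> {0})"
    "rotational (surface D)" "proper_in_ambient \<epsilon> (surface D)"
    "vertical_graph (surface D) (\<lambda>y. U (norm y)) (geo_ball \<epsilon> (geo_radius \<epsilon> r1) - geo_ball \<epsilon> (geo_radius \<epsilon> r0))"
    "surface D \<subseteq> {p. 0 \<le> snd p}" "\<not> bdd_above (snd ` surface D)"
    "vertically_asymptotic \<epsilon> (surface D) (geo_sphere \<epsilon> (geo_radius \<epsilon> r1) \<times> UNIV)"
    "hyp_boundary (surface D) \<noteq> {}" "hyp_boundary (surface D) = geo_sphere \<epsilon> (geo_radius \<epsilon> r0) \<times> {0}"
    "\<forall>p \<in> hyp_boundary (surface D). tangent_space (surface D) p = {v. snd v = 0}"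
proof -
  let ?\<Lambda> = "{y :: real ^ 'n. norm y = r0} \<times> {0 :: real}"
  let ?B = "{y :: real ^ 'n. y \<noteq> 0 \<and> norm y < r1}"
  have ann: "annulus \<subseteq> D" by (auto simp: annulus_def D_def)
  have oB: "open ?B" by (intro open_Collect_conj open_Collect_neq open_Collect_less continuous_intros)
  have cases: "norm x = r0 \<or> x \<in> annulus" if "x \<in> D" for x
    using that by (auto simp: annulus_def D_def)
  have xD: "x \<noteq> 0 \<and> norm x < r1" if "x \<in> D" for x using that pos by (auto simp: D_def)
  have edge: "x \<in> D \<and> U (norm x) = 0 \<and> slope (norm x) = 0 \<and> x \<noteq> 0" if "norm x = r0" for x
    using that pos r01 U_r0 flat a_le[of r0] by (auto simp: D_def slope_def)
  have sub: "?\<Lambda> \<subseteq> surface D" using edge by (force simp: surface_def)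
  have diff: "surface D - ?\<Lambda> = surface annulus"
    using cases edge U_r0 by (auto simp: surface_def D_def annulus_def)
  have bp: "boundary_point C1_on (surface D) (x, U (norm x))" if x: "norm x = r0" for x
    unfolding surface_def
  proof (rule boundary_point_graph[OF oB])
    let ?g = "\<lambda>y :: real ^ 'n. y \<bullet> y - r0\<^sup>2"
    show "x \<in> ?B" using edge[OF x] xD by auto
    show "D \<inter> ?B = {y \<in> ?B. 0 \<le> ?g y}"
      using pos by (auto simp: D_def abs_le_square_iff[symmetric] dot_square_norm)
    show "?g x = 0" using x by (simp add: dot_square_norm)
    have dg: "(?g has_derivative (\<lambda>v. 2 * (y \<bullet> v))) (at y)" for y
      by (auto intro!: derivative_eq_intros simp: inner_commute)
    then show "(?g has_derivative (\<lambda>v. 2 * (x \<bullet> v))) (at x)" .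
    show "2 * (x \<bullet> x) \<noteq> 0" using edge[OF x] by simp
    show "C1_on ?B ?g" by (rule C1_onI[OF dg]) (intro continuous_intros)
  qed (rule C1_on_height)
  have span: "span {v. \<forall>\<^sub>F t in at_right 0. x + t *\<^sub>R v \<in> D} = UNIV" if "x \<in> D" for x
  proof (cases "x \<in> annulus")
    case True
    then show ?thesis by (rule span_directions_open[OF open_annulus _ ann])
  next
    case False
    then have x: "norm x = r0" using cases that by blast
    \<comment> \<open>Directions making an angle of at most \<open>\<pi> / 2\<close> with \<open>x\<close> do not decrease the norm; every vector or its opposite is one of them.\<close>
    have out: "\<forall>\<^sub>F t in at_right 0. x + t *\<^sub>R v \<in> D" if v: "0 \<le> x \<bullet> v" for v
    proof -
      have "((\<lambda>t::real. norm (x + t *\<^sub>R v)) \<longlongrightarrow> norm x) (at_right 0)" by (auto intro!: tendsto_eq_intros)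
      then have "\<forall>\<^sub>F t in at_right 0. norm (x + t *\<^sub>R v) < r1"
        by (rule order_tendstoD) (use x r01 in simp)
      with eventually_at_right_less[of 0] show ?thesis
      proof eventually_elim
        case (elim t)
        have "(x + t *\<^sub>R v) \<bullet> (x + t *\<^sub>R v) = x \<bullet> x + 2 * t * (x \<bullet> v) + t\<^sup>2 * (v \<bullet> v)"
          by (simp add: inner_add_left inner_add_right inner_commute power2_eq_square algebra_simps)
        moreover have "0 \<le> 2 * t * (x \<bullet> v)" "0 \<le> t\<^sup>2 * (v \<bullet> v)" using elim v by auto
        ultimately have "norm x \<le> norm (x + t *\<^sub>R v)" unfolding norm_le by linarith
        then show ?case using elim x by (simp add: D_def)
      qed
    qed
    have "v \<in> span {v. \<forall>\<^sub>F t in at_right 0. x + t *\<^sub>R v \<in> D}" for v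
    proof (cases "0 \<le> x \<bullet> v")
      case True
      then show ?thesis using out by (intro span_base) simp
    next
      case False
      then have "- v \<in> span {v. \<forall>\<^sub>F t in at_right 0. x + t *\<^sub>R v \<in> D}"
        using out[of "- v"] by (intro span_base) simp
      then show ?thesis using span_neg by fastforce
    qed
    then show ?thesis by blast
  qed
  have N: "unit_normal \<epsilon> (surface D) normal"
    by (rule unit_normal_surface) (use xD span in blast)
  have "hypersurface \<epsilon> (surface D) ?\<Lambda>"
    unfolding hypersurface_def
  proof (intro conjI ballI sub)
    show "surface D \<subseteq> ambient \<epsilon>" by (rule surface_subset_ambient) (use xD in blast)
    fix p assume "p \<in> surface D"
    then obtain x where p: "p = (x, U (norm x))" and x: "x \<in> D" by (auto simp: surface_def)
    show "interior_point C1_on (surface D) p \<or> boundary_point C1_on (surface D) p"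
      using cases[OF x] bp interior_point_C2_imp_C1[OF interior_point_C2_annulus[OF _ ann]] unfolding p by blast
  next
    fix p assume "p \<in> surface D - ?\<Lambda>"
    then show "interior_point C2_on (surface D) p \<or> boundary_point C2_on (surface D) p"
      unfolding diff using interior_point_C2_annulus[OF _ ann] by (auto simp: surface_def)
  next
    have "hausdorff_null CARD('n) (sphere (0 :: real ^ 'n) r0)"
      using hausdorff_null_negligible[OF bounded_sphere negligible_sphere, of "0 :: real ^ 'n" r0] by simp
    from hausdorff_null_isometric_image[OF this, of "\<lambda>y. (y, 0 :: real)"]
    have "hausdorff_null CARD('n) ((\<lambda>y. (y, 0 :: real)) ` sphere (0 :: real ^ 'n) r0)"
      by (simp add: dist_Pair_Pair)
    moreover have "(\<lambda>y. (y, 0 :: real)) ` sphere (0 :: real ^ 'n) r0 = ?\<Lambda>" by auto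
    ultimately show "hausdorff_null CARD('n) ?\<Lambda>" by simp
  qed
  moreover have "gauss_curvature \<epsilon> (surface D) normal p (angle \<epsilon> normal p)" if "p \<in> surface D - ?\<Lambda>" for p
    using that gauss_curvature_annulus[OF _ ann m] unfolding diff by (auto simp: surface_def)
  ultimately show "n_translator \<epsilon> (surface D) normal ?\<Lambda>"
    unfolding n_translator_def using N by blast
  show "rotational (surface D)" unfolding D_def by (rule rotational_surface)
  show "proper_in_ambient \<epsilon> (surface D)" unfolding proper_in_ambient_def
  proof (rule closed_subset)
    show "surface D \<subseteq> ambient \<epsilon>" by (rule surface_subset_ambient) (simp add: D_def)
    show "closed (surface D)" unfolding D_def by (rule closed_surface)
  qed
  have "geo_ball \<epsilon> (geo_radius \<epsilon> r1) - geo_ball \<epsilon> (geo_radius \<epsilon> r0) = D"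
    using r0 r01 by (auto simp: geo_ball_profile D_def)
  then show "vertical_graph (surface D) (\<lambda>y. U (norm y)) (geo_ball \<epsilon> (geo_radius \<epsilon> r1) - geo_ball \<epsilon> (geo_radius \<epsilon> r0))"
    using vertical_graph_surface[of D] xD by simp
  show "surface D \<subseteq> {p. 0 \<le> snd p}"
    using U_nonneg by (auto simp: surface_def D_def)
  show "\<not> bdd_above (snd ` surface D)" by (rule height_unbounded[OF ann])
  show "vertically_asymptotic \<epsilon> (surface D) (geo_sphere \<epsilon> (geo_radius \<epsilon> r1) \<times> UNIV)"
    using vertically_asymptotic_surface[OF ann] r1_pos by (simp add: geo_sphere_profile D_def)
  have bd: "hyp_boundary (surface D) = ?\<Lambda>"
  proof
    show "?\<Lambda> \<subseteq> hyp_boundary (surface D)" unfolding hyp_boundary_def using bp edge by fastforce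
    show "hyp_boundary (surface D) \<subseteq> ?\<Lambda>"
    proof
      fix p assume p: "p \<in> hyp_boundary (surface D)"
      then have "p \<in> surface D" by (simp add: hyp_boundary_def boundary_point_def)
      then obtain x where px: "p = (x, U (norm x))" and x: "x \<in> D" by (auto simp: surface_def)
      have "x \<notin> annulus"
        using not_boundary_point_graph[OF open_annulus _ ann height_has_derivative, of x] annulusD[of x] p
        unfolding px hyp_boundary_def surface_def by blast
      then have "norm x = r0" using cases[OF x] by blast
      then show "p \<in> ?\<Lambda>" using edge px by auto
    qed
  qed
  show "hyp_boundary (surface D) = geo_sphere \<epsilon> (geo_radius \<epsilon> r0) \<times> {0}"
    unfolding bd using r0 r01 by (simp add: geo_sphere_profile)
  show "hyp_boundary (surface D) \<noteq> {}" unfolding bd using exists_norm_eq[OF r0] by auto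
  show "\<forall>p \<in> hyp_boundary (surface D). tangent_space (surface D) p = {v. snd v = 0}"
  proof
    fix p assume "p \<in> hyp_boundary (surface D)"
    then obtain x where p: "p = (x, U (norm x))" and x: "norm x = r0"
      unfolding bd using edge by auto
    have "tangent_space (surface D) p = range (\<lambda>v. (v, slope (norm x) * (x \<bullet> v)))"
      unfolding p using edge[OF x] xD[of x] span[of x] by (intro tangent_space_surface) auto
    also have "\<dots> = {v. snd v = 0}" using edge[OF x] by (auto simp: image_iff)
    finally show "tangent_space (surface D) p = {v. snd v = 0}" .
  qed
qed

end

section \<open>Existence of the translators\<close>

theorem theorem5:
  fixes \<epsilon> :: real
  assumes "\<epsilon> = 0 \<or> \<epsilon> = -1"
    and "2 \<le> CARD('n::finite)" and "even CARD('n)"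
  shows
    "(\<exists>R>0. \<exists>(\<Sigma>\<^sub>0 :: 'n amb set) u N.
        n_translator \<epsilon> \<Sigma>\<^sub>0 N {} \<and>
        hyp_boundary \<Sigma>\<^sub>0 = {} \<and>
        rotational \<Sigma>\<^sub>0 \<and>
        strictly_convex \<epsilon> \<Sigma>\<^sub>0 N \<and>
        vertical_graph \<Sigma>\<^sub>0 u (geo_ball \<epsilon> R) \<and>
        \<Sigma>\<^sub>0 \<subseteq> {p. 0 \<le> snd p} \<and>
        \<not> bdd_above (snd ` \<Sigma>\<^sub>0) \<and>
        vertically_asymptotic \<epsilon> \<Sigma>\<^sub>0 (geo_sphere \<epsilon> R \<times> UNIV))
   \<and> (\<exists>K :: real \<Rightarrow> 'n amb set. \<forall>l. 0 < l \<and> l < 1 \<longrightarrow>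
        (\<exists>R>0. \<exists>u N \<Lambda>.
          n_translator \<epsilon> (K l - {(0, 0)}) N \<Lambda> \<and>
          hyp_boundary (K l - {(0, 0)}) = {} \<and>
          rotational (K l) \<and>
          proper_in_ambient \<epsilon> (K l) \<and>
          vertical_graph (K l) u (geo_ball \<epsilon> R) \<and>
          u 0 = 0 \<and> conical_singularity u 0 \<and>
          (\<exists>c. K l \<subseteq> {p. c \<le> snd p}) \<and>
          \<not> bdd_above (snd ` K l) \<and>
          vertically_asymptotic \<epsilon> (K l) (geo_sphere \<epsilon> R \<times> UNIV) \<and>
          (\<exists>\<theta> :: real \<Rightarrow> real.
             (\<forall>x \<in> geo_ball \<epsilon> R - {0}. angle \<epsilon> N (x, u x) = \<theta> (geo_dist \<epsilon> 0 x)) \<and>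
             ((\<lambda>s. (\<theta> s)\<^sup>2) \<longlongrightarrow> 1 - l\<^sup>2) (at_right 0))))
   \<and> (\<exists>G :: real \<Rightarrow> 'n amb set. \<forall>\<mu>>0.
        (\<exists>R>\<mu>. \<exists>u N \<Lambda>.
          n_translator \<epsilon> (G \<mu>) N \<Lambda> \<and>
          rotational (G \<mu>) \<and>
          proper_in_ambient \<epsilon> (G \<mu>) \<and>
          vertical_graph (G \<mu>) u (geo_ball \<epsilon> R - geo_ball \<epsilon> \<mu>) \<and>
          (\<exists>c. G \<mu> \<subseteq> {p. c \<le> snd p}) \<and>
          \<not> bdd_above (snd ` G \<mu>) \<and>
          vertically_asymptotic \<epsilon> (G \<mu>) (geo_sphere \<epsilon> R \<times> UNIV) \<and>
          hyp_boundary (G \<mu>) \<noteq> {} \<and>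
          hyp_boundary (G \<mu>) = geo_sphere \<epsilon> \<mu> \<times> {0} \<and>
          (\<forall>p \<in> hyp_boundary (G \<mu>). tangent_space (G \<mu>) p = {v. snd v = 0})))"
proof (intro conjI)
  interpret curvature_sign \<epsilon> using assms(1) by unfold_locales
  define m where "m = CARD('n) - 1"
  have m: "CARD('n) = Suc m" using assms(2) by (simp add: m_def)
  show "\<exists>R>0. \<exists>(\<Sigma>\<^sub>0 :: 'n amb set) u N.
        n_translator \<epsilon> \<Sigma>\<^sub>0 N {} \<and>
        hyp_boundary \<Sigma>\<^sub>0 = {} \<and>
        rotational \<Sigma>\<^sub>0 \<and>
        strictly_convex \<epsilon> \<Sigma>\<^sub>0 N \<and>
        vertical_graph \<Sigma>\<^sub>0 u (geo_ball \<epsilon> R) \<and>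
        \<Sigma>\<^sub>0 \<subseteq> {p. 0 \<le> snd p} \<and>
        \<not> bdd_above (snd ` \<Sigma>\<^sub>0) \<and>
        vertically_asymptotic \<epsilon> \<Sigma>\<^sub>0 (geo_sphere \<epsilon> R \<times> UNIV)"
  proof -
    obtain r1 a U where "translator_profile \<epsilon> 0 r1 0 m a U"
      using translator_profile_exists[of 0 0 m] by auto
    then interpret P: bowl_profile \<epsilon> 0 r1 0 m a U
      by (simp add: bowl_profile_def bowl_profile_axioms_def)
    show ?thesis
      by (intro exI[of _ "geo_radius \<epsilon> r1"] exI[of _ "P.surface {y. norm y < r1}"]
          exI[of _ "\<lambda>y. U (norm y)"] exI[of _ P.normal] conjI P.bowl_soliton[OF m] P.geo_radius_r1_pos)
  qed
  show "\<exists>K :: real \<Rightarrow> 'n amb set. \<forall>l. 0 < l \<and> l < 1 \<longrightarrow>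
        (\<exists>R>0. \<exists>u N \<Lambda>.
          n_translator \<epsilon> (K l - {(0, 0)}) N \<Lambda> \<and>
          hyp_boundary (K l - {(0, 0)}) = {} \<and>
          rotational (K l) \<and>
          proper_in_ambient \<epsilon> (K l) \<and>
          vertical_graph (K l) u (geo_ball \<epsilon> R) \<and>
          u 0 = 0 \<and> conical_singularity u 0 \<and>
          (\<exists>c. K l \<subseteq> {p. c \<le> snd p}) \<and>
          \<not> bdd_above (snd ` K l) \<and>
          vertically_asymptotic \<epsilon> (K l) (geo_sphere \<epsilon> R \<times> UNIV) \<and>
          (\<exists>\<theta> :: real \<Rightarrow> real.
             (\<forall>x \<in> geo_ball \<epsilon> R - {0}. angle \<epsilon> N (x, u x) = \<theta> (geo_dist \<epsilon> 0 x)) \<and>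
             ((\<lambda>s. (\<theta> s)\<^sup>2) \<longlongrightarrow> 1 - l\<^sup>2) (at_right 0)))"
  proof (rule choice, intro allI)
    fix l :: real
    show "\<exists>K :: 'n amb set. 0 < l \<and> l < 1 \<longrightarrow>
        (\<exists>R>0. \<exists>u N \<Lambda>.
          n_translator \<epsilon> (K - {(0, 0)}) N \<Lambda> \<and>
          hyp_boundary (K - {(0, 0)}) = {} \<and>
          rotational K \<and>
          proper_in_ambient \<epsilon> K \<and>
          vertical_graph K u (geo_ball \<epsilon> R) \<and>
          u 0 = 0 \<and> conical_singularity u 0 \<and>
          (\<exists>c. K \<subseteq> {p. c \<le> snd p}) \<and>
          \<not> bdd_above (snd ` K) \<and>
          vertically_asymptotic \<epsilon> K (geo_sphere \<epsilon> R \<times> UNIV) \<and>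
          (\<exists>\<theta> :: real \<Rightarrow> real.
             (\<forall>x \<in> geo_ball \<epsilon> R - {0}. angle \<epsilon> N (x, u x) = \<theta> (geo_dist \<epsilon> 0 x)) \<and>
             ((\<lambda>s. (\<theta> s)\<^sup>2) \<longlongrightarrow> 1 - l\<^sup>2) (at_right 0)))"
    proof (cases "0 < l \<and> l < 1")
      case True
      define a0 where "a0 = arcsin l"
      have a0: "0 < a0" "a0 < pi / 2" "sin a0 = l"
        using True arcsin_less_arcsin[of 0 l] arcsin_less_arcsin[of l 1] by (simp_all add: a0_def)
      obtain r1 a U where "translator_profile \<epsilon> 0 r1 a0 m a U"
        using translator_profile_exists[of 0 a0 m] a0 by auto
      then interpret P: translator_profile \<epsilon> 0 r1 a0 m a U .
      note cone = P.peaked_bowl_soliton[OF m refl a0(1), unfolded a0(3)]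
      show ?thesis
        by (rule exI[of _ "P.surface {y. norm y < r1}"], rule impI, rule exI[of _ "geo_radius \<epsilon> r1"],
            intro conjI exI[of _ "\<lambda>y. U (norm y)"] exI[of _ P.normal] exI[of _ "{} :: 'n amb set"]
            exI[of _ "0 :: real"] exI[of _ "\<lambda>s. cos (a (chart_radius \<epsilon> s))"])
          (use cone P.geo_radius_r1_pos P.U_r0 P.conical_singularity_height[OF refl a0(1)] in simp_all)
    qed blast
  qed
  show "\<exists>G :: real \<Rightarrow> 'n amb set. \<forall>\<mu>>0.
        (\<exists>R>\<mu>. \<exists>u N \<Lambda>.
          n_translator \<epsilon> (G \<mu>) N \<Lambda> \<and>
          rotational (G \<mu>) \<and>
          proper_in_ambient \<epsilon> (G \<mu>) \<and>
          vertical_graph (G \<mu>) u (geo_ball \<epsilon> R - geo_ball \<epsilon> \<mu>) \<and>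
          (\<exists>c. G \<mu> \<subseteq> {p. c \<le> snd p}) \<and>
          \<not> bdd_above (snd ` G \<mu>) \<and>
          vertically_asymptotic \<epsilon> (G \<mu>) (geo_sphere \<epsilon> R \<times> UNIV) \<and>
          hyp_boundary (G \<mu>) \<noteq> {} \<and>
          hyp_boundary (G \<mu>) = geo_sphere \<epsilon> \<mu> \<times> {0} \<and>
          (\<forall>p \<in> hyp_boundary (G \<mu>). tangent_space (G \<mu>) p = {v. snd v = 0}))"
  proof (rule choice, intro allI)
    fix \<mu> :: real
    show "\<exists>G :: 'n amb set. 0 < \<mu> \<longrightarrow>
        (\<exists>R>\<mu>. \<exists>u N \<Lambda>.
          n_translator \<epsilon> G N \<Lambda> \<and>
          rotational G \<and>
          proper_in_ambient \<epsilon> G \<and>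
          vertical_graph G u (geo_ball \<epsilon> R - geo_ball \<epsilon> \<mu>) \<and>
          (\<exists>c. G \<subseteq> {p. c \<le> snd p}) \<and>
          \<not> bdd_above (snd ` G) \<and>
          vertically_asymptotic \<epsilon> G (geo_sphere \<epsilon> R \<times> UNIV) \<and>
          hyp_boundary G \<noteq> {} \<and>
          hyp_boundary G = geo_sphere \<epsilon> \<mu> \<times> {0} \<and>
          (\<forall>p \<in> hyp_boundary G. tangent_space G p = {v. snd v = 0}))"
    proof (cases "0 < \<mu>")
      case True
      define r0 where "r0 = chart_radius \<epsilon> \<mu>"
      have r0: "0 \<le> r0" "0 < 1 + \<epsilon> * r0\<^sup>2 / 4" "geo_radius \<epsilon> r0 = \<mu>"
        using chart_radius[of \<mu>] True by (simp_all add: r0_def)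
      have r0_pos: "0 < r0" using r0 True by (cases "r0 = 0") auto
      obtain r1 a U where "translator_profile \<epsilon> r0 r1 0 m a U"
        using translator_profile_exists[OF r0(1,2), of 0 m] by auto
      then interpret P: translator_profile \<epsilon> r0 r1 0 m a U .
      note reaper = P.grim_reaper[OF m r0_pos refl, unfolded r0(3)]
      have "\<mu> < geo_radius \<epsilon> r1"
        using geo_radius_strict_mono[OF P.dom r0(1) P.r01] r0(3) by simp
      then show ?thesis
        by - (rule exI[of _ "P.surface {y. r0 \<le> norm y \<and> norm y < r1}"], rule impI,
            rule exI[of _ "geo_radius \<epsilon> r1"],
            intro conjI exI[of _ "\<lambda>y. U (norm y)"] exI[of _ P.normal]
            exI[of _ "{y. norm y = r0} \<times> {0 :: real}"] exI[of _ "0 :: real"] reaper)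
    qed blast
  qed
qed

end
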